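(* There exists a unique real analytic function $\kappa\colon\mathbf{R}\to\mathbf{R}$ such that $\kappa(0)=-\frac12$ and, for all $t\in\mathbf{R}$, $$e^{2\pi i\kappa(t)}=1+2\vartheta'(t)\frac{\zeta(\frac12+it)}{\zeta'(\frac12+it)},$$ where at points $t$ with $\zeta'(\frac12+it)=0$ the quotient $\zeta(\frac12+it)/\zeta'(\frac12+it)$ is understood as its real analytic extension (with value $0$; such points satisfy $\zeta(\frac12+it)=0$).
   Context: $\zeta$ is Riemann's zeta function. $\vartheta\colon\mathbf{R}\to\mathbf{R}$ is the Riemann–Siegel theta function: the real analytic function with $\vartheta(0)=0$ and $\Gamma(\frac14+\frac{it}{2})=|\Gamma(\frac14+\frac{it}{2})|\,e^{i(\vartheta(t)+\frac t2\log\pi)}$. One has $\zeta(\frac12+it)=Z(t)e^{-i\vartheta(t)}$ with $Z\colon\mathbf{R}\to\mathbf{R}$ real analytic. A function on $\mathbf{R}$ is called real analytic if near each point it is given by a convergent power series. It is known that if $\zeta'(\frac12+ia)=0$ for a real $a$, then $\zeta(\frac12+ia)=0$. *)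

theory Defs
  imports "HOL-Complex_Analysis.Complex_Analysis"
begin

definition real_analytic :: "(real \<Rightarrow> 'a::real_normed_vector) \<Rightarrow> bool" where
  "real_analytic f \<longleftrightarrow>
     (\<forall>x. \<exists>r>0. \<exists>c :: nat \<Rightarrow> 'a. \<forall>y. \<bar>y - x\<bar> < r \<longrightarrow> (\<lambda>n. (y - x) ^ n *\<^sub>R c n) sums f y)"

(* Analytic continuation of the Dirichlet series to the punctured plane, which is unique
   because the punctured plane is connected. The value 0 at the pole is a convention
   needed only to single out a total function. *)
definition riemann_zeta :: "complex \<Rightarrow> complex" where
  "riemann_zeta =
     (THE f. f holomorphic_on (- {1}) \<and>
             (\<forall>s. Re s > 1 \<longrightarrow> (\<lambda>n. 1 / of_nat (Suc n) powr s) sums f s) \<and>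
             f 1 = 0)"

definition critical_line :: "real \<Rightarrow> complex" where
  "critical_line t = 1 / 2 + \<i> * of_real t"

definition riemann_siegel_theta :: "real \<Rightarrow> real" where
  "riemann_siegel_theta =
     (THE \<theta>. real_analytic \<theta> \<and> \<theta> 0 = 0 \<and>
        (\<forall>t. Gamma (1 / 4 + \<i> * of_real t / 2) =
             of_real (cmod (Gamma (1 / 4 + \<i> * of_real t / 2))) *
             exp (\<i> * of_real (\<theta> t + t / 2 * ln pi))))"

(* The real analytic extension to the whole line of the quotient of zeta by its (complex)
   derivative along the critical line; it is unique because the zeros of the denominator
   are isolated. *)
definition zeta_quotient :: "real \<Rightarrow> complex" where
  "zeta_quotient =
     (THE q. real_analytic q \<and>
        (\<forall>t. deriv riemann_zeta (critical_line t) \<noteq> 0 \<longrightarrow>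
             q t = riemann_zeta (critical_line t) / deriv riemann_zeta (critical_line t)))"

end

(* On the critical line zeta = G xi with G = pi^(s/2) / Gamma(s/2) and xi real, and differentiating gives
   zeta' = G (- theta' xi + i X) with X real.  Hence 1 + 2 theta' zeta / zeta' = - conj B / B with
   B = - theta' xi + i X has modulus 1 and is - 1 at t = 0, where X vanishes; a real analytic map from
   the line to the circle lifts to a real analytic phase, unique once its value at 0 is fixed.

   For the quotient to extend, zeta' may vanish only where zeta does.  If zeta' = 0 and xi is nonzero, then
   theta' = 0 and X = 0.  Telescoping bounds for the digamma series show that theta'(t) = 0 forces
   |t^2/4 - pi^2| <= 3/16, and there X is nonzero: xi and X are a cosine and a sine transform of the kernel
   exp(u/4) (exp(-pi exp u) + exp(-4 pi exp u) + ...), which a polynomial certificate bounds sharply enough.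
   The representation of xi rests on the transformation formula of the theta function. *)
theory Submission
  imports Defs "HOL-Real_Asymp.Real_Asymp"
begin

section \<open>Polya's proof of the theta transformation\<close>

text \<open>The obstacle is that theta' really vanishes, near t = 2 pi and t = - 2 pi. There the
  real part of zeta' / G says nothing, and only a numerical estimate of X can help. Put y = t / 2,
  let C and S be the cosine and sine transforms, D = 1/4 + t^2, and P half the imaginary part of the
  digamma function at 1/4 + i y. Then - X = (2 C - 1/D) P - S + 4 y / D^2. The total mass of the
  kernel already gives 2 C <= 1/D, so P may be replaced by its lower bound 81/100. What remains to
  be bounded is the single combination 162/100 C - S; treating it as one integral avoids adding up
  two separate errors. At the upper end of the range of y the final slack is below one percent, and
  this dictates the precision of the constants along the way. Polya's route to the theta
  transformation uses only finite trigonometric sums and dominated termwise limits, with no Fourier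
  analysis.\<close>

lemma sum_cis_roots_of_unity:
  fixes l :: nat and d :: int
  assumes l: "l > 0"
  shows "(\<Sum>j<l. cis (2 * pi * of_int d / l * j)) = (if int l dvd d then of_nat l else 0)"
proof -
  define w where "w = cis (2 * pi * of_int d / l)"
  have pow: "cis (2 * pi * of_int d / l * j) = w ^ j" for j
    unfolding w_def Complex.DeMoivre by (intro arg_cong[where f = cis]) (simp add: field_simps)
  have wl: "w ^ l = 1"
    using l by (simp add: w_def Complex.DeMoivre cis_multiple_2pi)
  have w1: "w = 1 \<longleftrightarrow> int l dvd d"
  proof
    assume "w = 1"
    then obtain n :: int where n: "2 * pi * of_int d / l = of_int n * (2 * pi)"
      unfolding w_def cis_conv_exp exp_eq_1 by (auto simp: mult_ac)
    hence "real_of_int d = of_int n * real l"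
      using l by (simp add: field_simps)
    hence "d = n * int l"
      by (metis of_int_eq_iff of_int_mult of_int_of_nat_eq)
    thus "int l dvd d" by simp
  next
    assume "int l dvd d"
    then obtain k where "d = int l * k" by (elim dvdE)
    hence "2 * pi * of_int d / l = 2 * pi * of_int k" using l by simp
    thus "w = 1" unfolding w_def by (simp only: cis_multiple_2pi Ints_of_int)
  qed
  show ?thesis
  proof (cases "int l dvd d")
    case True
    with w1 show ?thesis unfolding pow by simp
  next
    case False
    with w1 wl show ?thesis unfolding pow by (simp add: geometric_sum)
  qed
qed

lemma cos_even_power_expansion:
  "complex_of_real ((2 * cos x) ^ (2 * m)) =
     (\<Sum>k\<le>2*m. of_nat ((2 * m) choose k) * cis (2 * x * (real k - real m)))"
proof -
  have "complex_of_real (2 * cos x) = cis x + cis (-x)"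
    by (simp add: complex_eq_iff)
  hence "complex_of_real ((2 * cos x) ^ (2 * m)) = (cis x + cis (-x)) ^ (2 * m)"
    by (metis of_real_power)
  also have "\<dots> = (\<Sum>k\<le>2*m. of_nat ((2 * m) choose k) * cis x ^ k * cis (-x) ^ (2 * m - k))"
    by (rule binomial_ring)
  also have "\<dots> = (\<Sum>k\<le>2*m. of_nat ((2 * m) choose k) * cis (2 * x * (real k - real m)))"
  proof (intro sum.cong refl)
    fix k assume k: "k \<in> {..2*m}"
    have "cis x ^ k * cis (-x) ^ (2 * m - k) = cis (2 * x * (real k - real m))"
      unfolding Complex.DeMoivre cis_mult
      by (intro arg_cong[where f = cis]) (use k in \<open>simp add: of_nat_diff algebra_simps\<close>)
    thus "of_nat ((2 * m) choose k) * cis x ^ k * cis (-x) ^ (2 * m - k) = of_nat ((2 * m) choose k) * cis (2 * x * (real k - real m))"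
      by (simp add: mult.assoc)
  qed
  finally show ?thesis .
qed

text \<open>A finite form of Poisson summation. Expanding the power into exponentials and summing
  over the l-th roots of unity keeps exactly the binomial coefficients whose index is congruent to m
  modulo l. The symmetry of the row then folds m - j l onto m + j l.\<close>

lemma cos_power_multisection:
  fixes l m :: nat
  assumes l: "l > 0"
  shows "(\<Sum>j<l. (2 * cos (pi * j / l)) ^ (2 * m)) =
           real l * (real ((2 * m) choose m) +
             2 * (\<Sum>j | j \<ge> 1 \<and> j * l \<le> m. real ((2 * m) choose (m + j * l))))"
proof -
  define J where "J = {j::nat. j \<ge> 1 \<and> j * l \<le> m}"
  have finJ: "finite J"
  proof (rule finite_subset)
    show "J \<subseteq> {..m}"
    proof
      fix j assume "j \<in> J"
      hence "j * l \<le> m" by (auto simp: J_def)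
      moreover have "j * 1 \<le> j * l" using l by (intro mult_le_mono) auto
      ultimately have "j \<le> m" by linarith
      thus "j \<in> {..m}" by simp
    qed
  qed auto
  let ?S = "{k. k \<le> 2 * m \<and> int l dvd int k - int m}"
  let ?A = "(\<lambda>j. m + j * l) ` J" and ?B = "(\<lambda>j. m - j * l) ` J"
  have S: "?S = {m} \<union> (?A \<union> ?B)"
  proof (intro equalityI subsetI)
    fix k assume "k \<in> ?S"
    hence k: "k \<le> 2 * m" "int l dvd int k - int m" by auto
    then obtain c where c: "int k - int m = int l * c" by (elim dvdE)
    show "k \<in> {m} \<union> (?A \<union> ?B)"
    proof (cases "c = 0")
      case True with c show ?thesis by simp
    next
      case c0: False
      show ?thesis
      proof (cases "c > 0")
        case True
        have "int k = int (m + nat c * l)" using c True by (simp add: algebra_simps)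
        hence k': "k = m + nat c * l" by (simp only: of_nat_eq_iff)
        with k True have "nat c \<in> J" by (auto simp: J_def)
        with k' show ?thesis by blast
      next
        case False
        have e: "int m = int (k + nat (-c) * l)" using c False by (simp add: algebra_simps)
        hence e: "m = k + nat (-c) * l" by (simp only: of_nat_eq_iff)
        hence "nat (-c) \<in> J" using c0 False by (auto simp: J_def)
        moreover have "k = m - nat (-c) * l" using e by simp
        ultimately show ?thesis by blast
      qed
    qed
  next
    fix k assume "k \<in> {m} \<union> (?A \<union> ?B)"
    thus "k \<in> ?S" by (auto simp: J_def of_nat_diff)
  qed
  have injA: "inj_on (\<lambda>j. m + j * l) J" using l by (auto simp: inj_on_def)
  have injB: "inj_on (\<lambda>j. m - j * l) J"
  proof (rule inj_onI)
    fix x y assume "x \<in> J" "y \<in> J" "m - x * l = m - y * l"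
    hence "x * l = y * l" unfolding J_def mem_Collect_eq by linarith
    thus "x = y" using l by simp
  qed
  have pos: "j * l > 0" if "j \<in> J" for j using that l by (auto simp: J_def)
  have sumS: "(\<Sum>k\<in>?S. real ((2 * m) choose k)) =
      real ((2 * m) choose m) + 2 * (\<Sum>j\<in>J. real ((2 * m) choose (m + j * l)))"
  proof -
    have "(\<Sum>k\<in>?S. real ((2 * m) choose k)) =
        real ((2 * m) choose m) + (\<Sum>k\<in>?A \<union> ?B. real ((2 * m) choose k))"
    proof -
      have "m \<noteq> m + j * l \<and> m \<noteq> m - j * l" if "j \<in> J" for j
        using pos[OF that] that unfolding J_def mem_Collect_eq by linarith
      hence "{m} \<inter> (?A \<union> ?B) = {}" by blast
      thus ?thesis unfolding S using finJ by (subst sum.union_disjoint) auto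
    qed
    also have "(\<Sum>k\<in>?A \<union> ?B. real ((2 * m) choose k)) =
       (\<Sum>k\<in>?A. real ((2 * m) choose k)) + (\<Sum>k\<in>?B. real ((2 * m) choose k))"
    proof (rule sum.union_disjoint)
      show "?A \<inter> ?B = {}"
      proof -
        have "m + i * l \<noteq> m - j * l" if "i \<in> J" "j \<in> J" for i j
          using pos[OF that(1)] by linarith
        thus ?thesis by blast
      qed
    qed (use finJ in auto)
    also have "(\<Sum>k\<in>?A. real ((2 * m) choose k)) = (\<Sum>j\<in>J. real ((2 * m) choose (m + j * l)))"
      by (subst sum.reindex[OF injA]) simp
    also have "(\<Sum>k\<in>?B. real ((2 * m) choose k)) = (\<Sum>j\<in>J. real ((2 * m) choose (m + j * l)))"
    proof (subst sum.reindex[OF injB], intro sum.cong refl, simp only: o_def)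
      fix j assume "j \<in> J"
      hence j: "j * l \<le> m" by (simp add: J_def)
      hence "(2 * m) choose (m - j * l) = (2 * m) choose (2 * m - (m - j * l))"
        by (intro binomial_symmetric) auto
      also have "2 * m - (m - j * l) = m + j * l" using j by simp
      finally show "real ((2 * m) choose (m - j * l)) = real ((2 * m) choose (m + j * l))" by simp
    qed
    finally show ?thesis by simp
  qed
  have "complex_of_real (\<Sum>j<l. (2 * cos (pi * j / l)) ^ (2 * m)) =
        (\<Sum>j<l. \<Sum>k\<le>2*m. of_nat ((2 * m) choose k) * cis (2 * pi * of_int (int k - int m) / l * j))"
    unfolding of_real_sum by (intro sum.cong refl, subst cos_even_power_expansion)
      (simp add: mult_ac)
  also have "\<dots> = (\<Sum>k\<le>2*m. of_nat ((2 * m) choose k) * (if int l dvd int k - int m then of_nat l else 0))"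
    unfolding sum_cis_roots_of_unity[OF l, symmetric] sum_distrib_left by (rule sum.swap)
  also have "\<dots> = (\<Sum>k\<in>?S. of_nat l * of_nat ((2 * m) choose k))"
    by (rule sum.mono_neutral_cong_right) auto
  also have "\<dots> = of_real (real l * (\<Sum>k\<in>?S. real ((2 * m) choose k)))"
    by (simp add: sum_distrib_left)
  finally have "(\<Sum>j<l. (2 * cos (pi * j / l)) ^ (2 * m)) = real l * (\<Sum>k\<in>?S. real ((2 * m) choose k))"
    by (simp only: of_real_eq_iff)
  thus ?thesis unfolding sumS J_def .
qed

text \<open>The even power is invariant under x -> pi - x, which exchanges j and l - j for l = 2 r +
  1. As l is odd, only j = 0 stays unpaired. The surviving angles lie below pi / 2, as the
  domination of the sum by a geometric series requires.\<close>

lemma odd_cos_power_sum: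
  fixes r m :: nat
  assumes "m > 0"
  shows "(\<Sum>j<2*r+1. (cos (pi * j / (2 * r + 1))) ^ (2 * m)) =
           1 + 2 * (\<Sum>j::nat=1..r. (cos (pi * j / (2 * r + 1))) ^ (2 * m))"
proof -
  let ?f = "\<lambda>j::nat. (cos (pi * j / (2 * r + 1))) ^ (2 * m)"
  have "{..<2*r+1} = {0} \<union> ({1..r} \<union> {r+1..2*r})" by auto
  hence "(\<Sum>j<2*r+1. ?f j) = ?f 0 + ((\<Sum>j=1..r. ?f j) + (\<Sum>j=r+1..2*r. ?f j))"
    by (simp add: sum.union_disjoint)
  also have "(\<Sum>j=r+1..2*r. ?f j) = (\<Sum>j=1..r. ?f j)"
  proof (rule sum.reindex_bij_witness[of _ "\<lambda>j. 2 * r + 1 - j" "\<lambda>j. 2 * r + 1 - j"])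
    fix j assume j: "j \<in> {r+1..2*r}"
    have "cos (pi * real (2 * r + 1 - j) / (2 * r + 1)) = cos (pi - pi * j / (2 * r + 1))"
      using j by (intro arg_cong[where f = cos]) (simp add: of_nat_diff field_simps)
    thus "?f (2 * r + 1 - j) = ?f j" by simp
  qed auto
  finally show ?thesis using assms by simp
qed

section \<open>Limits of powers, central binomial coefficients and their ratios\<close>

lemma one_minus_power_tendsto_exp:
  fixes a :: "nat \<Rightarrow> real" and k :: "nat \<Rightarrow> nat"
  assumes a: "a \<longlonglongrightarrow> 0" and ka: "(\<lambda>n. real (k n) * a n) \<longlonglongrightarrow> c"
  shows "(\<lambda>n. (1 - a n) ^ k n) \<longlonglongrightarrow> exp (- c)"
proof -
  \<comment> \<open>The quotient ln (1 - x) / x with its removable singularity filled in, so that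
    indices with \<open>a n = 0\<close> are covered as well.\<close>
  define g :: "real \<Rightarrow> real" where "g = (\<lambda>x. if x = 0 then - 1 else ln (1 - x) / x)"
  have "((\<lambda>x::real. ln (1 - x) / x) \<longlongrightarrow> - 1) (at 0)" by real_asymp
  hence "(g \<longlongrightarrow> g 0) (at 0)"
    by (subst tendsto_cong[where g = "\<lambda>x. ln (1 - x) / x"]) (auto simp: g_def eventually_at_filter)
  hence "isCont g 0" by (simp add: isCont_def)
  hence "(\<lambda>n. g (a n)) \<longlonglongrightarrow> g 0" using a isCont_tendsto_compose by blast
  hence "(\<lambda>n. exp ((real (k n) * a n) * g (a n))) \<longlonglongrightarrow> exp (c * g 0)"
    by (intro tendsto_intros ka)
  moreover have "eventually (\<lambda>n. exp ((real (k n) * a n) * g (a n)) = (1 - a n) ^ k n) sequentially"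
    using order_tendstoD(2)[OF a, of 1, simplified]
  proof eventually_elim
    case (elim n)
    have "(real (k n) * a n) * g (a n) = real (k n) * ln (1 - a n)" by (simp add: g_def)
    hence "exp ((real (k n) * a n) * g (a n)) = exp (real (k n) * ln (1 - a n))"
      by (rule arg_cong)
    also have "\<dots> = exp (ln (1 - a n)) ^ k n" by (rule exp_of_nat_mult)
    finally have "exp ((real (k n) * a n) * g (a n)) = exp (ln (1 - a n)) ^ k n" .
    with elim show ?case by simp
  qed
  ultimately show ?thesis by (simp add: g_def tendsto_cong)
qed

text \<open>The normalised coefficient equals the Pochhammer symbol of 1/2 over the factorial, hence
  is essentially the reciprocal of Gauss's product for Gamma (1/2) = sqrt pi. The product runs one
  factor further, which the quotient m / (m + 1/2) compensates.\<close>

lemma central_binomial_asymptotic: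
  "(\<lambda>m. real ((2 * m) choose m) * sqrt m / 4 ^ m) \<longlonglongrightarrow> 1 / sqrt pi"
proof -
  have choose: "real ((2 * m) choose m) / 4 ^ m = pochhammer (1/2) m / fact m" for m
  proof -
    have "real ((2 * m) choose m) = fact (2 * m) / (fact m * fact m)"
      by (subst binomial_fact) auto
    also have "\<dots> = 4 ^ m * pochhammer (1/2) m / fact m"
      by (simp add: fact_double power_mult[of 2 2, simplified])
    finally show ?thesis by simp
  qed
  have "(\<lambda>m. real m / (real m + 1/2) / Gamma_series (1/2) m) \<longlonglongrightarrow> 1 / Gamma (1/2)"
  proof (intro tendsto_divide Gamma_series_LIMSEQ)
    show "(\<lambda>m. real m / (real m + 1/2)) \<longlonglongrightarrow> 1" by real_asymp
  qed (auto simp: Gamma_one_half_real)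
  moreover have "eventually (\<lambda>m. real m / (real m + 1/2) / Gamma_series (1/2) m =
       real ((2 * m) choose m) * sqrt m / 4 ^ m) sequentially"
    using eventually_gt_at_top[of 0]
  proof eventually_elim
    case (elim m)
    have "exp (1/2 * ln (real m)) = sqrt m"
      using elim by (simp add: powr_def[symmetric] powr_half_sqrt[symmetric] powr_def)
    hence "Gamma_series (1/2) m = fact m * sqrt m / (pochhammer (1/2) m * (real m + 1/2))"
      by (simp add: Gamma_series_def pochhammer_Suc add.commute)
    moreover have "real m = sqrt m * sqrt m" by simp
    moreover have "pochhammer (1/2::real) m > 0" by (intro pochhammer_pos) auto
    moreover have "sqrt m > 0" using elim by simp
    ultimately have "real m / (real m + 1/2) / Gamma_series (1/2) m =
        (sqrt m * sqrt m) / (real m + 1/2) / (fact m * sqrt m / (pochhammer (1/2) m * (real m + 1/2)))"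
      by simp
    also have "\<dots> = pochhammer (1/2) m / fact m * sqrt m"
    proof -
      have *: "(q * q) / h / (f * q / (p * h)) = p / f * q" if "q > 0" "h > 0" "f > 0" "p > 0" for q h f p :: real
        using that by (simp add: field_simps)
      show ?thesis
        by (rule *) (use \<open>sqrt m > 0\<close> \<open>pochhammer (1/2::real) m > 0\<close> in auto)
    qed
    finally have "real m / (real m + 1/2) / Gamma_series (1/2) m = pochhammer (1/2) m / fact m * sqrt m" .
    thus ?case unfolding choose[of m, symmetric] by simp
  qed
  ultimately show ?thesis by (simp add: tendsto_cong Gamma_one_half_real)
qed

lemma sin_ge_cubic:
  fixes x :: real
  assumes "x \<ge> 0"
  shows "x - x ^ 3 / 6 \<le> sin x"
proof -
  have c: "1 - t\<^sup>2 / 2 \<le> cos t" if "t \<ge> 0" for t :: real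
  proof -
    have "cos 0 - (1 - 0\<^sup>2 / 2) \<le> cos t - (1 - t\<^sup>2 / 2)"
      by (rule DERIV_nonneg_imp_nondecreasing[OF that])
         (auto intro!: exI derivative_eq_intros simp: sin_x_le_x)
    thus ?thesis by simp
  qed
  have "sin 0 - (0 - 0 ^ 3 / 6) \<le> sin x - (x - x ^ 3 / 6)"
    by (rule DERIV_nonneg_imp_nondecreasing[OF assms])
       (auto intro!: exI derivative_eq_intros simp: c[unfolded power2_eq_square] power2_eq_square)
  thus ?thesis by simp
qed

lemma cos_le_quartic:
  fixes x :: real
  assumes "x \<ge> 0"
  shows "cos x \<le> 1 - x\<^sup>2 / 2 + x ^ 4 / 24"
proof -
  have "(1 - 0\<^sup>2 / 2 + 0 ^ 4 / 24) - cos 0 \<le> (1 - x\<^sup>2 / 2 + x ^ 4 / 24) - cos x"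
  proof (rule DERIV_nonneg_imp_nondecreasing[OF assms])
    fix t :: real assume t: "0 \<le> t" "t \<le> x"
    have "((\<lambda>x. (1 - x\<^sup>2 / 2 + x ^ 4 / 24) - cos x) has_real_derivative (- t + t ^ 3 / 6 + sin t)) (at t)"
      by (auto intro!: derivative_eq_intros)
    moreover have "- t + t ^ 3 / 6 + sin t \<ge> 0" using sin_ge_cubic[OF t(1)] by simp
    ultimately show "\<exists>y. ((\<lambda>x. (1 - x\<^sup>2 / 2 + x ^ 4 / 24) - cos x) has_real_derivative y) (at t) \<and> 0 \<le> y"
      by blast
  qed
  thus ?thesis by simp
qed

lemma central_binomial_ratio:
  assumes "k \<le> m"
  shows "real ((2 * m) choose (m + k)) / real ((2 * m) choose m) = (\<Prod>i=1..k. 1 - real k / real (m + i))"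
proof -
  have F: "fact (n + k) = (fact n * (\<Prod>i=1..k. real (n + i)) :: real)" for n k
    by (induction k) (auto simp: algebra_simps)
  have "real ((2 * m) choose (m + k)) = fact (2 * m) / (fact (m + k) * fact (m - k))"
    using assms by (subst binomial_fact) (auto simp: mult_2)
  moreover have "real ((2 * m) choose m) = fact (2 * m) / (fact m * fact m)"
    by (subst binomial_fact) auto
  ultimately have "real ((2 * m) choose (m + k)) / real ((2 * m) choose m) =
      (fact m / fact (m - k)) / (fact (m + k) / fact m)"
    by simp
  also have "fact m / fact (m - k) = (\<Prod>i=1..k. real (m - k + i))"
    using F[of "m - k" k] assms by (simp add: field_simps)
  also have "fact (m + k) / fact m = (\<Prod>i=1..k. real (m + i))"
    using F[of m k] by (simp add: field_simps)
  also have "(\<Prod>i=1..k. real (m - k + i)) / (\<Prod>i=1..k. real (m + i)) = (\<Prod>i=1..k. real (m - k + i) / real (m + i))"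
    by (rule prod_dividef[symmetric])
  also have "\<dots> = (\<Prod>i=1..k. 1 - real k / real (m + i))"
    using assms by (intro prod.cong refl) (auto simp: field_simps of_nat_diff)
  finally show ?thesis .
qed

text \<open>In the product for the ratio the factors increase with i, so each lies between the one
  for i = 1 and the one for i = k. When k has the order of sqrt m both extreme powers have the same
  Gaussian limit.\<close>

lemma central_binomial_ratio_le:
  assumes "k \<le> m" "m > 0"
  shows "real ((2 * m) choose (m + k)) / real ((2 * m) choose m) \<le> (1 - real k / real (m + k)) ^ k"
    and "(1 - real k / real (m + 1)) ^ k \<le> real ((2 * m) choose (m + k)) / real ((2 * m) choose m)"
proof -
  have "(\<Prod>i=1..k. 1 - real k / real (m + i)) \<le> (\<Prod>i=1..k. 1 - real k / real (m + k))"
    using assms by (intro prod_mono) (auto simp: frac_le)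
  thus "real ((2 * m) choose (m + k)) / real ((2 * m) choose m) \<le> (1 - real k / real (m + k)) ^ k"
    using assms by (simp add: central_binomial_ratio)
  have "(\<Prod>i=1..k. 1 - real k / real (m + 1)) \<le> (\<Prod>i=1..k. 1 - real k / real (m + i))"
    using assms by (intro prod_mono) (auto intro!: divide_left_mono)
  thus "(1 - real k / real (m + 1)) ^ k \<le> real ((2 * m) choose (m + k)) / real ((2 * m) choose m)"
    using assms by (simp add: central_binomial_ratio)
qed

text \<open>A bound uniform in k and m, obtained from m + k <= 2 m; it loses a factor 2 in the
  exponent but serves as a summable majorant.\<close>

lemma central_binomial_ratio_le_exp:
  assumes "k \<le> m" "m > 0"
  shows "real ((2 * m) choose (m + k)) / real ((2 * m) choose m) \<le> exp (- (real k)\<^sup>2 / (2 * real m))"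
proof -
  have "real ((2 * m) choose (m + k)) / real ((2 * m) choose m) \<le> (1 - real k / real (m + k)) ^ k"
    by (rule central_binomial_ratio_le[OF assms])
  also have "\<dots> \<le> exp (- (real k / real (m + k))) ^ k"
    using assms exp_ge_add_one_self[of "- (real k / real (m + k))"] by (intro power_mono) auto
  also have "\<dots> = exp (- ((real k)\<^sup>2 / real (m + k)))"
    by (simp add: exp_of_nat_mult[symmetric] power2_eq_square)
  also have "\<dots> \<le> exp (- (real k)\<^sup>2 / (2 * real m))"
    using assms by (auto intro!: divide_left_mono)
  finally show ?thesis .
qed

text \<open>Both sides of \<open>cos_power_multisection\<close>, divided by \<open>4\<^sup>m\<close>, converge termwise to the two Gaussian sums
  when \<open>l = 2 r + 1 \<rightarrow> \<infinity>\<close> and \<open>m \<sim> s l\<^sup>2 / \<pi>\<^sup>2\<close>.\<close>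

lemma gaussian_sum_transform:
  fixes s :: real
  assumes s: "s > 0"
  shows "1 + 2 * (\<Sum>n. exp (- s * (real (Suc n))\<^sup>2)) =
           sqrt (pi / s) * (1 + 2 * (\<Sum>n. exp (- (pi\<^sup>2 / s) * (real (Suc n))\<^sup>2)))"
proof -
  \<comment> \<open>Heuristically cos (pi j / l) to the power 2 m behaves like exp (- m (pi j /
    l)^2), so m / l^2 has to tend to s / pi^2 for the limit exp (- s j^2).\<close>
  define c where "c = s / pi\<^sup>2"
  have c: "c > 0" using s by (simp add: c_def)
  define l :: "nat \<Rightarrow> nat" where "l = (\<lambda>r. 2 * r + 1)"
  define m :: "nat \<Rightarrow> nat" where "m = (\<lambda>r. nat \<lceil>c * (real (l r))\<^sup>2\<rceil>)"
  have l: "l r \<ge> 1" for r by (simp add: l_def)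
  have l2: "(real (l r))\<^sup>2 > 0" for r by (simp add: l_def)
  have m_ge: "c * (real (l r))\<^sup>2 \<le> real (m r)" for r
    unfolding m_def by linarith
  have m_le: "real (m r) \<le> c * (real (l r))\<^sup>2 + 1" for r
  proof -
    have "c * (real (l r))\<^sup>2 \<ge> 0" using c by simp
    thus ?thesis unfolding m_def by linarith
  qed
  have m_pos: "m r > 0" for r
  proof -
    have "0 < c * (real (l r))\<^sup>2" using c l[of r] by simp
    with m_ge[of r] have "real (m r) > 0" by linarith
    thus ?thesis by simp
  qed
  have lim1: "(\<lambda>r. real (m r) / (real (l r))\<^sup>2) \<longlonglongrightarrow> c"
  proof (rule real_tendsto_sandwich)
    show "\<forall>\<^sub>F r in sequentially. c \<le> real (m r) / (real (l r))\<^sup>2"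
      using m_ge l2 by (intro always_eventually allI) (simp add: pos_le_divide_eq)
    show "\<forall>\<^sub>F r in sequentially. real (m r) / (real (l r))\<^sup>2 \<le> c + 1 / (real (l r))\<^sup>2"
      using m_le l2 by (intro always_eventually allI) (simp add: field_simps)
    show "(\<lambda>r. c + 1 / (real (l r))\<^sup>2) \<longlonglongrightarrow> c" unfolding l_def by real_asymp
  qed auto
  have lim2: "(\<lambda>r. (real (l r))\<^sup>2 / real (m r)) \<longlonglongrightarrow> 1 / c"
    using tendsto_inverse[OF lim1] c by (simp add: inverse_eq_divide)
  have m_top: "filterlim m at_top sequentially"
  proof -
    have "filterlim (\<lambda>r. real (m r)) at_top sequentially"
    proof (rule filterlim_at_top_mono)
      show "\<forall>\<^sub>F r in sequentially. c * (real (l r))\<^sup>2 \<le> real (m r)" using m_ge by simp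
      show "filterlim (\<lambda>r. c * (real (l r))\<^sup>2) at_top sequentially" unfolding l_def using c by real_asymp
    qed
    thus ?thesis using filterlim_sequentially_iff_filterlim_real by blast
  qed

  \<comment> \<open>The finite sum, whose length grows with r, is padded with zeros to an infinite
    series so that Tannery's theorem applies; \<open>b\<close> does the same for the binomial
    side.\<close>
  define a where "a = (\<lambda>k r. if Suc k \<le> r then cos (pi * Suc k / l r) ^ (2 * m r) else 0)"
  have a_sum: "(\<Sum>k. a k r) = (\<Sum>j::nat=1..r. cos (pi * j / (2 * r + 1)) ^ (2 * m r))" for r
  proof -
    have "(\<Sum>k. a k r) = (\<Sum>k<r. a k r)" by (rule suminf_finite) (auto simp: a_def)
    also have "\<dots> = (\<Sum>k<r. cos (pi * Suc k / (2 * r + 1)) ^ (2 * m r))"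
      by (intro sum.cong) (auto simp: a_def l_def)
    finally show ?thesis by (simp add: sum.atLeast1_atMost_eq)
  qed
  have a_lim: "(\<lambda>r. \<Sum>k. a k r) \<longlonglongrightarrow> (\<Sum>k. exp (- s * (real (Suc k))\<^sup>2))"
  proof (rule tannerys_theorem[THEN conjunct2, THEN conjunct2])
    show "summable (\<lambda>k. exp (- s / 4) ^ k)" using s by (intro summable_geometric) auto
    show "\<forall>\<^sub>F (k, r) in at_top \<times>\<^sub>F sequentially. norm (a k r) \<le> exp (- s / 4) ^ k"
    proof (rule always_eventually, safe)
      fix k r
      show "norm (a k r) \<le> exp (- s / 4) ^ k"
      proof (cases "Suc k \<le> r")
        case True
        define x where "x = pi * Suc k / l r"
        have "real (Suc k) / real (l r) \<le> 1 / 2" using True by (simp add: l_def field_simps)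
        hence "pi * (real (Suc k) / real (l r)) \<le> pi * (1 / 2)" by (intro mult_left_mono) auto
        hence "x \<le> pi / 2" by (simp add: x_def)
        hence x: "0 \<le> x" "x \<le> 1.6" using pi_approx by (auto simp: x_def)
        \<comment> \<open>This yields sin x >= x / 2 on the whole range of angles, so 1 - (sin x)^2
          <= exp (- (sin x)^2) decays fast enough for a geometric majorant.\<close>
        have "x ^ 3 / 6 \<le> x / 2"
        proof -
          have "x * (x * x) \<le> x * (1.6 * 1.6)" using x by (intro mult_left_mono mult_mono) auto
          thus ?thesis using x by (simp add: power3_eq_cube)
        qed
        hence "x / 2 \<le> sin x" using sin_ge_cubic[OF x(1)] by linarith
        hence "(x / 2)\<^sup>2 \<le> (sin x)\<^sup>2" using x by (intro power_mono) auto
        moreover have "s / 4 * k \<le> real (m r) * (x / 2)\<^sup>2"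
        proof -
          have "s / 4 * real k \<le> s / 4 * (real (Suc k))\<^sup>2"
            using s by (intro mult_left_mono) (auto simp: power2_eq_square algebra_simps)
          also have "\<dots> = (c * (real (l r))\<^sup>2) * (x / 2)\<^sup>2"
            using l[of r] by (simp add: c_def x_def field_simps power2_eq_square)
          also have "\<dots> \<le> real (m r) * (x / 2)\<^sup>2" by (intro mult_right_mono m_ge) auto
          finally show ?thesis .
        qed
        ultimately have *: "s / 4 * k \<le> real (m r) * (sin x)\<^sup>2"
          by (meson mult_left_mono of_nat_0_le_iff order_trans)
        have "norm (a k r) = ((cos x)\<^sup>2) ^ m r"
          using True by (simp add: a_def x_def power_mult)
        also have "\<dots> = (1 - (sin x)\<^sup>2) ^ m r" by (simp only: cos_squared_eq)
        also have "\<dots> \<le> exp (- (sin x)\<^sup>2) ^ m r"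
          using exp_ge_add_one_self[of "- (sin x)\<^sup>2"] by (intro power_mono) (auto simp: abs_square_le_1)
        also have "\<dots> = exp (- (real (m r) * (sin x)\<^sup>2))"
          by (simp add: exp_of_nat_mult[symmetric])
        also have "\<dots> \<le> exp (- (s / 4 * k))" using * by simp
        also have "\<dots> = exp (- s / 4) ^ k" by (simp add: exp_of_nat_mult[symmetric] mult.commute)
        finally show ?thesis .
      qed (simp add: a_def)
    qed
    fix k
    let ?x = "\<lambda>r. pi * Suc k / l r"
    have x0: "?x \<longlonglongrightarrow> 0" unfolding l_def by real_asymp
    have "(\<lambda>r. (1 - (sin (?x r))\<^sup>2) ^ m r) \<longlonglongrightarrow> exp (- (s * (real (Suc k))\<^sup>2))"
    proof (rule one_minus_power_tendsto_exp)
      show "(\<lambda>r. (sin (?x r))\<^sup>2) \<longlonglongrightarrow> 0"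
        using tendsto_power[OF tendsto_sin[OF x0], of 2] by simp
      have "filterlim ?x (at 0) sequentially"
      proof -
        have "?x r \<noteq> 0" for r using l2[of r] by simp
        thus ?thesis using x0 by (simp add: filterlim_at)
      qed
      moreover have "((\<lambda>x::real. (sin x / x)\<^sup>2) \<longlongrightarrow> 1) (at 0)" by real_asymp
      ultimately have "(\<lambda>r. (sin (?x r) / ?x r)\<^sup>2) \<longlonglongrightarrow> 1"
        by (rule filterlim_compose[rotated])
      hence "(\<lambda>r. (real (m r) / (real (l r))\<^sup>2) * (pi * Suc k)\<^sup>2 * (sin (?x r) / ?x r)\<^sup>2) \<longlonglongrightarrow> c * (pi * Suc k)\<^sup>2 * 1"
        by (intro tendsto_mult lim1 tendsto_const)
      also have "c * (pi * Suc k)\<^sup>2 * 1 = s * (real (Suc k))\<^sup>2"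
        by (simp add: c_def power_mult_distrib)
      also have "(\<lambda>r. (real (m r) / (real (l r))\<^sup>2) * (pi * Suc k)\<^sup>2 * (sin (?x r) / ?x r)\<^sup>2) = (\<lambda>r. real (m r) * (sin (?x r))\<^sup>2)"
        using l by (intro ext) (auto simp: power_divide power_mult_distrib divide_simps)
      finally show "(\<lambda>r. real (m r) * (sin (?x r))\<^sup>2) \<longlonglongrightarrow> s * (real (Suc k))\<^sup>2" .
    qed
    moreover have "\<forall>\<^sub>F r in sequentially. (1 - (sin (?x r))\<^sup>2) ^ m r = a k r"
      using eventually_ge_at_top[of "Suc k"]
      by eventually_elim (auto simp: a_def power_mult cos_squared_eq)
    ultimately show "(\<lambda>r. a k r) \<longlonglongrightarrow> exp (- s * (real (Suc k))\<^sup>2)"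
      by (simp add: tendsto_cong)
  qed auto

  define b where "b = (\<lambda>k r. if Suc k * l r \<le> m r
     then real ((2 * m r) choose (m r + Suc k * l r)) / real ((2 * m r) choose m r) else 0)"
  have b_sum: "(\<Sum>j | j \<ge> 1 \<and> j * l r \<le> m r. real ((2 * m r) choose (m r + j * l r))) =
      real ((2 * m r) choose m r) * (\<Sum>k. b k r)" for r
  proof -
    have "(\<Sum>k. b k r) = (\<Sum>k<m r. b k r)"
    proof (rule suminf_finite)
      fix k assume k: "k \<notin> {..<m r}"
      have "Suc k * 1 \<le> Suc k * l r" by (intro mult_le_mono l) auto
      with k show "b k r = 0" by (auto simp: b_def)
    qed auto
    also have "\<dots> = (\<Sum>k | k < m r \<and> Suc k * l r \<le> m r. real ((2 * m r) choose (m r + Suc k * l r)) / real ((2 * m r) choose m r))"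
      unfolding b_def by (rule sum.mono_neutral_cong_right) auto
    also have "\<dots> = (\<Sum>j | j \<ge> 1 \<and> j * l r \<le> m r. real ((2 * m r) choose (m r + j * l r)) / real ((2 * m r) choose m r))"
    proof (rule sum.reindex_bij_witness[of _ "\<lambda>j. j - 1" Suc])
      fix j assume j: "j \<in> {j. j \<ge> 1 \<and> j * l r \<le> m r}"
      have "j * 1 \<le> j * l r" by (intro mult_le_mono l) auto
      also have "\<dots> \<le> m r" using j by simp
      finally have "j \<le> m r" by simp
      moreover have "Suc (j - 1) = j" using j by simp
      ultimately
      show "j - 1 \<in> {k. k < m r \<and> Suc k * l r \<le> m r}" using j by (auto simp del: mult_Suc)
    qed auto
    finally show ?thesis by (simp add: sum_divide_distrib[symmetric])
  qed
  have b_lim: "(\<lambda>r. \<Sum>k. b k r) \<longlonglongrightarrow> (\<Sum>k. exp (- (pi\<^sup>2 / s) * (real (Suc k))\<^sup>2))"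
  proof (rule tannerys_theorem[THEN conjunct2, THEN conjunct2])
    \<comment> \<open>The constant c + 1 comes from m <= c l^2 + 1 <= (c + 1) l^2: the error of the
      ceiling is absorbed by l >= 1.\<close>
    let ?q = "exp (- (1 / (2 * (c + 1))))"
    show "summable (\<lambda>k. ?q ^ k)" using c by (intro summable_geometric) auto
    show "\<forall>\<^sub>F (k, r) in at_top \<times>\<^sub>F sequentially. norm (b k r) \<le> ?q ^ k"
    proof (rule always_eventually, safe)
      fix k r
      show "norm (b k r) \<le> ?q ^ k"
      proof (cases "Suc k * l r \<le> m r")
        case True
        have "1 \<le> (real (l r))\<^sup>2" using l[of r] by (intro one_le_power) simp
        hence "real (m r) \<le> c * (real (l r))\<^sup>2 + (real (l r))\<^sup>2"
          using m_le[of r] by linarith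
        hence "real (m r) \<le> (c + 1) * (real (l r))\<^sup>2" by (simp only: distrib_right mult_1)
        hence "real (m r) * real k \<le> ((c + 1) * (real (l r))\<^sup>2) * (real (Suc k))\<^sup>2"
          using c by (intro mult_mono) (auto simp: power2_eq_square algebra_simps)
        also have "\<dots> = (c + 1) * (real (Suc k * l r))\<^sup>2"
          by (simp only: of_nat_mult power_mult_distrib mult_ac)
        finally have *: "1 / (2 * (c + 1)) * k \<le> (real (Suc k * l r))\<^sup>2 / (2 * real (m r))"
          using c m_pos[of r] by (simp add: divide_simps algebra_simps del: mult_Suc of_nat_mult of_nat_Suc)
        have "norm (b k r) = real ((2 * m r) choose (m r + Suc k * l r)) / real ((2 * m r) choose m r)"
          using True by (simp add: b_def)
        also have "\<dots> \<le> exp (- (real (Suc k * l r))\<^sup>2 / (2 * real (m r)))"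
          by (rule central_binomial_ratio_le_exp[OF True m_pos])
        also have "\<dots> \<le> exp (- (1 / (2 * (c + 1)) * k))"
          using * by simp
        also have "\<dots> = ?q ^ k" by (simp add: exp_of_nat_mult[symmetric] mult.commute)
        finally show ?thesis .
      qed (simp add: b_def)
    qed
    fix k
    let ?k = "\<lambda>r. Suc k * l r"
    have kk: "(\<lambda>r. (real (?k r))\<^sup>2 / real (m r)) \<longlonglongrightarrow> (pi\<^sup>2 / s) * (real (Suc k))\<^sup>2"
    proof -
      have "(\<lambda>r. (real (l r))\<^sup>2 / real (m r) * (real (Suc k))\<^sup>2) \<longlonglongrightarrow> 1 / c * (real (Suc k))\<^sup>2"
        by (intro tendsto_mult lim2 tendsto_const)
      moreover have "(real (?k r))\<^sup>2 / real (m r) = (real (l r))\<^sup>2 / real (m r) * (real (Suc k))\<^sup>2" for r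
        unfolding of_nat_mult power_mult_distrib by simp
      moreover have "1 / c = pi\<^sup>2 / s" by (simp add: c_def)
      ultimately show ?thesis by (simp only:)
    qed
    have km: "(\<lambda>r. real (?k r) / real (m r)) \<longlonglongrightarrow> 0"
    proof -
      have "(\<lambda>r. (real (?k r))\<^sup>2 / real (m r) * (1 / real (?k r))) \<longlonglongrightarrow> (pi\<^sup>2 / s) * (real (Suc k))\<^sup>2 * 0"
      proof (intro tendsto_mult kk)
        show "(\<lambda>r. 1 / real (?k r)) \<longlonglongrightarrow> 0" unfolding l_def by real_asymp
      qed
      moreover have "(real (?k r))\<^sup>2 / real (m r) * (1 / real (?k r)) = real (?k r) / real (m r)" for r
        using l[of r] by (simp add: power2_eq_square del: of_nat_mult of_nat_Suc mult_Suc)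
      ultimately show ?thesis by (simp only: mult_zero_right)
    qed
    have m1: "(\<lambda>r. real (m r) / (real (m r) + 1)) \<longlonglongrightarrow> 1"
    proof -
      have "(\<lambda>n. real n / (real n + 1)) \<longlonglongrightarrow> 1" by real_asymp
      thus ?thesis using m_top by (rule filterlim_compose)
    qed
    have m2: "(\<lambda>r. real (m r) / (real (m r) + real (?k r))) \<longlonglongrightarrow> 1"
    proof -
      have "(\<lambda>r. 1 / (1 + real (?k r) / real (m r))) \<longlonglongrightarrow> 1 / (1 + 0)"
        by (intro tendsto_intros km) auto
      also have "(\<lambda>r. 1 / (1 + real (?k r) / real (m r))) = (\<lambda>r. real (m r) / (real (m r) + real (?k r)))"
        using m_pos by (intro ext) (simp add: field_simps)
      finally show ?thesis by simp
    qed
    have lower: "(\<lambda>r. (1 - real (?k r) / real (m r + 1)) ^ ?k r) \<longlonglongrightarrow> exp (- ((pi\<^sup>2 / s) * (real (Suc k))\<^sup>2))"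
    proof (rule one_minus_power_tendsto_exp)
      show "(\<lambda>r. real (?k r) / real (m r + 1)) \<longlonglongrightarrow> 0"
        using tendsto_mult[OF km m1] m_pos by (simp add: add.commute)
      show "(\<lambda>r. real (?k r) * (real (?k r) / real (m r + 1))) \<longlonglongrightarrow> (pi\<^sup>2 / s) * (real (Suc k))\<^sup>2"
        using tendsto_mult[OF kk m1] m_pos by (simp add: power2_eq_square add.commute)
    qed
    have upper: "(\<lambda>r. (1 - real (?k r) / real (m r + ?k r)) ^ ?k r) \<longlonglongrightarrow> exp (- ((pi\<^sup>2 / s) * (real (Suc k))\<^sup>2))"
    proof (rule one_minus_power_tendsto_exp)
      show "(\<lambda>r. real (?k r) / real (m r + ?k r)) \<longlonglongrightarrow> 0"
        using tendsto_mult[OF km m2] m_pos by (simp add: add.commute)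
      show "(\<lambda>r. real (?k r) * (real (?k r) / real (m r + ?k r))) \<longlonglongrightarrow> (pi\<^sup>2 / s) * (real (Suc k))\<^sup>2"
        using tendsto_mult[OF kk m2] m_pos by (simp add: power2_eq_square add.commute)
    qed
    have ev: "\<forall>\<^sub>F r in sequentially. ?k r \<le> m r"
      using order_tendstoD(2)[OF km zero_less_one]
    proof eventually_elim
      case (elim r)
      hence "real (?k r) < real (m r)" using m_pos[of r] by (simp add: pos_divide_less_eq)
      thus ?case by linarith
    qed
    have "(\<lambda>r. b k r) \<longlonglongrightarrow> exp (- ((pi\<^sup>2 / s) * (real (Suc k))\<^sup>2))"
    proof (rule real_tendsto_sandwich[OF _ _ lower upper])
      show "\<forall>\<^sub>F r in sequentially. (1 - real (?k r) / real (m r + 1)) ^ ?k r \<le> b k r"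
        using ev
      proof eventually_elim
        case (elim r)
        from central_binomial_ratio_le(2)[OF elim m_pos] show ?case by (simp only: b_def elim if_True)
      qed
      show "\<forall>\<^sub>F r in sequentially. b k r \<le> (1 - real (?k r) / real (m r + ?k r)) ^ ?k r"
        using ev
      proof eventually_elim
        case (elim r)
        from central_binomial_ratio_le(1)[OF elim m_pos] show ?case by (simp only: b_def elim if_True)
      qed
    qed
    thus "(\<lambda>r. b k r) \<longlonglongrightarrow> exp (- (pi\<^sup>2 / s) * (real (Suc k))\<^sup>2)" by simp
  qed auto

  have key: "1 + 2 * (\<Sum>k. a k r) =
      real ((2 * m r) choose m r) * sqrt (m r) / 4 ^ m r * sqrt ((real (l r))\<^sup>2 / real (m r)) * (1 + 2 * (\<Sum>k. b k r))" for r
  proof -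
    have e1: "(\<Sum>j<l r. (2 * cos (pi * j / l r)) ^ (2 * m r)) = 4 ^ m r * (1 + 2 * (\<Sum>k. a k r))"
      unfolding a_sum using odd_cos_power_sum[OF m_pos[of r], of r]
      by (simp add: l_def power_mult_distrib sum_distrib_left[symmetric] power_mult[of 2 2, simplified])
    have e2: "(\<Sum>j<l r. (2 * cos (pi * j / l r)) ^ (2 * m r)) =
        real (l r) * real ((2 * m r) choose m r) * (1 + 2 * (\<Sum>k. b k r))"
    proof -
      have "l r > 0" using l[of r] by simp
      from cos_power_multisection[OF this, of "m r"] show ?thesis
        unfolding b_sum by (simp add: algebra_simps)
    qed
    \<comment> \<open>Splitting l in this way attaches sqrt m to the central binomial coefficient,
      giving the limit 1 / sqrt pi, and leaves a factor with limit sqrt (1 / c).\<close>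
    have e3: "real (l r) = sqrt (m r) * sqrt ((real (l r))\<^sup>2 / real (m r))"
      using m_pos[of r] by (simp add: real_sqrt_divide)
    have "1 + 2 * (\<Sum>k. a k r) = real (l r) * real ((2 * m r) choose m r) * (1 + 2 * (\<Sum>k. b k r)) / 4 ^ m r"
      using e1 e2 by (simp add: eq_divide_eq mult.commute)
    thus ?thesis by (subst (asm) e3) (simp add: mult_ac)
  qed
  have L1: "(\<lambda>r. real ((2 * m r) choose m r) * sqrt (m r) / 4 ^ m r * sqrt ((real (l r))\<^sup>2 / real (m r)) * (1 + 2 * (\<Sum>k. b k r)))
      \<longlonglongrightarrow> 1 / sqrt pi * sqrt (1 / c) * (1 + 2 * (\<Sum>k. exp (- (pi\<^sup>2 / s) * (real (Suc k))\<^sup>2)))"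
    by (intro tendsto_mult[OF tendsto_mult] tendsto_add tendsto_const b_lim tendsto_mult[OF tendsto_const b_lim] tendsto_real_sqrt lim2
          filterlim_compose[OF central_binomial_asymptotic m_top])
  have L2: "(\<lambda>r. 1 + 2 * (\<Sum>k. a k r)) \<longlonglongrightarrow> 1 + 2 * (\<Sum>k. exp (- s * (real (Suc k))\<^sup>2))"
    by (intro tendsto_intros a_lim)
  have sq: "1 / sqrt pi * sqrt (1 / c) = sqrt (pi / s)"
    proof -
    have "1 / sqrt pi * sqrt (1 / c) = sqrt ((1 / pi) * (pi\<^sup>2 / s))"
      by (simp add: c_def real_sqrt_mult real_sqrt_divide)
    thus ?thesis by (simp add: power2_eq_square)
  qed
  from LIMSEQ_unique[OF L2[unfolded key] L1] show ?thesis unfolding sq .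
qed

section \<open>Real analytic functions and phases\<close>

lemma local_extensionI:
  assumes "r > 0" "g holomorphic_on ball (of_real x) r" "\<And>y. \<bar>y - x\<bar> < r \<Longrightarrow> f y = g (of_real y)"
  shows "\<exists>r>0. \<exists>g. g holomorphic_on ball (complex_of_real x) r \<and> (\<forall>y. \<bar>y - x\<bar> < r \<longrightarrow> f y = g (of_real y))"
  by (intro exI conjI allI impI) (rule assms, assumption?)+

text \<open>A real power series converges on the complex disc of the same radius, and conversely a
  holomorphic function has a Taylor series on the disc. All later closure properties are thereby
  inherited from holomorphic functions.\<close>

lemma real_analytic_complex_iff:
  fixes f :: "real \<Rightarrow> complex"
  shows "real_analytic f \<longleftrightarrow>
    (\<forall>x. \<exists>r>0. \<exists>g. g holomorphic_on ball (of_real x) r \<and> (\<forall>y. \<bar>y - x\<bar> < r \<longrightarrow> f y = g (of_real y)))"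
    (is "_ \<longleftrightarrow> (\<forall>x. ?P x)")
proof
  assume f: "real_analytic f"
  show "\<forall>x. ?P x"
  proof
    fix x
    from f obtain r c where r: "r > 0" and c: "\<And>y. \<bar>y - x\<bar> < r \<Longrightarrow> (\<lambda>n. (y - x) ^ n *\<^sub>R c n) sums f y"
      unfolding real_analytic_def by blast
    define g :: "complex \<Rightarrow> complex" where "g = (\<lambda>w. \<Sum>n. c n * (w - of_real x) ^ n)"
    have sums: "(\<lambda>n. c n * (w - of_real x) ^ n) sums g w" if w: "w \<in> ball (of_real x) r" for w
    proof -
      \<comment> \<open>A radius strictly between |w - x| and r: the series converges at the real
        point x + d, hence at every complex point closer to x.\<close>
      define d where "d = (norm (w - of_real x) + r) / 2"
      have d: "norm (w - of_real x) < d" "d < r"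
        using w by (auto simp: d_def dist_norm norm_minus_commute field_simps)
      have d0: "d \<ge> 0" using d(1) norm_ge_zero[of "w - of_real x"] by linarith
      have "summable (\<lambda>n. c n * (of_real d :: complex) ^ n)"
        using sums_summable[OF c[of "x + d"]] d d0
        by (simp add: scaleR_conv_of_real mult.commute)
      hence "summable (\<lambda>n. c n * (w - of_real x) ^ n)"
        by (rule powser_inside) (use d d0 in auto)
      thus ?thesis unfolding g_def by (rule summable_sums)
    qed
    have "g holomorphic_on ball (of_real x) r"
      using sums by (rule power_series_holomorphic)
    moreover have "f y = g (of_real y)" if y: "\<bar>y - x\<bar> < r" for y
    proof -
      have "(\<lambda>n. c n * (of_real y - of_real x) ^ n) sums g (of_real y)"
        using y by (intro sums) (simp add: dist_real_def abs_minus_commute)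
      moreover have "(\<lambda>n. c n * (of_real y - of_real x) ^ n) sums f y"
        using c[OF y] by (simp add: scaleR_conv_of_real mult.commute)
      ultimately show ?thesis using sums_unique2 by blast
    qed
    ultimately show "?P x" using r by (intro local_extensionI[of r g])
  qed
next
  assume *: "\<forall>x. ?P x"
  show "real_analytic f" unfolding real_analytic_def
  proof
    fix x
    from * obtain r g where r: "r > 0" and g: "g holomorphic_on ball (of_real x) r"
      and fg: "\<And>y. \<bar>y - x\<bar> < r \<Longrightarrow> f y = g (of_real y)" by blast
    have "(\<lambda>n. (y - x) ^ n *\<^sub>R ((deriv ^^ n) g (of_real x) / fact n)) sums f y" if y: "\<bar>y - x\<bar> < r" for y
    proof -
      have "(\<lambda>n. (deriv ^^ n) g (of_real x) / fact n * (of_real y - of_real x) ^ n) sums g (of_real y)"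
        using y by (intro holomorphic_power_series[OF g]) (simp add: dist_real_def abs_minus_commute)
      thus ?thesis using fg[OF y] by (simp add: scaleR_conv_of_real mult.commute)
    qed
    thus "\<exists>r>0. \<exists>c. \<forall>y. \<bar>y - x\<bar> < r \<longrightarrow> (\<lambda>n. (y - x) ^ n *\<^sub>R c n) sums f y"
      by (intro exI[of _ r] exI[of _ "\<lambda>n. (deriv ^^ n) g (of_real x) / fact n"] conjI allI impI r)
  qed
qed

lemma real_analytic_linear:
  assumes "bounded_linear h" "real_analytic f"
  shows "real_analytic (\<lambda>x. h (f x))"
  unfolding real_analytic_def
proof
  fix x
  interpret bounded_linear h by fact
  from assms(2) obtain r c where r: "r > 0" and c: "\<And>y. \<bar>y - x\<bar> < r \<Longrightarrow> (\<lambda>n. (y - x) ^ n *\<^sub>R c n) sums f y"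
    unfolding real_analytic_def by blast
  show "\<exists>r>0. \<exists>c. \<forall>y. \<bar>y - x\<bar> < r \<longrightarrow> (\<lambda>n. (y - x) ^ n *\<^sub>R c n) sums h (f y)"
  proof (intro exI conjI allI impI)
    show "r > 0" by fact
    fix y assume "\<bar>y - x\<bar> < r"
    from sums[OF c[OF this]] show "(\<lambda>n. (y - x) ^ n *\<^sub>R h (c n)) sums h (f y)" by (simp add: scaleR)
  qed
qed

lemma real_analytic_of_real:
  "real_analytic f \<Longrightarrow> real_analytic (\<lambda>x. complex_of_real (f x))"
  by (rule real_analytic_linear[OF bounded_linear_of_real])

lemma real_analytic_of_real_iff:
  "real_analytic (\<lambda>x. complex_of_real (f x)) \<longleftrightarrow> real_analytic f"
proof
  assume "real_analytic (\<lambda>x. complex_of_real (f x))"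
  from real_analytic_linear[OF bounded_linear_Re this] show "real_analytic f" by simp
qed (rule real_analytic_of_real)

lemma real_analytic_const: "real_analytic (\<lambda>_. c :: complex)"
  unfolding real_analytic_complex_iff
  by (intro allI local_extensionI[of 1 "\<lambda>_. c"]) auto

lemma real_analytic_binop:
  fixes f g :: "real \<Rightarrow> complex"
  assumes f: "real_analytic f" and g: "real_analytic g"
    and op: "\<And>F G A. F holomorphic_on A \<Longrightarrow> G holomorphic_on A \<Longrightarrow> (\<lambda>z. h (F z) (G z)) holomorphic_on A"
  shows "real_analytic (\<lambda>x. h (f x) (g x))"
  unfolding real_analytic_complex_iff
proof
  fix x
  from f obtain r F where F: "r > 0" "F holomorphic_on ball (of_real x) r" "\<And>y. \<bar>y - x\<bar> < r \<Longrightarrow> f y = F (of_real y)"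
    unfolding real_analytic_complex_iff by blast
  from g obtain s G where G: "s > 0" "G holomorphic_on ball (of_real x) s" "\<And>y. \<bar>y - x\<bar> < s \<Longrightarrow> g y = G (of_real y)"
    unfolding real_analytic_complex_iff by blast
  have "F holomorphic_on ball (of_real x) (min r s)" "G holomorphic_on ball (of_real x) (min r s)"
    using F(2) G(2) by (auto elim!: holomorphic_on_subset)
  from op[OF this] have "(\<lambda>z. h (F z) (G z)) holomorphic_on ball (of_real x) (min r s)" .
  thus "\<exists>r>0. \<exists>H. H holomorphic_on ball (of_real x) r \<and>
      (\<forall>y. \<bar>y - x\<bar> < r \<longrightarrow> h (f y) (g y) = H (of_real y))"
  proof (rule local_extensionI[rotated])
    show "min r s > 0" using F(1) G(1) by simp
    fix y assume y: "\<bar>y - x\<bar> < min r s"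
    show "h (f y) (g y) = h (F (of_real y)) (G (of_real y))"
      using F(3)[of y] G(3)[of y] y by simp
  qed
qed

lemma real_analytic_add:
  fixes f g :: "real \<Rightarrow> complex"
  shows "real_analytic f \<Longrightarrow> real_analytic g \<Longrightarrow> real_analytic (\<lambda>x. f x + g x)"
  by (rule real_analytic_binop) (auto intro: holomorphic_intros)

lemma real_analytic_mult:
  fixes f g :: "real \<Rightarrow> complex"
  shows "real_analytic f \<Longrightarrow> real_analytic g \<Longrightarrow> real_analytic (\<lambda>x. f x * g x)"
  by (rule real_analytic_binop) (auto intro: holomorphic_intros)

lemma real_analytic_holomorphic_line:
  assumes "open A" "f holomorphic_on A" "\<And>t. a + b * of_real t \<in> A"
  shows "real_analytic (\<lambda>t. f (a + b * of_real t))"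
  unfolding real_analytic_complex_iff
proof
  fix x :: real
  let ?h = "\<lambda>z. a + b * z"
  have "open (?h -` A)"
    by (intro continuous_open_vimage assms continuous_intros)
  moreover have "of_real x \<in> ?h -` A" using assms by simp
  ultimately obtain r where r: "r > 0" "ball (of_real x) r \<subseteq> ?h -` A"
    unfolding open_contains_ball by blast
  have "f \<circ> ?h holomorphic_on ball (of_real x) r"
    by (intro holomorphic_on_compose holomorphic_intros holomorphic_on_subset[OF assms(2)]) (use r in auto)
  thus "\<exists>r>0. \<exists>g. g holomorphic_on ball (of_real x) r \<and> (\<forall>y. \<bar>y - x\<bar> < r \<longrightarrow> f (a + b * of_real y) = g (of_real y))"
    using r by (intro local_extensionI[of r "f \<circ> ?h"]) auto
qed

lemma real_analytic_imp_continuous: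
  fixes f :: "real \<Rightarrow> complex"
  assumes "real_analytic f"
  shows "continuous_on UNIV f"
proof (rule continuous_at_imp_continuous_on, rule ballI)
  fix x
  from assms obtain r g where r: "r > 0" and g: "g holomorphic_on ball (of_real x) r"
      and fg: "\<And>y. \<bar>y - x\<bar> < r \<Longrightarrow> f y = g (of_real y)"
    unfolding real_analytic_complex_iff by blast
  have "isCont g (of_real x)"
    using holomorphic_on_imp_continuous_on[OF g] r by (simp add: continuous_on_eq_continuous_at)
  hence "isCont (\<lambda>y. g (of_real y)) x"
    by (intro isCont_o2[where g = g and f = of_real] isCont_of_real continuous_ident)
  moreover have "\<forall>\<^sub>F y in nhds x. f y = g (of_real y)"
    unfolding eventually_nhds_metric using r fg by (auto simp: dist_real_def)
  ultimately show "isCont f x" by (simp add: isCont_cong)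
qed

lemma real_analytic_imp_continuous_real:
  fixes f :: "real \<Rightarrow> real"
  assumes "real_analytic f"
  shows "continuous_on UNIV f"
proof -
  have "continuous_on UNIV (\<lambda>x. Re (complex_of_real (f x)))"
    by (intro continuous_on_Re real_analytic_imp_continuous real_analytic_of_real assms)
  thus ?thesis by simp
qed

text \<open>The difference of two continuous phases takes values in 2 pi Z, and a continuous
  function with discrete values on a connected set is constant.\<close>

lemma continuous_phase_unique:
  fixes f g :: "real \<Rightarrow> real"
  assumes "continuous_on UNIV f" "continuous_on UNIV g"
    and "\<And>t. exp (\<i> * of_real (f t)) = exp (\<i> * of_real (g t))" and "f 0 = g 0"
  shows "f = g"
proof -
  define d where "d = (\<lambda>t. f t - g t)"
  have cont: "continuous_on UNIV d" unfolding d_def by (intro continuous_intros assms)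
  have int: "\<exists>n::int. d t = of_int n * (2 * pi)" for t
  proof -
    obtain n :: int where "\<i> * of_real (f t) = \<i> * of_real (g t) + of_int (2 * n) * pi * \<i>"
      using assms(3)[of t] unfolding exp_eq by auto
    hence "Im (\<i> * of_real (f t)) = Im (\<i> * of_real (g t) + of_int (2 * n) * pi * \<i>)" by simp
    thus ?thesis by (intro exI[of _ n]) (simp add: d_def algebra_simps)
  qed
  have "d constant_on UNIV"
  proof (rule continuous_discrete_range_constant[OF connected_UNIV cont])
    fix x
    have "2 * pi \<le> norm (d y - d x)" if "d y \<noteq> d x" for y
    proof -
      obtain m n :: int where mn: "d x = of_int m * (2 * pi)" "d y = of_int n * (2 * pi)"
        using int by blast
      hence e: "d y - d x = of_int (n - m) * (2 * pi)" by (simp add: algebra_simps)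
      have "n \<noteq> m" using that mn by auto
      hence "1 \<le> \<bar>n - m\<bar>" by linarith
      hence "1 \<le> \<bar>real_of_int (n - m)\<bar>" by linarith
      thus ?thesis unfolding e by (simp add: abs_mult)
    qed
    thus "\<exists>e>0. \<forall>y. y \<in> UNIV \<and> d y \<noteq> d x \<longrightarrow> e \<le> norm (d y - d x)"
      using pi_gt_zero by (intro exI[of _ "2 * pi"]) auto
  qed
  hence "d t = d 0" for t unfolding constant_on_def by auto
  thus ?thesis using assms(4) by (auto simp: d_def fun_eq_iff)
qed

text \<open>The line is contractible, so U has a continuous logarithm; |U| = 1 makes it purely
  imaginary. Analyticity is a local matter and is checked against the principal logarithm of U / U
  x.\<close>

lemma real_analytic_phase_exists:
  fixes U :: "real \<Rightarrow> complex"
  assumes U: "real_analytic U" and norm: "\<And>t. norm (U t) = 1" and U0: "U 0 = exp (\<i> * of_real p)"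
  shows "\<exists>f :: real \<Rightarrow> real. real_analytic f \<and> f 0 = p \<and> (\<forall>t. U t = exp (\<i> * of_real (f t)))"
proof -
  have nz: "U t \<noteq> 0" for t using norm[of t] by auto
  obtain g where g: "continuous_on UNIV g" "\<And>t. U t = exp (g t)"
    using continuous_logarithm_on_contractible[OF real_analytic_imp_continuous[OF U] contractible_UNIV] nz
    by (metis UNIV_I)
  define f where "f = (\<lambda>t. Im (g t) - Im (g 0) + p)"
  have Re: "Re (g t) = 0" for t using norm[of t] g(2)[of t] by simp
  have g_eq: "g t = \<i> * of_real (Im (g t))" for t using Re[of t] by (simp add: complex_eq_iff)
  have Uf: "U t = exp (\<i> * of_real (f t))" for t
  proof -
    have "exp (\<i> * of_real (f t)) = exp (g t) * exp (\<i> * of_real p) / exp (g 0)"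
      by (subst (1 2) g_eq) (simp add: f_def exp_add[symmetric] exp_diff[symmetric] algebra_simps)
    thus ?thesis using g(2)[of t] g(2)[of 0] U0 by simp
  qed
  have contf: "continuous_on UNIV f" unfolding f_def by (intro continuous_intros g(1))
  have "real_analytic (\<lambda>t. complex_of_real (f t))"
    unfolding real_analytic_complex_iff
  proof
    fix x
    from U obtain r G where r: "r > 0" and G: "G holomorphic_on ball (of_real x) r"
      and UG: "\<And>y. \<bar>y - x\<bar> < r \<Longrightarrow> U y = G (of_real y)"
      unfolding real_analytic_complex_iff by blast
    have "continuous_on (ball (of_real x) r) (\<lambda>z. G z / U x)"
      using nz by (intro continuous_intros holomorphic_on_imp_continuous_on G) auto
    moreover have "G (of_real x) / U x = 1" using UG[of x] r nz[of x] by simp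
    ultimately have "\<forall>\<^sub>F z in nhds (complex_of_real x). G z / U x \<in> ball 1 1"
      using r by (intro topological_tendstoD) (auto simp: continuous_on_eq_continuous_at isCont_def tendsto_nhds_iff)
    then obtain s where s: "s > 0" "\<And>z. z \<in> ball (complex_of_real x) s \<Longrightarrow> G z / U x \<in> ball 1 1"
      unfolding eventually_nhds_metric by (auto simp: dist_commute)
    have "isCont f x" using contf by (simp add: continuous_on_eq_continuous_at)
    then obtain e where e: "e > 0" "\<And>y. \<bar>y - x\<bar> < e \<Longrightarrow> \<bar>f y - f x\<bar> < pi"
      unfolding continuous_at_eps_delta dist_real_def using pi_gt_zero by metis
    define R where "R = min r (min s e)"
    \<comment> \<open>On this ball G / U x stays in the disc of radius 1 about 1, away from the
      branch cut, and f moves by less than pi, so the principal branch returns exactly f y - f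
      x.\<close>
    define H where "H = (\<lambda>z. of_real (f x) + Ln (G z / U x) / \<i>)"
    have "H holomorphic_on ball (of_real x) R"
      unfolding H_def
    proof (intro holomorphic_intros holomorphic_on_subset[OF G])
      fix z :: complex assume "z \<in> ball (of_real x) R"
      hence "G z / U x \<in> ball 1 1" by (intro s) (auto simp: R_def)
      hence "Re (1 - G z / U x) < 1"
        using complex_Re_le_cmod[of "1 - G z / U x"] by (simp add: dist_norm)
      thus "G z / U x \<notin> \<real>\<^sub>\<le>\<^sub>0" by (auto simp: complex_nonpos_Reals_iff)
    qed (use nz in \<open>auto simp: R_def\<close>)
    moreover have "of_real (f y) = H (of_real y)" if y: "\<bar>y - x\<bar> < R" for y
    proof -
      have "G (of_real y) / U x = exp (\<i> * of_real (f y - f x))"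
        using UG[of y] y unfolding Uf[of x] Uf[of y] by (simp add: R_def exp_diff right_diff_distrib)
      moreover have "Ln (exp (\<i> * of_real (f y - f x))) = \<i> * of_real (f y - f x)"
        using e(2)[of y] y by (intro Ln_exp) (auto simp: R_def abs_less_iff)
      ultimately show ?thesis by (simp add: H_def)
    qed
    ultimately show "\<exists>r>0. \<exists>g. g holomorphic_on ball (of_real x) r \<and> (\<forall>y. \<bar>y - x\<bar> < r \<longrightarrow> complex_of_real (f y) = g (of_real y))"
      using r s e by (intro local_extensionI[of R H]) (auto simp: R_def)
  qed
  hence "real_analytic f" by (simp add: real_analytic_of_real_iff)
  thus ?thesis using Uf by (intro exI[of _ f]) (auto simp: f_def)
qed

section \<open>The Riemann--Siegel theta function\<close>

lemma quarter_line_not_nonpos: "1 / 4 + \<i> * of_real t / 2 \<notin> \<real>\<^sub>\<le>\<^sub>0"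
  by (auto simp: complex_nonpos_Reals_iff)

lemma quarter_line_not_nonpos_Ints: "1 / 4 + \<i> * of_real t / 2 \<notin> \<int>\<^sub>\<le>\<^sub>0"
  using quarter_line_not_nonpos nonpos_Ints_subset_nonpos_Reals by blast

text \<open>The function \<open>ln_Gamma\<close> is an analytic logarithm of Gamma off the closed
  negative axis and is real at 1/4, so its imaginary part is the required phase. As Gamma has no
  zeros, any competitor gives the same exponentials and \<open>continuous_phase_unique\<close>
  applies.\<close>

lemma riemann_siegel_theta_eq:
  "riemann_siegel_theta t = Im (ln_Gamma (1 / 4 + \<i> * of_real t / 2)) - t / 2 * ln pi"
proof -
  define \<theta> where "\<theta> = (\<lambda>t. Im (ln_Gamma (1 / 4 + \<i> * of_real t / 2)) - t / 2 * ln pi)"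
  have "(\<lambda>z. ln_Gamma z - (z - 1 / 4) * of_real (ln pi)) holomorphic_on (- \<real>\<^sub>\<le>\<^sub>0)"
    by (intro holomorphic_intros) auto
  from real_analytic_holomorphic_line[OF _ this, of "1 / 4" "\<i> / 2"]
  have "real_analytic (\<lambda>t. ln_Gamma (1 / 4 + \<i> * of_real t / 2) - \<i> * of_real t / 2 * of_real (ln pi))"
    using quarter_line_not_nonpos by (simp add: open_Compl)
  from real_analytic_linear[OF bounded_linear_Im this]
  have an: "real_analytic \<theta>" by (simp add: \<theta>_def)
  have 0: "\<theta> 0 = 0"
    using ln_Gamma_complex_of_real[of "1/4"] by (simp add: \<theta>_def)
  have phase: "Gamma (1 / 4 + \<i> * of_real t / 2) =
             of_real (cmod (Gamma (1 / 4 + \<i> * of_real t / 2))) *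
             exp (\<i> * of_real (\<theta> t + t / 2 * ln pi))" for t
  proof -
    define w where "w = ln_Gamma (1 / 4 + \<i> * of_real t / 2 :: complex)"
    have A: "Gamma (1 / 4 + \<i> * of_real t / 2) = exp w"
      using quarter_line_not_nonpos_Ints by (simp add: Gamma_complex_altdef w_def)
    have B: "exp w = of_real (cmod (exp w)) * exp (\<i> * of_real (Im w))"
      unfolding norm_exp_eq_Re cis_conv_exp[symmetric] by (rule exp_eq_polar)
    have C: "\<theta> t + t / 2 * ln pi = Im w" by (simp add: \<theta>_def w_def)
    show ?thesis unfolding A C by (rule B)
  qed
  have "riemann_siegel_theta = \<theta>"
    unfolding riemann_siegel_theta_def
  proof (rule the_equality, intro conjI an 0 allI phase, elim conjE)
    fix \<eta> :: "real \<Rightarrow> real"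
    assume \<eta>: "real_analytic \<eta>" "\<eta> 0 = 0"
      and ph: "\<forall>t. Gamma (1 / 4 + \<i> * of_real t / 2) =
             of_real (cmod (Gamma (1 / 4 + \<i> * of_real t / 2))) *
             exp (\<i> * of_real (\<eta> t + t / 2 * ln pi))"
    show "\<eta> = \<theta>"
    proof (rule continuous_phase_unique)
      fix t
      have "Gamma (1 / 4 + \<i> * of_real t / 2 :: complex) \<noteq> 0"
        using quarter_line_not_nonpos_Ints by (simp add: Gamma_eq_zero_iff)
      hence "exp (\<i> * of_real (\<eta> t + t / 2 * ln pi)) = exp (\<i> * of_real (\<theta> t + t / 2 * ln pi))"
        using ph[rule_format, of t] phase[of t] by (metis mult_cancel_left norm_eq_zero of_real_eq_0_iff)
      thus "exp (\<i> * of_real (\<eta> t)) = exp (\<i> * of_real (\<theta> t))"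
        by (simp add: distrib_left exp_add)
    qed (use \<eta> an 0 in \<open>auto intro: real_analytic_imp_continuous_real\<close>)
  qed
  from fun_cong[OF this, of t] show ?thesis by (simp only: \<theta>_def)
qed

lemma deriv_riemann_siegel_theta:
  "deriv riemann_siegel_theta t = Re (Digamma (1 / 4 + \<i> * of_real t / 2)) / 2 - ln pi / 2"
proof (rule DERIV_imp_deriv)
  have "((\<lambda>z. ln_Gamma (1 / 4 + \<i> * z / 2)) has_field_derivative Digamma (1 / 4 + \<i> * of_real t / 2) * (\<i> / 2)) (at (of_real t))"
    using quarter_line_not_nonpos[of t] by (auto intro!: derivative_eq_intros)
  hence "((\<lambda>t. ln_Gamma (1 / 4 + \<i> * of_real t / 2)) has_vector_derivative Digamma (1 / 4 + \<i> * of_real t / 2) * (\<i> / 2)) (at t)"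
    by (rule has_vector_derivative_real_field)
  from bounded_linear.has_vector_derivative[OF bounded_linear_Im this]
  have "((\<lambda>t. Im (ln_Gamma (1 / 4 + \<i> * of_real t / 2))) has_real_derivative Re (Digamma (1 / 4 + \<i> * of_real t / 2)) / 2) (at t)"
    by (simp add: has_real_derivative_iff_has_vector_derivative)
  thus "(riemann_siegel_theta has_real_derivative Re (Digamma (1 / 4 + \<i> * of_real t / 2)) / 2 - ln pi / 2) (at t)"
    unfolding riemann_siegel_theta_eq[abs_def]
  proof (rule DERIV_diff)
    show "((\<lambda>t. t / 2 * ln pi) has_real_derivative ln pi / 2) (at t)"
      by (auto intro!: derivative_eq_intros)
  qed
qed

lemma real_analytic_deriv_riemann_siegel_theta:
  "real_analytic (\<lambda>t. complex_of_real (deriv riemann_siegel_theta t))"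
proof -
  have "(\<lambda>z. Digamma z / 2 - of_real (ln pi / 2) :: complex) holomorphic_on (- \<real>\<^sub>\<le>\<^sub>0)"
    using nonpos_Ints_subset_nonpos_Reals by (intro holomorphic_intros) auto
  from real_analytic_holomorphic_line[OF _ this, of "1 / 4" "\<i> / 2"]
  have "real_analytic (\<lambda>t. Digamma (1 / 4 + \<i> * of_real t / 2) / 2 - of_real (ln pi / 2) :: complex)"
    using quarter_line_not_nonpos by (simp add: open_Compl)
  from real_analytic_of_real[OF real_analytic_linear[OF bounded_linear_Re this]]
  show ?thesis by (simp add: deriv_riemann_siegel_theta)
qed

section \<open>Mellin transform of the theta function\<close>

text \<open>Euler's integral for Gamma under x = exp u; the parameter a is then introduced by the
  translation u -> u + ln a, which produces the factor a^(-z).\<close>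

lemma Mellin_exp:
  fixes z :: complex and a :: real
  assumes z: "Re z > 0" and a: "a > 0"
  shows "integrable lborel (\<lambda>u. exp (z * of_real u) * of_real (exp (- a * exp u)))" (is ?int)
    and "(LINT u|lborel. exp (z * of_real u) * of_real (exp (- a * exp u))) = Gamma z * exp (- z * of_real (ln a))" (is ?val)
proof -
  let ?f = "\<lambda>t. complex_of_real t powr (z - 1) / of_real (exp t)"
  let ?h = "\<lambda>u. exp (z * of_real u) * complex_of_real (exp (- exp u))"
  have img: "exp ` (UNIV :: real set) = {0<..}"
  proof (intro equalityI subsetI)
    fix x :: real assume "x \<in> {0<..}"
    thus "x \<in> range exp" by (intro image_eqI[of _ _ "ln x"]) auto
  qed auto
  have "?f absolutely_integrable_on exp ` UNIV \<and> integral (exp ` UNIV) ?f = Gamma z"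
    unfolding img using absolutely_integrable_Gamma_integral'[OF z] Gamma_integral_complex'[OF z]
    by (simp add: integral_unique)
  hence "(\<lambda>u. \<bar>exp u\<bar> *\<^sub>R ?f (exp u)) absolutely_integrable_on UNIV \<and> integral UNIV (\<lambda>u. \<bar>exp u\<bar> *\<^sub>R ?f (exp u)) = Gamma z"
    by (subst has_absolute_integral_change_of_variables_real[where g = exp and h = exp])
       (auto intro: inj_onI derivative_eq_intros)
  also have "(\<lambda>u. \<bar>exp u\<bar> *\<^sub>R ?f (exp u)) = ?h"
  proof
    fix u :: real
    have "complex_of_real (exp u) powr (z - 1) = exp ((z - 1) * of_real u)"
      by (simp add: powr_def Ln_of_real)
    thus "\<bar>exp u\<bar> *\<^sub>R ?f (exp u) = ?h u"
      by (simp add: scaleR_conv_of_real exp_of_real[symmetric] exp_diff exp_minus exp_add[symmetric] field_simps left_diff_distrib)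
  qed
  finally have h: "?h absolutely_integrable_on UNIV" "integral UNIV ?h = Gamma z" by auto
  have meas: "?h \<in> borel_measurable borel" by measurable
  have int: "integrable lborel ?h"
    using h(1) meas unfolding set_integrable_def by (simp add: integrable_completion)
  have val: "(LINT u|lborel. ?h u) = Gamma z"
    using integral_lborel[OF int] h(2) by simp
  have eq: "exp (z * of_real u) * complex_of_real (exp (- a * exp u)) = exp (- z * of_real (ln a)) * ?h (ln a + 1 * u)" for u
    using a by (simp add: exp_add exp_diff distrib_left exp_minus)
  show ?int
    unfolding eq using lborel_integrable_real_affine[OF int, of 1 "ln a"] by (intro integrable_mult_right) simp
  show ?val
    unfolding eq using lborel_integral_real_affine[of 1 ?h "ln a"] val by (simp add: mult.commute)
qed

lemma integrable_real_exp_kernel: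
  fixes x a :: real
  assumes "x > 0" "a > 0"
  shows "integrable lborel (\<lambda>u. exp (x * u) * exp (- a * exp u))"
proof -
  have "integrable lborel (\<lambda>u. norm (exp (of_real x * complex_of_real u) * of_real (exp (- a * exp u))))"
    using assms by (intro integrable_norm Mellin_exp) auto
  thus ?thesis by (simp add: norm_mult)
qed

lemma integral_real_exp_kernel:
  fixes x a :: real
  assumes "x > 0" "a > 0"
  shows "(LINT u|lborel. exp (x * u) * exp (- a * exp u)) = Gamma x * a powr (- x)"
proof -
  have "complex_of_real (LINT u|lborel. exp (x * u) * exp (- a * exp u)) =
      (LINT u|lborel. exp (of_real x * complex_of_real u) * of_real (exp (- a * exp u)))"
    by (subst integral_complex_of_real[symmetric]) (simp add: exp_of_real[symmetric])
  also have "\<dots> = Gamma (of_real x) * exp (- of_real x * of_real (ln a))"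
    using assms by (intro Mellin_exp) auto
  also have "\<dots> = of_real (Gamma x * a powr (- x))"
    using assms by (simp add: Gamma_complex_of_real powr_def exp_of_real[symmetric])
  finally show ?thesis by (simp only: of_real_eq_iff)
qed

text \<open>Equals (theta(x) - 1) / 2 for Jacobi's theta function, the sum of exp (- pi n^2 x) over
  all integers n.\<close>

definition half_theta :: "real \<Rightarrow> real" where
  "half_theta x = (\<Sum>n. exp (- (pi * (real (Suc n))\<^sup>2) * x))"

text \<open>Rests on (n + 1)^2 - 1 >= 3 n. At x = 1 the geometric majorant is exact in its first two
  terms, so very little is lost in the later comparison with the leading term alone.\<close>

lemma half_theta_term_le:
  assumes "x \<ge> 1"
  shows "exp (- (pi * (real (Suc n))\<^sup>2) * x) \<le> exp (- pi * x) * exp (- 3 * pi) ^ n"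
proof -
  have "3 * real n \<le> (real (Suc n))\<^sup>2 - 1"
    by (cases n) (auto simp: power2_eq_square algebra_simps)
  hence "3 * real n * 1 \<le> ((real (Suc n))\<^sup>2 - 1) * x"
    using assms by (intro mult_mono) auto
  hence "pi * (3 * real n * 1) \<le> pi * (((real (Suc n))\<^sup>2 - 1) * x)" by (intro mult_left_mono) auto
  thus ?thesis by (simp add: exp_of_nat_mult[symmetric] exp_add[symmetric] algebra_simps del: of_nat_Suc)
qed

lemma summable_half_theta:
  assumes "x > 0"
  shows "summable (\<lambda>n. exp (- (pi * (real (Suc n))\<^sup>2) * x))"
proof (rule summable_comparison_test')
  show "summable (\<lambda>n. exp (- pi * x) ^ n)" using assms by (intro summable_geometric) auto
  fix n :: nat
  have "real n \<le> (real (Suc n))\<^sup>2" by (simp add: power2_eq_square algebra_simps)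
  hence "pi * x * real n \<le> pi * x * (real (Suc n))\<^sup>2" using assms by (intro mult_left_mono) auto
  thus "norm (exp (- (pi * (real (Suc n))\<^sup>2) * x)) \<le> exp (- pi * x) ^ n"
    by (simp add: exp_of_nat_mult[symmetric] mult_ac del: of_nat_Suc)
qed

lemma half_theta_nonneg: "x > 0 \<Longrightarrow> half_theta x \<ge> 0"
  unfolding half_theta_def by (intro suminf_nonneg summable_half_theta) auto

lemma half_theta_le:
  assumes "x \<ge> 1"
  shows "half_theta x \<le> exp (- pi * x) / (1 - exp (- 3 * pi))"
proof -
  have "half_theta x \<le> (\<Sum>n. exp (- pi * x) * exp (- 3 * pi) ^ n)"
    unfolding half_theta_def using assms
    by (intro suminf_le half_theta_term_le summable_half_theta summable_mult summable_geometric) auto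
  also have "\<dots> = exp (- pi * x) / (1 - exp (- 3 * pi))"
    by (subst suminf_mult) (auto intro: summable_geometric simp: suminf_geometric)
  finally show ?thesis .
qed

lemma borel_measurable_half_theta [measurable]: "half_theta \<in> borel_measurable borel"
  unfolding half_theta_def by measurable

text \<open>The substitution \<open>x = exp u\<close> turns the symmetry \<open>x \<mapsto> 1 / x\<close> of the theta function
  into \<open>u \<mapsto> - u\<close>, and the factor \<open>exp (u / 4)\<close> centres the transform at \<open>s = 1 / 2\<close>.\<close>

definition theta_weight :: "real \<Rightarrow> real" where
  "theta_weight u = indicator {0..} u * (exp (u / 4) * half_theta (exp u))"

lemma borel_measurable_theta_weight [measurable]: "theta_weight \<in> borel_measurable borel"
  unfolding theta_weight_def by measurable

lemma theta_weight_nonneg: "theta_weight u \<ge> 0"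
  unfolding theta_weight_def by (auto simp: half_theta_nonneg)

lemma integrable_exp_theta_weight: "integrable lborel (\<lambda>u. exp (a * u) * theta_weight u)"
proof (rule Bochner_Integration.integrable_bound)
  define b where "b = \<bar>a\<bar> + 1 / 4"
  define K where "K = 1 / (1 - exp (- 3 * pi))"
  have K: "K > 0" by (simp add: K_def)
  show "integrable lborel (\<lambda>u. K * (exp (b * u) * exp (- pi * exp u)))"
    by (intro integrable_mult_right integrable_real_exp_kernel) (auto simp: b_def)
  show "AE u in lborel. norm (exp (a * u) * theta_weight u) \<le> norm (K * (exp (b * u) * exp (- pi * exp u)))"
  proof (rule AE_I2)
    fix u :: real
    show "norm (exp (a * u) * theta_weight u) \<le> norm (K * (exp (b * u) * exp (- pi * exp u)))"
    proof (cases "u \<ge> 0")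
      case True
      have "a * u + u / 4 \<le> b * u"
        using True mult_right_mono[OF abs_ge_self True, of a] by (simp add: b_def algebra_simps)
      hence "exp (a * u) * exp (u / 4) \<le> exp (b * u)" by (simp add: exp_add[symmetric])
      moreover have "half_theta (exp u) \<le> K * exp (- pi * exp u)"
        using half_theta_le[of "exp u"] True by (simp add: K_def)
      ultimately have "(exp (a * u) * exp (u / 4)) * half_theta (exp u) \<le> exp (b * u) * (K * exp (- pi * exp u))"
        by (intro mult_mono) (auto simp: half_theta_nonneg)
      thus ?thesis using True K by (simp add: theta_weight_def half_theta_nonneg abs_mult mult_ac)
    qed (simp add: theta_weight_def)
  qed
qed measurable

lemma integrable_power_exp_theta_weight: "integrable lborel (\<lambda>u. u ^ k * exp (a * u) * theta_weight u)"
proof (rule Bochner_Integration.integrable_bound)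
  show "integrable lborel (\<lambda>u. fact k * (exp ((a + 1) * u) * theta_weight u))"
    by (intro integrable_mult_right integrable_exp_theta_weight)
  show "AE u in lborel. norm (u ^ k * exp (a * u) * theta_weight u) \<le> norm (fact k * (exp ((a + 1) * u) * theta_weight u))"
  proof (rule AE_I2)
    fix u :: real
    show "norm (u ^ k * exp (a * u) * theta_weight u) \<le> norm (fact k * (exp ((a + 1) * u) * theta_weight u))"
    proof (cases "u \<ge> 0")
      case True
      have "u ^ k /\<^sub>R fact k \<le> exp u"
        using sum_le_suminf[OF summable_exp_generic[of u], of "{k}"] True by (simp add: exp_def)
      hence "u ^ k \<le> fact k * exp u" by (simp add: field_simps)
      hence "u ^ k * (exp (a * u) * theta_weight u) \<le> (fact k * exp u) * (exp (a * u) * theta_weight u)"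
        by (intro mult_right_mono) (auto simp: theta_weight_nonneg)
      thus ?thesis using True by (simp add: abs_mult theta_weight_nonneg exp_add algebra_simps)
    qed (simp add: theta_weight_def)
  qed
qed measurable

definition theta_transform :: "complex \<Rightarrow> complex" where
  "theta_transform z = (LINT u|lborel. exp (z * of_real u) * of_real (theta_weight u))"

lemma norm_exp_diff_le:
  fixes w :: complex
  shows "norm (exp w - 1 - w) \<le> (norm w)\<^sup>2 * exp (norm w)"
proof -
  have "(\<lambda>n. w ^ (n + 2) /\<^sub>R fact (n + 2)) sums (exp w - (\<Sum>n<2. w ^ n /\<^sub>R fact n))"
    by (intro sums_split_initial_segment exp_converges)
  hence s: "(\<lambda>n. w ^ (n + 2) /\<^sub>R fact (n + 2)) sums (exp w - 1 - w)"
    by (simp add: numeral_2_eq_2 algebra_simps)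
  have s2: "(\<lambda>n. (norm w)\<^sup>2 * (norm w ^ n /\<^sub>R fact n)) sums ((norm w)\<^sup>2 * exp (norm w))"
    by (intro sums_mult exp_converges)
  have le: "norm (w ^ (n + 2) /\<^sub>R fact (n + 2)) \<le> (norm w)\<^sup>2 * (norm w ^ n /\<^sub>R fact n)" for n
  proof -
    have "norm w ^ (n + 2) / fact (n + 2) \<le> norm w ^ (n + 2) / (fact n :: real)"
      by (intro divide_left_mono fact_mono) auto
    moreover have "norm (w ^ m /\<^sub>R fact m) = norm w ^ m / fact m" for m
      by (simp add: norm_power divide_inverse mult.commute)
    moreover have "norm w ^ (n + 2) / fact n = (norm w)\<^sup>2 * (norm w ^ n /\<^sub>R fact n)"
      by (simp add: power_add divide_inverse power2_eq_square mult_ac)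
    ultimately show ?thesis by (simp only:)
  qed
  show ?thesis
    using norm_suminf_le[OF le sums_summable[OF s2]]
    unfolding sums_unique[OF s, symmetric] sums_unique[OF s2, symmetric] .
qed

text \<open>Differentiation under the integral by a direct estimate: by the second-order remainder
  of exp, for |h| <= 1 the error is at most |h|^2 times one convergent integral. The explicit form
  of the derivative is what later gives the sine transform.\<close>

lemma theta_transform_has_derivative:
  "(theta_transform has_field_derivative
     (LINT u|lborel. of_real u * exp (z * of_real u) * of_real (theta_weight u))) (at z)"
proof -
  define D where "D = (LINT u|lborel. of_real u * exp (z * of_real u) * complex_of_real (theta_weight u))"
  have int0: "integrable lborel (\<lambda>u. exp (z * of_real u) * complex_of_real (theta_weight u))" for z
    by (rule Bochner_Integration.integrable_bound[OF integrable_exp_theta_weight[of "Re z"]])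
       (auto simp: norm_mult abs_mult)
  have int1: "integrable lborel (\<lambda>u. of_real u * exp (z * of_real u) * complex_of_real (theta_weight u))"
    by (rule Bochner_Integration.integrable_bound[OF integrable_power_exp_theta_weight[of 1 "Re z"]])
       (auto simp: norm_mult abs_mult)
  \<comment> \<open>The additional 1 absorbs the factor exp (|h| u) <= exp u from the remainder
    bound.\<close>
  define a where "a = Re z + 1"
  define C where "C = (LINT u|lborel. u ^ 2 * exp (a * u) * theta_weight u)"
  have bound: "norm (theta_transform (z + h) - theta_transform z - h * D) \<le> (norm h)\<^sup>2 * C" if h: "norm h \<le> 1" for h
  proof -
    have "theta_transform (z + h) - theta_transform z - h * D =
        (LINT u|lborel. exp (z * of_real u) * (exp (h * of_real u) - 1 - h * of_real u) * complex_of_real (theta_weight u))"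
      unfolding theta_transform_def D_def
      by (simp only: integral_mult_right_zero[symmetric] Bochner_Integration.integral_diff[symmetric]
            int0 int1 integrable_mult_right Bochner_Integration.integrable_diff)
         (simp add: algebra_simps exp_add)
    also have "norm \<dots> \<le> (LINT u|lborel. (norm h)\<^sup>2 * (u ^ 2 * exp (a * u) * theta_weight u))"
    proof (rule Bochner_Integration.integral_norm_bound_integral)
      show "integrable lborel (\<lambda>u. exp (z * of_real u) * (exp (h * of_real u) - 1 - h * of_real u) * complex_of_real (theta_weight u))"
      proof -
        have "integrable lborel (\<lambda>u. exp ((z + h) * of_real u) * complex_of_real (theta_weight u)
           - exp (z * of_real u) * complex_of_real (theta_weight u) - h * (of_real u * exp (z * of_real u) * complex_of_real (theta_weight u)))"
          by (intro Bochner_Integration.integrable_diff integrable_mult_right int0 int1)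
        thus ?thesis by (simp add: algebra_simps exp_add)
      qed
      show "integrable lborel (\<lambda>u. (norm h)\<^sup>2 * (u ^ 2 * exp (a * u) * theta_weight u))"
        by (intro integrable_mult_right integrable_power_exp_theta_weight)
      fix u :: real
      show "norm (exp (z * of_real u) * (exp (h * of_real u) - 1 - h * of_real u) * complex_of_real (theta_weight u))
              \<le> (norm h)\<^sup>2 * (u ^ 2 * exp (a * u) * theta_weight u)"
      proof (cases "u \<ge> 0")
        case True
        have hu: "norm (h * of_real u) = norm h * u" using True by (simp add: norm_mult)
        have "norm (exp (h * of_real u) - 1 - h * of_real u) \<le> (norm h * u)\<^sup>2 * exp (norm h * u)"
          using norm_exp_diff_le[of "h * of_real u"] unfolding hu .
        also have "\<dots> \<le> (norm h * u)\<^sup>2 * exp u"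
          using mult_right_mono[OF h True] by (intro mult_left_mono) auto
        finally have "exp (Re z * u) * norm (exp (h * of_real u) - 1 - h * of_real u) * theta_weight u
            \<le> exp (Re z * u) * ((norm h * u)\<^sup>2 * exp u) * theta_weight u"
          by (intro mult_right_mono mult_left_mono) (auto simp: theta_weight_nonneg)
        thus ?thesis
          by (simp add: norm_mult theta_weight_nonneg a_def distrib_left distrib_right exp_add power_mult_distrib mult_ac)
      qed (simp add: theta_weight_def)
    qed
    also have "\<dots> = (norm h)\<^sup>2 * C" by (simp add: C_def)
    finally show ?thesis .
  qed
  have "((\<lambda>h. (theta_transform (z + h) - theta_transform z) / h - D) \<longlongrightarrow> 0) (at 0)"
  proof (rule Lim_null_comparison)
    show "\<forall>\<^sub>F h in at 0. norm ((theta_transform (z + h) - theta_transform z) / h - D) \<le> norm h * C"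
      unfolding eventually_at
    proof (intro exI[of _ 1] conjI ballI impI)
      fix h :: complex assume h: "h \<noteq> 0 \<and> dist h 0 < 1"
      have "(theta_transform (z + h) - theta_transform z) / h - D = (theta_transform (z + h) - theta_transform z - h * D) / h"
        using h by (simp add: field_simps)
      also have "norm \<dots> \<le> (norm h)\<^sup>2 * C / norm h"
        unfolding norm_divide using h by (intro divide_right_mono bound) auto
      also have "\<dots> = norm h * C" using h by (simp add: power2_eq_square)
      finally show "norm ((theta_transform (z + h) - theta_transform z) / h - D) \<le> norm h * C" .
    qed auto
    show "((\<lambda>h::complex. norm h * C) \<longlongrightarrow> 0) (at 0)"
      by (intro tendsto_mult_left_zero tendsto_norm_zero tendsto_ident_at)
  qed
  hence "((\<lambda>h. (theta_transform (z + h) - theta_transform z) / h) \<longlongrightarrow> D) (at 0)"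
    by (simp add: LIM_zero_iff)
  thus ?thesis unfolding D_def DERIV_def .
qed

section \<open>Analytic continuation of zeta\<close>

lemma half_theta_inverse:
  assumes x: "x > 0"
  shows "half_theta (1 / x) = sqrt x * half_theta x + sqrt x / 2 - 1 / 2"
proof -
  have "1 + 2 * (\<Sum>n. exp (- (pi / x) * (real (Suc n))\<^sup>2)) =
           sqrt (pi / (pi / x)) * (1 + 2 * (\<Sum>n. exp (- (pi\<^sup>2 / (pi / x)) * (real (Suc n))\<^sup>2)))"
    using x by (intro gaussian_sum_transform) auto
  also have "(\<lambda>n. exp (- (pi / x) * (real (Suc n))\<^sup>2)) = (\<lambda>n. exp (- (pi * (real (Suc n))\<^sup>2) * (1 / x)))"
    by (simp add: fun_eq_iff)
  also have "(\<lambda>n. exp (- (pi\<^sup>2 / (pi / x)) * (real (Suc n))\<^sup>2)) = (\<lambda>n. exp (- (pi * (real (Suc n))\<^sup>2) * x))"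
    using x by (simp add: fun_eq_iff power2_eq_square)
  finally have "1 + 2 * half_theta (1 / x) = sqrt x * (1 + 2 * half_theta x)"
    using x by (simp add: half_theta_def)
  thus ?thesis by (simp add: field_simps)
qed

lemma exp_neg_integral_Ici:
  fixes c :: complex
  assumes c: "Re c > 0"
  shows "integrable lborel (\<lambda>u. indicator {0..} u *\<^sub>R exp (- c * of_real u))" (is ?int)
    and "(LINT u|lborel. indicator {0..} u *\<^sub>R exp (- c * of_real u)) = 1 / c" (is ?val)
proof -
  have c0: "c \<noteq> 0" using c by auto
  have "(\<lambda>u. exp (- Re c * u)) absolutely_integrable_on {0..}"
    by (rule nonnegative_absolutely_integrable_1)
       (use has_integral_exp_minus_to_infinity[OF c, of 0] in \<open>auto simp: integrable_on_def\<close>)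
  hence "integrable lborel (\<lambda>u. indicator {0..} u *\<^sub>R exp (- Re c * u))"
    unfolding set_integrable_def by (subst (asm) integrable_completion) auto
  thus int: ?int
    by (rule Bochner_Integration.integrable_bound) (auto simp: indicator_def)
  have "((\<lambda>b. LINT u:{0..b}|lborel. exp (- c * of_real u)) \<longlongrightarrow> (LINT u:{0..}|lborel. exp (- c * of_real u))) at_top"
    using int by (intro tendsto_set_lebesgue_integral_at_top) (auto simp: set_integrable_def)
  moreover have "((\<lambda>b. LINT u:{0..b}|lborel. exp (- c * of_real u)) \<longlongrightarrow> 1 / c) at_top"
  proof -
    have eq: "(LINT u:{0..b}|lborel. exp (- c * of_real u)) = 1 / c - exp (- c * of_real b) / c" if "b \<ge> 0" for b
    proof -
      have "set_integrable lborel {0..b} (\<lambda>u. exp (- c * of_real u))"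
        by (intro borel_integrable_atLeastAtMost') (auto intro!: continuous_intros)
      hence "(LINT u:{0..b}|lborel. exp (- c * of_real u)) = integral {0..b} (\<lambda>u. exp (- c * of_real u))"
        by (rule set_borel_integral_eq_integral)
      also have "((\<lambda>u. exp (- c * of_real u)) has_integral (- exp (- c * of_real b) / c - - exp (- c * of_real 0) / c)) {0..b}"
      proof (rule fundamental_theorem_of_calculus[OF that])
        fix x :: real
        have "((\<lambda>z. - exp (- c * z) / c) has_field_derivative exp (- c * of_real x)) (at (of_real x))"
          using c0 by (auto intro!: derivative_eq_intros)
        from has_vector_derivative_real_field[OF this]
        show "((\<lambda>u. - exp (- c * of_real u) / c) has_vector_derivative exp (- c * of_real x)) (at x within {0..b})"
          by (rule has_vector_derivative_at_within)
      qed
      hence "integral {0..b} (\<lambda>u. exp (- c * of_real u)) = - exp (- c * of_real b) / c - - exp (- c * of_real 0) / c"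
        by (rule integral_unique)
      finally show ?thesis by simp
    qed
    have "((\<lambda>b::real. exp (- c * of_real b)) \<longlongrightarrow> 0) at_top"
    proof (rule tendsto_norm_zero_cancel)
      have "((\<lambda>b::real. exp (- Re c * b)) \<longlongrightarrow> 0) at_top" using c by real_asymp
      thus "((\<lambda>b::real. norm (exp (- c * of_real b))) \<longlongrightarrow> 0) at_top" by simp
    qed
    hence "((\<lambda>b::real. 1 / c - exp (- c * of_real b) / c) \<longlongrightarrow> 1 / c - 0 / c) at_top"
      using c0 by (intro tendsto_intros) auto
    moreover have "\<forall>\<^sub>F b in at_top. 1 / c - exp (- c * of_real b) / c = (LINT u:{0..b}|lborel. exp (- c * of_real u))"
      using eventually_ge_at_top[of "0::real"] by eventually_elim (rule eq[symmetric])
    ultimately show ?thesis by (simp add: tendsto_cong)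
  qed
  ultimately show ?val
    unfolding set_lebesgue_integral_def by (rule tendsto_unique[OF trivial_limit_at_top_linorder])
qed

text \<open>The entire part of the completed zeta function pi^(-s/2) Gamma(s/2) zeta(s), that is,
  without its polar terms 1 / (s - 1) and - 1 / s; it is not Riemann's xi function. Its invariance
  under s -> 1 - s is visible in the two summands.\<close>

definition xi_entire :: "complex \<Rightarrow> complex" where
  "xi_entire s = theta_transform ((s - 1 / 2) / 2) + theta_transform (- ((s - 1 / 2) / 2))"

lemma integrable_theta_transform: "integrable lborel (\<lambda>u. exp (z * of_real u) * complex_of_real (theta_weight u))"
  by (rule Bochner_Integration.integrable_bound[OF integrable_exp_theta_weight[of "Re z"]])
     (auto simp: norm_mult abs_mult)

lemma exp_mult_exp_of_real: "exp a * complex_of_real (exp x) = exp (a + of_real x)"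
  by (simp add: exp_add exp_of_real)

text \<open>Riemann's argument. Integrating the theta series termwise gives the left side. The same
  integral is split at u = 0, and the theta transformation folds the negative half onto the positive
  one; its two elementary terms produce the poles at 1 and 0.\<close>

lemma Mellin_half_theta:
  assumes s: "Re s > 1"
  shows "(\<lambda>n. Gamma (s / 2) * exp (- (s / 2) * of_real (ln (pi * (real (Suc n))\<^sup>2)))) sums
           (xi_entire s + 1 / (s - 1) - 1 / s)"
proof -
  define f where "f = (\<lambda>n u. exp (s / 2 * of_real u) * complex_of_real (exp (- (pi * (real (Suc n))\<^sup>2) * exp u)))"
  define I where "I = (\<lambda>u. exp (s / 2 * of_real u) * complex_of_real (half_theta (exp u)))"
  have s2: "Re (s / 2) > 0" using s by simp
  have s0: "s \<noteq> 0" "s \<noteq> 1" using s by auto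
  have fint: "integrable lborel (f n)" for n
    unfolding f_def by (rule Mellin_exp(1)[OF s2]) simp
  have fval: "(LINT u|lborel. f n u) = Gamma (s / 2) * exp (- (s / 2) * of_real (ln (pi * (real (Suc n))\<^sup>2)))" for n
    unfolding f_def by (rule Mellin_exp(2)[OF s2]) simp
  have norm_f: "norm (f n u) = exp (Re s / 2 * u) * exp (- (pi * (real (Suc n))\<^sup>2) * exp u)" for n u
    by (simp add: f_def norm_mult)
  have fsum: "summable (\<lambda>n. norm (f n u))" for u
    unfolding norm_f by (intro summable_mult summable_half_theta) auto
  have fnorm: "summable (\<lambda>n. LINT u|lborel. norm (f n u))"
  proof -
    have "(LINT u|lborel. norm (f n u)) = Gamma (Re s / 2) * pi powr (- (Re s / 2)) * real (Suc n) powr (- Re s)" for n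
    proof -
      have "(LINT u|lborel. norm (f n u)) = Gamma (Re s / 2) * (pi * (real (Suc n))\<^sup>2) powr (- (Re s / 2))"
        unfolding norm_f using s by (intro integral_real_exp_kernel) auto
      also have "(pi * (real (Suc n))\<^sup>2) powr (- (Re s / 2)) = pi powr (- (Re s / 2)) * ((real (Suc n))\<^sup>2) powr (- (Re s / 2))"
        by (simp add: powr_mult)
      also have "((real (Suc n))\<^sup>2) powr (- (Re s / 2)) = real (Suc n) powr (- Re s)"
      proof -
        have "(real (Suc n))\<^sup>2 = real (Suc n) powr 2" by (simp del: of_nat_Suc)
        thus ?thesis by (simp only: powr_powr) simp
      qed
      finally show ?thesis by simp
    qed
    moreover have "summable (\<lambda>n. real (Suc n) powr (- Re s))"
      using s by (subst summable_Suc_iff, subst summable_real_powr_iff) auto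
    ultimately show ?thesis by (simp only: summable_mult)
  qed
  have suminf_f: "(\<Sum>n. f n u) = I u" for u
  proof -
    have sm: "summable (\<lambda>n. exp (- (pi * (real (Suc n))\<^sup>2) * exp u))" by (rule summable_half_theta) simp
    show ?thesis
      unfolding f_def I_def half_theta_def suminf_of_real[OF sm]
      by (rule suminf_mult[OF summable_of_real[OF sm]])
  qed
  have Iint: "integrable lborel I"
    using integrable_suminf[OF fint _ fnorm] fsum by (simp add: suminf_f)
  have sums: "(\<lambda>n. LINT u|lborel. f n u) sums (LINT u|lborel. I u)"
    using sums_integral[OF fint _ fnorm] fsum by (simp add: suminf_f)

  define A where "A = (\<lambda>u. exp ((s - 1 / 2) / 2 * of_real u) * complex_of_real (theta_weight u))"
  define B where "B = (\<lambda>u. exp (- ((s - 1 / 2) / 2) * of_real u) * complex_of_real (theta_weight u))"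
  define P where "P = (\<lambda>u. indicator {0..} u *\<^sub>R exp (- ((s - 1) / 2) * of_real u))"
  define Q where "Q = (\<lambda>u. indicator {0..} u *\<^sub>R exp (- (s / 2) * of_real u))"
  have [measurable]: "A \<in> borel_measurable borel" "B \<in> borel_measurable borel"
       "P \<in> borel_measurable borel" "Q \<in> borel_measurable borel" "I \<in> borel_measurable borel"
    unfolding A_def B_def P_def Q_def I_def by measurable
  have ints: "integrable lborel A" "integrable lborel B" "integrable lborel P" "integrable lborel Q"
    unfolding A_def B_def P_def Q_def using s
    by (intro integrable_theta_transform exp_neg_integral_Ici; simp)+
  have pos: "indicator {0..} u *\<^sub>R I u = A u" for u
  proof (cases "u \<ge> 0")
    case True
    have "exp (s / 2 * of_real u) = exp ((s - 1 / 2) / 2 * of_real u) * complex_of_real (exp (u / 4))"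
      unfolding exp_mult_exp_of_real by (rule arg_cong[where f = exp]) (simp add: field_simps)
    with True show ?thesis by (simp add: I_def A_def theta_weight_def)
  qed (simp add: A_def theta_weight_def)
  \<comment> \<open>The identity fails at u = 0, where only the right side keeps its endpoint; a
    single point does not matter to the integral.\<close>
  have neg: "indicator {..<0} (0 + (-1) * u) *\<^sub>R I (0 + (-1) * u) = B u + (1 / 2) * P u - (1 / 2) * Q u" if "u \<noteq> 0" for u
  proof (cases "u > 0")
    case True
    have "half_theta (exp (- u)) = half_theta (1 / exp u)" by (simp add: exp_minus inverse_eq_divide)
    also have "\<dots> = sqrt (exp u) * half_theta (exp u) + sqrt (exp u) / 2 - 1 / 2"
      by (rule half_theta_inverse) simp
    also have "sqrt (exp u) = exp (u / 2)"
      by (rule real_sqrt_unique) (auto simp: exp_double[symmetric] power2_eq_square exp_add[symmetric])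
    finally have ht: "half_theta (exp (- u)) = exp (u / 2) * half_theta (exp u) + exp (u / 2) / 2 - 1 / 2" .
    have e1: "exp (- (s / 2) * of_real u) * complex_of_real (exp (u / 2)) = exp (- ((s - 1 / 2) / 2) * of_real u) * complex_of_real (exp (u / 4))"
      unfolding exp_mult_exp_of_real by (rule arg_cong[where f = exp]) (simp add: field_simps)
    have e2: "exp (- (s / 2) * of_real u) * complex_of_real (exp (u / 2)) = exp (- ((s - 1) / 2) * of_real u)"
      unfolding exp_mult_exp_of_real by (rule arg_cong[where f = exp]) (simp add: field_simps)
    have "I (- u) = exp (- (s / 2) * of_real u) * complex_of_real (exp (u / 2) * half_theta (exp u) + exp (u / 2) / 2 - 1 / 2)"
      unfolding I_def ht[symmetric] by simp
    also have "\<dots> = (exp (- (s / 2) * of_real u) * complex_of_real (exp (u / 2))) * of_real (half_theta (exp u))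
        + (exp (- (s / 2) * of_real u) * complex_of_real (exp (u / 2))) / 2 - exp (- (s / 2) * of_real u) / 2"
      by (simp only: of_real_add of_real_diff of_real_mult of_real_divide of_real_1 of_real_numeral)
         (simp add: algebra_simps)
    also have "\<dots> = B u + (1 / 2) * P u - (1 / 2) * Q u"
      unfolding e2 using True
      by (subst e2[symmetric], subst e1) (simp add: B_def P_def Q_def theta_weight_def)
    finally show ?thesis using True by simp
  qed (use that in \<open>simp add: B_def P_def Q_def theta_weight_def\<close>)
  have "(LINT u|lborel. I u) = (LINT u|lborel. indicator {0..} u *\<^sub>R I u + indicator {..<0} u *\<^sub>R I u)"
    by (intro Bochner_Integration.integral_cong) (auto simp: indicator_def)
  also have "\<dots> = (LINT u|lborel. indicator {0..} u *\<^sub>R I u) + (LINT u|lborel. indicator {..<0} u *\<^sub>R I u)"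
    by (intro Bochner_Integration.integral_add integrable_mult_indicator Iint) auto
  also have "(LINT u|lborel. indicator {0..} u *\<^sub>R I u) = theta_transform ((s - 1 / 2) / 2)"
    unfolding pos unfolding A_def theta_transform_def ..
  also have "(LINT u|lborel. indicator {..<0} u *\<^sub>R I u) =
      (LINT u|lborel. indicator {..<0} (0 + (-1) * u) *\<^sub>R I (0 + (-1) * u))"
    using lborel_integral_real_affine[of "-1" "\<lambda>u. indicator {..<0} u *\<^sub>R I u" 0] by simp
  also have "\<dots> = (LINT u|lborel. B u + (1 / 2) * P u - (1 / 2) * Q u)"
  proof (rule integral_cong_AE)
    show "AE u in lborel. indicator {..<0} (0 + (-1) * u) *\<^sub>R I (0 + (-1) * u) = B u + (1 / 2) * P u - (1 / 2) * Q u"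
      using AE_lborel_singleton[of "0::real"] by eventually_elim (rule neg)
  qed measurable
  also have "\<dots> = (LINT u|lborel. B u) + (1 / 2) * (LINT u|lborel. P u) - (1 / 2) * (LINT u|lborel. Q u)"
    using ints by simp
  also have "(LINT u|lborel. B u) = theta_transform (- ((s - 1 / 2) / 2))"
    unfolding B_def theta_transform_def ..
  also have "(LINT u|lborel. P u) = 1 / ((s - 1) / 2)"
    unfolding P_def using s by (intro exp_neg_integral_Ici) simp
  also have "(LINT u|lborel. Q u) = 1 / (s / 2)"
    unfolding Q_def using s by (intro exp_neg_integral_Ici) simp
  finally have "(LINT u|lborel. I u) = xi_entire s + 1 / (s - 1) - 1 / s"
    using s0 by (simp add: xi_entire_def)
  with sums show ?thesis unfolding fval by simp
qed

text \<open>Multiplying through by \<open>rGamma (s / 2)\<close> cancels the pole at 0, so only the one at 1 is left.\<close>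

definition zeta_ext :: "complex \<Rightarrow> complex" where
  "zeta_ext s = exp (s / 2 * of_real (ln pi)) *
     (xi_entire s * rGamma (s / 2) - rGamma (s / 2 + 1) / (2 * (1 - s)))"

lemma holomorphic_theta_transform [holomorphic_intros]:
  assumes "f holomorphic_on A"
  shows "(\<lambda>z. theta_transform (f z)) holomorphic_on A"
proof -
  have "theta_transform holomorphic_on UNIV"
    using theta_transform_has_derivative
    by (auto simp: holomorphic_on_def field_differentiable_def intro: has_field_derivative_at_within)
  from holomorphic_on_compose_gen[OF assms this] show ?thesis by (simp add: o_def)
qed

lemma holomorphic_zeta_ext: "zeta_ext holomorphic_on - {1}"
  unfolding zeta_ext_def xi_entire_def by (intro holomorphic_intros) auto

definition gamma_factor :: "complex \<Rightarrow> complex" where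
  "gamma_factor s = exp (s / 2 * of_real (ln pi)) * rGamma (s / 2)"

lemma zeta_ext_eq_gamma_factor:
  assumes "s \<noteq> 0" "s \<noteq> 1"
  shows "zeta_ext s = gamma_factor s * (xi_entire s + 1 / (s - 1) - 1 / s)"
proof -
  have "rGamma (s / 2) = s / 2 * rGamma (s / 2 + 1)" by (rule rGamma_plus1[symmetric])
  hence "rGamma (s / 2) * (1 / (s - 1) - 1 / s) = - rGamma (s / 2 + 1) / (2 * (1 - s))"
    using assms by (simp add: divide_simps) (simp add: algebra_simps)
  moreover have "gamma_factor s * (xi_entire s + 1 / (s - 1) - 1 / s) =
        exp (s / 2 * of_real (ln pi)) * (xi_entire s * rGamma (s / 2) + rGamma (s / 2) * (1 / (s - 1) - 1 / s))"
    unfolding gamma_factor_def by (simp only: ring_distribs mult_ac add_ac diff_conv_add_uminus)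
  ultimately show ?thesis by (simp add: zeta_ext_def)
qed

lemma zeta_ext_sums:
  assumes s: "Re s > 1"
  shows "(\<lambda>n. 1 / of_nat (Suc n) powr s) sums zeta_ext s"
proof -
  let ?c = "exp (s / 2 * of_real (ln pi)) * rGamma (s / 2)"
  have s0: "s \<noteq> 0" "s \<noteq> 1" using s by auto
  have np: "s / 2 \<notin> \<int>\<^sub>\<le>\<^sub>0" using s by (auto elim!: nonpos_Ints_cases)
  have "(\<lambda>n. ?c * (Gamma (s / 2) * exp (- (s / 2) * of_real (ln (pi * (real (Suc n))\<^sup>2))))) sums
           (?c * (xi_entire s + 1 / (s - 1) - 1 / s))"
    by (intro sums_mult Mellin_half_theta s)
  also have "(\<lambda>n. ?c * (Gamma (s / 2) * exp (- (s / 2) * of_real (ln (pi * (real (Suc n))\<^sup>2))))) =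
      (\<lambda>n. 1 / of_nat (Suc n) powr s)"
  proof
    fix n
    have "rGamma (s / 2) * Gamma (s / 2) = 1"
      using np by (simp add: rGamma_inverse_Gamma Gamma_eq_zero_iff)
    hence "?c * (Gamma (s / 2) * exp (- (s / 2) * of_real (ln (pi * (real (Suc n))\<^sup>2)))) =
        exp (s / 2 * of_real (ln pi)) * exp (- (s / 2) * of_real (ln (pi * (real (Suc n))\<^sup>2)))"
      by (simp add: mult_ac)
    also have "\<dots> = exp (- (s * of_real (ln (real (Suc n)))))"
    proof -
      have "ln (pi * (real (Suc n))\<^sup>2) = ln pi + 2 * ln (real (Suc n))"
        by (simp add: ln_mult ln_realpow del: of_nat_Suc)
      thus ?thesis by (simp add: exp_add[symmetric] field_simps del: of_nat_Suc)
    qed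
    also have "exp (- (s * of_real (ln (real (Suc n))))) = 1 / of_nat (Suc n) powr s"
      by (simp add: powr_def exp_minus Ln_of_nat inverse_eq_divide del: of_nat_Suc)
    finally show "?c * (Gamma (s / 2) * exp (- (s / 2) * of_real (ln (pi * (real (Suc n))\<^sup>2)))) = 1 / of_nat (Suc n) powr s" .
  qed
  also have "?c * (xi_entire s + 1 / (s - 1) - 1 / s) = zeta_ext s"
    using zeta_ext_eq_gamma_factor[OF s0] by (simp only: gamma_factor_def)
  finally show ?thesis .
qed

text \<open>Any function meeting the description agrees with \<open>zeta_ext\<close> on the
  half-plane of convergence, hence, by the identity theorem, on the connected punctured
  plane.\<close>

lemma riemann_zeta_eq:
  assumes "s \<noteq> 1"
  shows "riemann_zeta s = zeta_ext s"
proof -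
  \<comment> \<open>At 1 the value of \<open>zeta_ext\<close> is an artefact of division by zero and
    is overwritten by the conventional 0.\<close>
  define f where "f = (\<lambda>s. if s = 1 then 0 else zeta_ext s)"
  have f_hol: "f holomorphic_on - {1}"
    by (rule holomorphic_transform[OF holomorphic_zeta_ext]) (auto simp: f_def)
  have f_sums: "(\<lambda>n. 1 / of_nat (Suc n) powr s) sums f s" if "Re s > 1" for s
  proof -
    have "s \<noteq> 1" using that by auto
    thus ?thesis using zeta_ext_sums[OF that] by (simp add: f_def)
  qed
  have "riemann_zeta = f"
    unfolding riemann_zeta_def
  proof (rule the_equality, intro conjI allI impI)
    fix g assume g: "g holomorphic_on - {1} \<and> (\<forall>s. Re s > 1 \<longrightarrow> (\<lambda>n. 1 / of_nat (Suc n) powr s) sums g s) \<and> g 1 = 0"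
    show "g = f"
    proof
      fix s :: complex
      show "g s = f s"
      proof (cases "s = 1")
        case False
        have "g s - f s = 0"
        proof (rule analytic_continuation[where f = "\<lambda>s. g s - f s" and S = "- {1}" and U = "{s. Re s > 1}" and \<xi> = 2])
          show "(\<lambda>s. g s - f s) holomorphic_on - {1}" using g f_hol by (intro holomorphic_intros) auto
          show "connected (- {1 :: complex})" by (rule connected_punctured_universe) simp
          have "open {s::complex. Re s > 1}" by (rule open_halfspace_Re_gt)
          thus "(2::complex) islimpt {s. Re s > 1}" by (intro interior_limit_point) (simp add: interior_open)
          fix z :: complex assume "z \<in> {s. Re s > 1}"
          hence z: "Re z > 1" by simp
          hence "(\<lambda>n. 1 / of_nat (Suc n) powr z) sums g z" using g by blast
          from sums_unique2[OF this f_sums[OF z]] show "g z - f z = 0" by simp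
        qed (use False in auto)
        thus ?thesis by simp
      qed (use g in \<open>simp add: f_def\<close>)
    qed
  qed (use f_hol f_sums in \<open>auto simp: f_def\<close>)
  from fun_cong[OF this, of s] show ?thesis using assms by (simp add: f_def)
qed

section \<open>The digamma function on the line \<open>Re z = 1/4\<close>\<close>

lemma half_le_iff:
  fixes a b :: real
  shows "2 * a \<le> b \<Longrightarrow> a \<le> b / 2" and "b \<le> 2 * a \<Longrightarrow> b / 2 \<le> a"
  by simp_all

lemma Digamma_quarter_limits:
  fixes y :: real
  shows "(\<lambda>m. ln (real m) - (\<Sum>n<m. (real n + 1/4) / ((real n
        + 1/4)\<^sup>2 + y\<^sup>2))) \<longlonglongrightarrow> Re (Digamma (1 / 4 + \<i> * of_real y))"
    and "(\<lambda>m. \<Sum>n<m. y / ((real n + 1/4)\<^sup>2 + y\<^sup>2)) \<longlonglongrightarrow> Im (Digamma (1 / 4 + \<i> * of_real y))"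
proof -
  have nz: "1 / 4 + \<i> * of_real y \<noteq> (0::complex)" by (auto simp: complex_eq_iff)
  note lim = Digamma_LIMSEQ[OF nz]
  have re: "Re (inverse (1 / 4 + \<i> * of_real y + of_nat n)) = (real n + 1/4) / ((real n + 1/4)\<^sup>2 + y\<^sup>2)" for n
    by (simp add: add.commute)
  have im: "Im (inverse (1 / 4 + \<i> * of_real y + of_nat n)) = - (y / ((real n + 1/4)\<^sup>2 + y\<^sup>2))" for n
    by (simp add: add.commute)
  show "(\<lambda>m. ln (real m) - (\<Sum>n<m. (real n + 1/4) / ((real n
        + 1/4)\<^sup>2 + y\<^sup>2))) \<longlonglongrightarrow> Re (Digamma (1 / 4 + \<i> * of_real y))"
    using tendsto_Re[OF lim] by (simp add: re Re_sum del: inverse_complex.simps)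
  show "(\<lambda>m. \<Sum>n<m. y / ((real n + 1/4)\<^sup>2 + y\<^sup>2)) \<longlonglongrightarrow> Im (Digamma (1 / 4 + \<i> * of_real y))"
    using tendsto_Im[OF lim] by (simp add: im Im_sum sum_negf del: inverse_complex.simps)
qed

text \<open>The logarithm is 2 artanh z. The lower bound is the first term of the series; for the
  upper bound every coefficient after the first is at most 1/3, so the rest is dominated by a
  geometric series in z^2.\<close>

lemma artanh_series_bounds:
  fixes z :: real
  assumes z: "0 \<le> z" "z < 1"
  shows "2 * z \<le> ln ((1 + z) / (1 - z))"
    and "ln ((1 + z) / (1 - z)) \<le> 2 * z + 2 * z ^ 3 / (3 * (1 - z\<^sup>2))"
proof -
  have d: "((\<lambda>z. ln ((1 + z) / (1 - z))) has_real_derivative 2 / (1 - t\<^sup>2)) (at t)" if "0 \<le> t" "t \<le> z" for t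
  proof -
    have "1 - t > 0" "1 + t > 0" "1 - t\<^sup>2 \<noteq> 0" using that z abs_square_eq_1[of t] by auto
    thus ?thesis
      by (auto intro!: derivative_eq_intros simp: divide_simps) (simp add: power2_eq_square algebra_simps)
  qed
  have sq: "0 < 1 - t\<^sup>2" "t\<^sup>2 \<le> 1" if "0 \<le> t" "t \<le> z" for t
    using that z power_strict_mono[of t 1 2] by auto
  have "ln ((1 + 0) / (1 - 0)) - 2 * 0 \<le> ln ((1 + z) / (1 - z)) - 2 * z"
  proof (rule DERIV_nonneg_imp_nondecreasing[OF z(1)])
    fix t assume t: "0 \<le> t" "t \<le> z"
    have "((\<lambda>z. ln ((1 + z) / (1 - z)) - 2 * z) has_real_derivative 2 / (1 - t\<^sup>2) - 2) (at t)"
      by (intro DERIV_diff d t) (auto intro!: derivative_eq_intros)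
    moreover have "2 / (1 - t\<^sup>2) - 2 \<ge> 0" using sq[OF t] by (simp add: field_simps)
    ultimately show "\<exists>y. ((\<lambda>z. ln ((1 + z) / (1 - z)) - 2 * z) has_real_derivative y) (at t) \<and> 0 \<le> y" by blast
  qed
  thus "2 * z \<le> ln ((1 + z) / (1 - z))" by simp
  have "2 * 0 + 2 * 0 ^ 3 / (3 * (1 - 0\<^sup>2)) - ln ((1 + 0) / (1 - 0)) \<le>
        2 * z + 2 * z ^ 3 / (3 * (1 - z\<^sup>2)) - ln ((1 + z) / (1 - z))"
  proof (rule DERIV_nonneg_imp_nondecreasing[OF z(1)])
    fix t assume t: "0 \<le> t" "t \<le> z"
    define w where "w = 1 - t\<^sup>2"
    have w: "w > 0" "w \<le> 1" using sq[OF t] by (auto simp: w_def)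
    have "((\<lambda>z. 2 * z + 2 * z ^ 3 / (3 * (1 - z\<^sup>2))) has_real_derivative
        2 + (2 * (3 * t\<^sup>2) * (3 * w) - 2 * t ^ 3 * (3 * (- 2 * t))) / (3 * w)\<^sup>2) (at t)"
      using w unfolding w_def by (auto intro!: derivative_eq_intros simp: power2_eq_square)
    hence "((\<lambda>z. 2 * z + 2 * z ^ 3 / (3 * (1 - z\<^sup>2)) - ln ((1 + z) / (1 - z))) has_real_derivative
        2 + (2 * (3 * t\<^sup>2) * (3 * w) - 2 * t ^ 3 * (3 * (- 2 * t))) / (3 * w)\<^sup>2 - 2 / w) (at t)"
      unfolding w_def by (intro DERIV_diff d t)
    moreover have "2 + (2 * (3 * t\<^sup>2) * (3 * w) - 2 * t ^ 3 * (3 * (- 2 * t))) / (3 * w)\<^sup>2 - 2 / w = 4 * (1 - w)\<^sup>2 / (3 * w\<^sup>2)"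
    proof -
      have t2: "t\<^sup>2 = 1 - w" by (simp add: w_def)
      have "2 * (3 * t\<^sup>2) * (3 * w) - 2 * t ^ 3 * (3 * (- 2 * t)) = 18 * t\<^sup>2 * w + 12 * (t\<^sup>2)\<^sup>2" by algebra
      thus ?thesis using w unfolding t2 by (simp add: field_simps power2_eq_square)
    qed
    ultimately show "\<exists>y. ((\<lambda>z. 2 * z + 2 * z ^ 3 / (3 * (1 - z\<^sup>2)) - ln ((1 + z) / (1 - z))) has_real_derivative y) (at t) \<and> 0 \<le> y"
      by (intro exI conjI) (assumption, simp)
  qed
  thus "ln ((1 + z) / (1 - z)) \<le> 2 * z + 2 * z ^ 3 / (3 * (1 - z\<^sup>2))" by simp
qed

lemma telescope_ln_limit:
  fixes c :: real
  shows "(\<lambda>m. ln (real m) - 1/2 * ln ((real m - 1/4)\<^sup>2 + c)) \<longlonglongrightarrow> 0"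
  by real_asymp

text \<open>The series is compared termwise with the differences of \<open>ln ((x - 1/2)\<^sup>2 + y\<^sup>2 + c) / 2\<close>, which are
  \<open>artanh (x / A)\<close> with \<open>A = x\<^sup>2 + y\<^sup>2 + c + 1/4\<close>; \<open>c = - 1/4\<close> makes them too large, \<open>c = 1/12\<close> too small.\<close>

lemma Re_Digamma_quarter_ge:
  fixes y :: real
  assumes y: "y\<^sup>2 > 1 / 4"
  shows "ln (y\<^sup>2 - 3 / 16) / 2 \<le> Re (Digamma (1 / 4 + \<i> * of_real y))"
proof -
  define g where "g = (\<lambda>n::nat. ln ((real n - 1/4)\<^sup>2 + (y\<^sup>2 - 1/4)) / 2)"
  have step: "(real n + 1/4) / ((real n + 1/4)\<^sup>2 + y\<^sup>2) \<le> g (Suc n) - g n" for n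
  proof -
    define x where "x = real n + 1/4"
    define A where "A = x\<^sup>2 + y\<^sup>2"
    have x: "x > 0" by (simp add: x_def)
    have A: "A > x"
    proof -
      have "A - x = (x - 1/2)\<^sup>2 + (y\<^sup>2 - 1/4)" by (simp add: A_def power2_eq_square algebra_simps)
      also have "\<dots> > 0" using y by (simp add: add_nonneg_pos)
      finally show ?thesis by simp
    qed
    have "2 * (x / A) \<le> ln ((1 + x / A) / (1 - x / A))"
      using x A by (intro artanh_series_bounds) auto
    also have "(1 + x / A) / (1 - x / A) = (A + x) / (A - x)" using x A by (simp add: divide_simps)
    also have "ln ((A + x) / (A - x)) = ln (A + x) - ln (A - x)" using x A by (intro ln_divide_pos) auto
    also have "A + x = (real (Suc n) - 1/4)\<^sup>2 + (y\<^sup>2 - 1/4)" by (simp add: A_def x_def power2_eq_square algebra_simps)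
    also have "A - x = (real n - 1/4)\<^sup>2 + (y\<^sup>2 - 1/4)" by (simp add: A_def x_def power2_eq_square algebra_simps)
    finally have "x / A \<le> (ln ((real (Suc n) - 1/4)\<^sup>2 + (y\<^sup>2 - 1/4)) - ln ((real n - 1/4)\<^sup>2 + (y\<^sup>2 - 1/4))) / 2"
      by (rule half_le_iff)
    thus ?thesis by (simp only: g_def x_def A_def diff_divide_distrib)
  qed
  have "ln (real m) - 1/2 * ln ((real m - 1/4)\<^sup>2 + (y\<^sup>2 - 1/4)) + g 0 \<le> ln (real m) - (\<Sum>n<m. (real n
        + 1/4) / ((real n + 1/4)\<^sup>2 + y\<^sup>2))" for m
  proof -
    have "(\<Sum>n<m. (real n + 1/4) / ((real n + 1/4)\<^sup>2 + y\<^sup>2)) \<le> (\<Sum>n<m. g (Suc n) - g n)"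
      by (intro sum_mono step)
    also have "\<dots> = g m - g 0" by (rule sum_lessThan_telescope)
    finally show ?thesis by (simp add: g_def)
  qed
  hence "0 + g 0 \<le> Re (Digamma (1 / 4 + \<i> * of_real y))"
    by (intro LIMSEQ_le[OF tendsto_add[OF telescope_ln_limit tendsto_const] Digamma_quarter_limits(1)]) auto
  thus ?thesis by (simp add: g_def power2_eq_square algebra_simps)
qed

lemma Re_Digamma_quarter_le:
  fixes y :: real
  assumes y: "y\<^sup>2 \<ge> 1 / 3"
  shows "Re (Digamma (1 / 4 + \<i> * of_real y)) \<le> ln (y\<^sup>2 + 7 / 48) / 2"
proof -
  define g where "g = (\<lambda>n::nat. ln ((real n - 1/4)\<^sup>2 + (y\<^sup>2 + 1/12)) / 2)"
  have step: "g (Suc n) - g n \<le> (real n + 1/4) / ((real n + 1/4)\<^sup>2 + y\<^sup>2)" for n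
  proof -
    define x where "x = real n + 1/4"
    \<comment> \<open>Here 1/3 is c + 1/4 with c = 1/12, so that A - 1/3 is the denominator of the
      series. For large x this shift is exactly what the cubic term of artanh demands, which is the
      origin of c.\<close>
    define A where "A = x\<^sup>2 + y\<^sup>2 + 1/3"
    have x: "x > 0" by (simp add: x_def)
    have A: "A > x"
    proof -
      have "A - x = (x - 1/2)\<^sup>2 + (y\<^sup>2 + 1/12)" by (simp add: A_def power2_eq_square algebra_simps)
      also have "\<dots> > 0" using y by (simp add: add_nonneg_pos)
      finally show ?thesis by simp
    qed
    have Ax: "A\<^sup>2 - x\<^sup>2 > 0" using x A by (simp add: power_strict_mono)
    have A1: "A - 1/3 > 0" using x y by (simp add: A_def add_pos_nonneg)
    have "ln (A + x) - ln (A - x) = ln ((A + x) / (A - x))" using x A by (intro ln_divide_pos[symmetric]) auto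
    also have "(A + x) / (A - x) = (1 + x / A) / (1 - x / A)" using x A by (simp add: divide_simps)
    also have "ln \<dots> \<le> 2 * (x / A) + 2 * (x / A) ^ 3 / (3 * (1 - (x / A)\<^sup>2))"
      using x A by (intro artanh_series_bounds) auto
    also have "\<dots> = 2 * (x / A) * (1 + x\<^sup>2 / (3 * (A\<^sup>2 - x\<^sup>2)))"
    proof -
      define D where "D = A\<^sup>2 - x\<^sup>2"
      have D: "D > 0" using Ax by (simp add: D_def)
      have e1: "1 - (x / A)\<^sup>2 = D / A\<^sup>2" using x A unfolding D_def by (simp add: power_divide diff_divide_distrib)
      have e2: "(x / A) ^ 3 = x * x\<^sup>2 / (A * A\<^sup>2)" by (simp add: power_divide power3_eq_cube power2_eq_square)
      show ?thesis unfolding e1 e2 D_def[symmetric] using x A D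
        by (simp add: divide_simps power2_eq_square) (simp add: algebra_simps)
    qed
    also have "\<dots> \<le> 2 * (x / A) * (1 + 1/3 / (A - 1/3))"
    proof -
      \<comment> \<open>The cubic correction is thereby paid for by replacing A with A - 1/3; the
        coefficient y^2 - 1/3 of x^2 below is where the lower bound on y^2 enters.\<close>
      have "x\<^sup>2 * (A - 1/3) \<le> A\<^sup>2 - x\<^sup>2"
      proof -
        have "A\<^sup>2 - x\<^sup>2 - x\<^sup>2 * (A - 1/3) = y\<^sup>2 * (x\<^sup>2 + y\<^sup>2) + 2/3 * y\<^sup>2 + 1/9 - x\<^sup>2 / 3"
          unfolding A_def by algebra
        also have "\<dots> = x\<^sup>2 * (y\<^sup>2 - 1/3) + (y\<^sup>2 * y\<^sup>2 + 2/3 * y\<^sup>2 + 1/9)" by (simp add: algebra_simps)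
        also have "\<dots> \<ge> 0" using y by (intro add_nonneg_nonneg mult_nonneg_nonneg) auto
        finally show ?thesis by simp
      qed
      hence "x\<^sup>2 / (3 * (A\<^sup>2 - x\<^sup>2)) \<le> 1/3 / (A - 1/3)" using Ax A1 by (simp add: divide_simps mult.commute)
      thus ?thesis using x A by (intro mult_left_mono) auto
    qed
    also have "\<dots> = 2 * (x / (A - 1/3))" using x A A1 by (simp add: divide_simps)
    finally have "ln (A + x) - ln (A - x) \<le> 2 * (x / (A - 1/3))" .
    moreover have "A + x = (real (Suc n) - 1/4)\<^sup>2 + (y\<^sup>2 + 1/12)" by (simp add: A_def x_def power2_eq_square algebra_simps)
    moreover have "A - x = (real n - 1/4)\<^sup>2 + (y\<^sup>2 + 1/12)" by (simp add: A_def x_def power2_eq_square algebra_simps)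
    moreover have "A - 1/3 = x\<^sup>2 + y\<^sup>2" by (simp add: A_def)
    ultimately have "ln ((real (Suc n) - 1/4)\<^sup>2 + (y\<^sup>2 + 1/12)) - ln ((real n - 1/4)\<^sup>2 + (y\<^sup>2
        + 1/12)) \<le> 2 * (x / (x\<^sup>2 + y\<^sup>2))"
      by (simp only:)
    hence "(ln ((real (Suc n) - 1/4)\<^sup>2 + (y\<^sup>2 + 1/12)) - ln ((real n - 1/4)\<^sup>2 + (y\<^sup>2
        + 1/12))) / 2 \<le> x / (x\<^sup>2 + y\<^sup>2)"
      by (rule half_le_iff)
    thus ?thesis by (simp only: g_def x_def diff_divide_distrib)
  qed
  have "ln (real m) - (\<Sum>n<m. (real n + 1/4) / ((real n + 1/4)\<^sup>2 + y\<^sup>2)) \<le> ln (real m) - 1/2 * ln ((real m - 1/4)\<^sup>2 + (y\<^sup>2 + 1/12)) + g 0" for m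
  proof -
    have "(\<Sum>n<m. g (Suc n) - g n) \<le> (\<Sum>n<m. (real n + 1/4) / ((real n + 1/4)\<^sup>2 + y\<^sup>2))"
      by (intro sum_mono step)
    moreover have "(\<Sum>n<m. g (Suc n) - g n) = g m - g 0" by (rule sum_lessThan_telescope)
    ultimately show ?thesis by (simp add: g_def)
  qed
  hence "Re (Digamma (1 / 4 + \<i> * of_real y)) \<le> 0 + g 0"
    by (intro LIMSEQ_le[OF Digamma_quarter_limits(1) tendsto_add[OF telescope_ln_limit tendsto_const]]) auto
  thus ?thesis by (simp add: g_def power2_eq_square algebra_simps)
qed

lemma Re_Digamma_quarter_mono:
  fixes y z :: real
  assumes "y\<^sup>2 \<le> z\<^sup>2"
  shows "Re (Digamma (1 / 4 + \<i> * of_real y)) \<le> Re (Digamma (1 / 4 + \<i> * of_real z))"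
proof (rule LIMSEQ_le[OF Digamma_quarter_limits(1) Digamma_quarter_limits(1)])
  have "(real n + 1/4) / ((real n + 1/4)\<^sup>2 + z\<^sup>2) \<le> (real n + 1/4) / ((real n + 1/4)\<^sup>2 + y\<^sup>2)" for n
    using assms by (intro divide_left_mono add_left_mono mult_pos_pos add_pos_nonneg) auto
  thus "\<exists>N. \<forall>m\<ge>N. ln (real m) - (\<Sum>n<m. (real n + 1/4) / ((real n + 1/4)\<^sup>2 + y\<^sup>2)) \<le>
      ln (real m) - (\<Sum>n<m. (real n + 1/4) / ((real n + 1/4)\<^sup>2 + z\<^sup>2))"
    by (intro exI allI impI diff_left_mono sum_mono)
qed

text \<open>Since ln pi = ln (pi^2) / 2, the two logarithmic bounds compare pi^2 directly with y^2 -
  3/16 and y^2 + 7/48. These shifts are 1/16 + c for c = - 1/4 and c = 1/12, and 3/16 is the larger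
  in absolute value.\<close>

lemma Re_Digamma_quarter_eq_ln_pi:
  fixes y :: real
  assumes "Re (Digamma (1 / 4 + \<i> * of_real y)) = ln pi"
  shows "\<bar>y\<^sup>2 - pi\<^sup>2\<bar> \<le> 3 / 16"
proof -
  have pi2: "ln pi = ln (pi\<^sup>2) / 2" by (simp add: ln_realpow)
  have y: "y\<^sup>2 \<ge> 1"
  proof (rule ccontr)
    assume "\<not> ?thesis"
    hence "y\<^sup>2 \<le> 1\<^sup>2" by simp
    from Re_Digamma_quarter_mono[OF this] have "ln pi \<le> ln (1\<^sup>2 + 7 / 48) / 2"
      using Re_Digamma_quarter_le[of 1] assms by simp
    hence "ln (pi\<^sup>2) \<le> ln (1\<^sup>2 + 7 / 48)" unfolding pi2 by linarith
    hence "pi\<^sup>2 \<le> 1\<^sup>2 + 7 / 48" by (subst (asm) ln_le_cancel_iff) auto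
    moreover have "pi\<^sup>2 \<ge> 3\<^sup>2" using pi_gt3 by (intro power_mono) auto
    ultimately show False by simp
  qed
  have "ln (y\<^sup>2 - 3 / 16) / 2 \<le> ln (pi\<^sup>2) / 2" using Re_Digamma_quarter_ge[of y] y assms pi2 by simp
  hence "y\<^sup>2 - 3 / 16 \<le> pi\<^sup>2" using y by (simp add: ln_le_cancel_iff)
  moreover have "ln (pi\<^sup>2) / 2 \<le> ln (y\<^sup>2 + 7 / 48) / 2" using Re_Digamma_quarter_le[of y] y assms pi2 by simp
  hence "pi\<^sup>2 \<le> y\<^sup>2 + 7 / 48" using y by (simp add: ln_le_cancel_iff)
  ultimately show ?thesis by linarith
qed

section \<open>The imaginary part of the digamma function for y near pi\<close>

lemma arctan_diff_le:
  fixes a b :: real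
  assumes "0 \<le> b" "b \<le> a"
  shows "arctan a - arctan b \<le> (a - b) / (1 + a * b)"
proof -
  let ?d = "arctan a - arctan b"
  have d: "0 \<le> ?d" "?d < pi / 2"
    using assms arctan_monotone'[of b a] arctan_ubound[of a] zero_le_arctan_iff[of b] by linarith+
  have "tan ?d = (tan (arctan a) - tan (arctan b)) / (1 + tan (arctan a) * tan (arctan b))"
    using d by (intro tan_diff) (auto simp: cos_gt_zero_pi intro!: less_imp_neq[symmetric] cos_gt_zero_pi)
  hence tan: "tan ?d = (a - b) / (1 + a * b)" by (simp add: tan_arctan)
  have "?d = arctan (tan ?d)" using d by (intro arctan_tan[symmetric]) auto
  also have "\<dots> \<le> tan ?d" using assms unfolding tan by (intro arctan_le_self divide_nonneg_nonneg) auto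
  finally show ?thesis unfolding tan .
qed

lemma arctan_le_quintic:
  fixes x :: real
  assumes "x \<ge> 0"
  shows "arctan x \<le> x - x ^ 3 / 3 + x ^ 5 / 5"
proof -
  have "(0 - 0 ^ 3 / 3 + 0 ^ 5 / 5) - arctan 0 \<le> (x - x ^ 3 / 3 + x ^ 5 / 5) - arctan x"
  proof (rule DERIV_nonneg_imp_nondecreasing[OF assms])
    fix t :: real
    have "((\<lambda>x. (x - x ^ 3 / 3 + x ^ 5 / 5) - arctan x) has_real_derivative (1 - t\<^sup>2 + t ^ 4) - inverse (1 + t\<^sup>2)) (at t)"
      by (auto intro!: derivative_eq_intros)
    moreover have "(1 - t\<^sup>2 + t ^ 4) - inverse (1 + t\<^sup>2) = t ^ 6 / (1 + t\<^sup>2)"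
    proof -
      have "1 + t\<^sup>2 > 0" by (simp add: add_pos_nonneg)
      moreover have "(1 - t\<^sup>2 + t ^ 4) * (1 + t\<^sup>2) - 1 = t ^ 6" by algebra
      ultimately show ?thesis by (simp add: field_simps)
    qed
    moreover have "t ^ 6 / (1 + t\<^sup>2) \<ge> 0" by (intro divide_nonneg_nonneg) auto
    ultimately show "\<exists>y. ((\<lambda>x. (x - x ^ 3 / 3 + x ^ 5 / 5) - arctan x) has_real_derivative y) (at t) \<and> 0 \<le> y"
      by (intro exI conjI) (assumption, simp)
  qed
  thus ?thesis by simp
qed

lemma near_pi_bounds:
  fixes y :: real
  assumes y: "y > 0" "\<bar>y\<^sup>2 - pi\<^sup>2\<bar> \<le> 3 / 16"
  shows "9682/1000 \<le> y\<^sup>2" "y\<^sup>2 \<le> 100572/10000" "31115/10000 \<le> y" "y \<le> 31714/10000"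
proof -
  have "((314159/100000)::real)\<^sup>2 \<le> pi\<^sup>2" "pi\<^sup>2 \<le> ((31416/10000)::real)\<^sup>2" using pi_approx by (auto intro!: power_mono)
  hence p: "98695/10000 \<le> pi\<^sup>2" "pi\<^sup>2 \<le> 98697/10000" by (simp_all add: power2_eq_square)
  have q: "y\<^sup>2 - pi\<^sup>2 \<le> 3 / 16" "- (y\<^sup>2 - pi\<^sup>2) \<le> 3 / 16" using y(2) by (simp_all only: abs_le_iff)
  show lo: "9682/1000 \<le> y\<^sup>2" using p q by linarith
  show hi: "y\<^sup>2 \<le> 100572/10000" using p q by linarith
  show "31115/10000 \<le> y" by (rule power2_le_imp_le) (use lo hi y in \<open>auto simp: power2_eq_square\<close>)
  show "y \<le> 31714/10000" by (rule power2_le_imp_le) (use lo hi y in \<open>auto simp: power2_eq_square\<close>)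
qed

text \<open>The first two terms of the series are estimated individually, where an integral
  comparison would be too crude, and the tail is bounded below by telescoping arctangents with total
  pi / 2 - \<open>g 0\<close>.\<close>

lemma Im_Digamma_quarter_ge:
  fixes y :: real
  assumes y: "y > 0" "\<bar>y\<^sup>2 - pi\<^sup>2\<bar> \<le> 3 / 16"
  shows "162/100 \<le> Im (Digamma (1 / 4 + \<i> * of_real y))"
proof -
  note b = near_pi_bounds[OF y]
  \<comment> \<open>The shift b = n + 1.81 has to satisfy b (b + 1) >= (n + 9/4)^2; the case n = 0
    is the critical one and 1.81 is just large enough for it.\<close>
  define g where "g = (\<lambda>n::nat. arctan ((real n + 181/100) / y))"
  have step: "g (Suc n) - g n \<le> y / ((real (n + 2) + 1/4)\<^sup>2 + y\<^sup>2)" for n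
  proof -
    let ?b = "real n + 181/100"
    have "g (Suc n) - g n \<le> ((?b + 1) / y - ?b / y) / (1 + (?b + 1) / y * (?b / y))"
      unfolding g_def using y by (intro order_trans[OF arctan_diff_le]) (auto simp: divide_right_mono add_ac)
    also have "\<dots> = y / (y\<^sup>2 + (?b + 1) * ?b)"
      using y by (simp add: field_simps power2_eq_square)
    also have "\<dots> \<le> y / ((real (n + 2) + 1/4)\<^sup>2 + y\<^sup>2)"
    proof -
      have "(real (n + 2) + 1/4)\<^sup>2 \<le> (?b + 1) * ?b"
        by (simp add: power2_eq_square algebra_simps)
      moreover have "(real (n + 2) + 1/4)\<^sup>2 + y\<^sup>2 > 0" using y by (simp add: add_nonneg_pos)
      ultimately show ?thesis using y by (intro divide_left_mono mult_pos_pos) auto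
    qed
    finally show ?thesis .
  qed
  have "y / (1/16 + y\<^sup>2) + y / (25/16 + y\<^sup>2) + (g m - g 0) \<le> (\<Sum>n<m + 2. y / ((real n + 1/4)\<^sup>2 + y\<^sup>2))" for m
  proof -
    have "g m - g 0 = (\<Sum>n<m. g (Suc n) - g n)" by (rule sum_lessThan_telescope[symmetric])
    also have "\<dots> \<le> (\<Sum>n<m. y / ((real (n + 2) + 1/4)\<^sup>2 + y\<^sup>2))" by (intro sum_mono step)
    also have "(\<Sum>n<m. y / ((real (n + 2) + 1/4)\<^sup>2 + y\<^sup>2)) + (y / (1/16 + y\<^sup>2) + y / (25/16 + y\<^sup>2)) = (\<Sum>n<m + 2. y / ((real n + 1/4)\<^sup>2 + y\<^sup>2))"
      by (simp add: sum.lessThan_Suc_shift numeral_2_eq_2 power2_eq_square add_ac del: sum.lessThan_Suc)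
    finally show ?thesis by simp
  qed
  moreover have "(\<lambda>m. y / (1/16 + y\<^sup>2) + y / (25/16 + y\<^sup>2) + (g m - g 0)) \<longlonglongrightarrow> y / (1/16 + y\<^sup>2) + y / (25/16 + y\<^sup>2) + (pi / 2 - g 0)"
  proof (intro tendsto_intros)
    have "filterlim (\<lambda>n. (real n + 181/100) / y) at_top sequentially" using y by real_asymp
    thus "g \<longlonglongrightarrow> pi / 2" unfolding g_def by (rule filterlim_compose[OF tendsto_arctan_at_top])
  qed
  ultimately have "y / (1/16 + y\<^sup>2) + y / (25/16 + y\<^sup>2) + (pi / 2 - g 0) \<le> Im (Digamma (1 / 4 + \<i> * of_real y))"
    using LIMSEQ_ignore_initial_segment[OF Digamma_quarter_limits(2)[of y], of 2] by (intro LIMSEQ_le) auto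
  moreover have "3133/10000 \<le> y / (1/16 + y\<^sup>2)" "2728/10000 \<le> y / (25/16 + y\<^sup>2)"
  proof -
    have "3133/10000 * (1/16 + y\<^sup>2) \<le> y" "2728/10000 * (25/16 + y\<^sup>2) \<le> y"
    proof -
      \<comment> \<open>This puts y^2 below its chord over the interval, which turns both
        inequalities into linear ones in y.\<close>
      have "(y - 31115/10000) * ((31714/10000) - y) \<ge> 0" using b by (intro mult_nonneg_nonneg) auto
      hence "y\<^sup>2 \<le> 62829/10000 * y - 31115/10000 * (31714/10000)" 
      proof -
        have "(y - 31115/10000) * ((31714/10000) - y) = (62829/10000) * y - 31115/10000 * (31714/10000) - y\<^sup>2" by algebra
        with \<open>(y - 31115/10000) * ((31714/10000) - y) \<ge> 0\<close> show ?thesis by linarith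
      qed
      hence Y: "y\<^sup>2 \<le> 62829/10000 * y - 98678/10000" by simp
      have "3133 * (1 + 16 * y\<^sup>2) \<le> 160000 * y" using Y b(4) by simp
      thus "3133/10000 * (1/16 + y\<^sup>2) \<le> y" by simp
      have "2728 * (25 + 16 * y\<^sup>2) \<le> 160000 * y" using Y b(4) by simp
      thus "2728/10000 * (25/16 + y\<^sup>2) \<le> y" by simp
    qed
    moreover have "1/16 + y\<^sup>2 > 0" "25/16 + y\<^sup>2 > 0" using b by linarith+
    ultimately show "3133/10000 \<le> y / (1/16 + y\<^sup>2)" "2728/10000 \<le> y / (25/16 + y\<^sup>2)" by (simp_all only: pos_le_divide_eq)
  qed
  moreover have "g 0 \<le> 53/100"
  proof -
    have "181/100 / y \<le> 582/1000" using b by (simp add: field_simps)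
    hence "g 0 \<le> arctan (582/1000)" by (simp add: g_def arctan_monotone')
    also have "\<dots> \<le> 53/100" using arctan_le_quintic[of "582/1000"] by (simp add: power_divide)
    finally show ?thesis .
  qed
  moreover have "pi \<ge> (31415/10000)" using pi_approx by simp
  ultimately show ?thesis by linarith
qed

section \<open>Bounds for the cosine and sine transforms\<close>

text \<open>The leading term of \<open>theta_weight\<close> on u >= 0. Being a single exponential it
  satisfies k' = (1/4 - pi exp u) k, the equation behind the certificates below.\<close>

definition theta_kernel :: "real \<Rightarrow> real" where
  "theta_kernel u = exp (u / 4) * exp (- pi * exp u)"

lemma theta_kernel_pos: "theta_kernel u > 0"
  by (simp add: theta_kernel_def)

lemma set_integrable_power_theta_kernel: "set_integrable lborel {0..} (\<lambda>u. u ^ k * theta_kernel u)"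
  unfolding set_integrable_def
proof (rule Bochner_Integration.integrable_bound)
  show "integrable lborel (\<lambda>u. fact k * (exp (5/4 * u) * exp (- pi * exp u)))"
    by (intro integrable_mult_right integrable_real_exp_kernel) auto
  show "AE u in lborel. norm (indicator {0..} u *\<^sub>R (u ^ k * theta_kernel u)) \<le> norm (fact k * (exp (5/4 * u) * exp (- pi * exp u)))"
  proof (rule AE_I2)
    fix u :: real
    show "norm (indicator {0..} u *\<^sub>R (u ^ k * theta_kernel u)) \<le> norm (fact k * (exp (5/4 * u) * exp (- pi * exp u)))"
    proof (cases "u \<ge> 0")
      case True
      have "u ^ k /\<^sub>R fact k \<le> exp u"
        using sum_le_suminf[OF summable_exp_generic[of u], of "{k}"] True by (simp add: exp_def)
      hence "u ^ k \<le> fact k * exp u" by (simp add: field_simps)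
      hence "u ^ k * theta_kernel u \<le> (fact k * exp u) * theta_kernel u"
        by (intro mult_right_mono) (auto simp: theta_kernel_pos less_imp_le)
      also have "\<dots> = fact k * ((exp u * exp (u / 4)) * exp (- pi * exp u))"
        by (simp add: theta_kernel_def)
      also have "exp u * exp (u / 4) = exp (5/4 * u)" by (simp add: exp_add[symmetric])
      finally show ?thesis using True theta_kernel_pos[of u] by (simp add: abs_mult)
    qed simp
  qed
qed (simp add: theta_kernel_def)

text \<open>A dual certificate: \<open>f\<close> is a supersolution of the first-order equation whose solution
  is \<open>(\<integral>\<^sub>u\<^sup>\<infinity> q k) / k\<close>.\<close>

lemma theta_kernel_integral_le:
  fixes f f' q :: "real \<Rightarrow> real"
  assumes f: "\<And>u. u \<ge> 0 \<Longrightarrow> (f has_real_derivative f' u) (at u)"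
    and ineq: "\<And>u. u \<ge> 0 \<Longrightarrow> q u \<le> (pi * exp u - 1 / 4) * f u - f' u"
    and int: "set_integrable lborel {0..} (\<lambda>u. q u * theta_kernel u)"
    and lim: "((\<lambda>u. f u * theta_kernel u) \<longlongrightarrow> 0) at_top"
  shows "(LINT u:{0..}|lborel. q u * theta_kernel u) \<le> f 0 * exp (- pi)"
proof (rule tendsto_le[OF trivial_limit_at_top_linorder])
  show "((\<lambda>b. LINT u:{0..b}|lborel. q u * theta_kernel u) \<longlongrightarrow> (LINT u:{0..}|lborel. q u * theta_kernel u)) at_top"
    by (intro tendsto_set_lebesgue_integral_at_top int) auto
  show "((\<lambda>b. f 0 * exp (- pi) - f b * theta_kernel b) \<longlongrightarrow> f 0 * exp (- pi)) at_top"
    using tendsto_diff[OF tendsto_const lim] by simp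
  show "\<forall>\<^sub>F b in at_top. (LINT u:{0..b}|lborel. q u * theta_kernel u) \<le> f 0 * exp (- pi) - f b * theta_kernel b"
    using eventually_ge_at_top[of 0]
  proof eventually_elim
    case (elim b)
    have ib: "set_integrable lborel {0..b} (\<lambda>u. q u * theta_kernel u)"
      by (rule set_integrable_subset[OF int]) auto
    have "((\<lambda>u. ((pi * exp u - 1 / 4) * f u - f' u) * theta_kernel u) has_integral
        (- (f b * theta_kernel b) - - (f 0 * theta_kernel 0))) {0..b}"
    proof (rule fundamental_theorem_of_calculus[OF elim])
      fix x assume x: "x \<in> {0..b}"
      have k: "(theta_kernel has_real_derivative (1 / 4 - pi * exp x) * theta_kernel x) (at x)"
        unfolding theta_kernel_def[abs_def] by (auto intro!: derivative_eq_intros simp: algebra_simps)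
      have "(f has_real_derivative f' x) (at x)" using x by (intro f) simp
      from DERIV_minus[OF DERIV_mult[OF this k]]
      have "((\<lambda>u. - (f u * theta_kernel u)) has_vector_derivative - (f' x * theta_kernel x + ((1 / 4 - pi * exp x) * theta_kernel x) * f x)) (at x)"
        by (simp only: has_real_derivative_iff_has_vector_derivative)
      also have "- (f' x * theta_kernel x + ((1 / 4 - pi * exp x) * theta_kernel x) * f x) = ((pi * exp x - 1 / 4) * f x - f' x) * theta_kernel x"
        by (simp add: algebra_simps)
      finally show "((\<lambda>u. - (f u * theta_kernel u)) has_vector_derivative ((pi * exp x - 1 / 4) * f x - f' x) * theta_kernel x) (at x within {0..b})"
        by (rule has_vector_derivative_at_within)
    qed
    note I1 = this
    have I2: "((\<lambda>u. q u * theta_kernel u) has_integral (LINT u:{0..b}|lborel. q u * theta_kernel u)) {0..b}"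
      using set_borel_integral_eq_integral[OF ib] by (simp add: has_integral_iff)
    have "(LINT u:{0..b}|lborel. q u * theta_kernel u) \<le> (- (f b * theta_kernel b) - - (f 0 * theta_kernel 0))"
    proof (rule has_integral_le[OF I2 I1])
      fix x assume "x \<in> {0..b}"
      thus "q x * theta_kernel x \<le> ((pi * exp x - 1 / 4) * f x - f' x) * theta_kernel x"
        using theta_kernel_pos[of x] by (intro mult_right_mono ineq) auto
    qed
    thus ?case by (simp add: theta_kernel_def)
  qed
qed

section \<open>Polynomial certificates for integrals against the kernel\<close>

lemma affine_nonneg_between:
  fixes a b :: real
  assumes "l \<le> x" "x \<le> h" "a + b * l \<ge> 0" "a + b * h \<ge> 0"
  shows "a + b * x \<ge> 0"
proof (cases "b \<ge> 0")
  case True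
  thus ?thesis using mult_left_mono[OF assms(1) True] assms by linarith
next
  case False
  thus ?thesis using mult_left_mono_neg[OF assms(2), of b] assms by linarith
qed

text \<open>Each of the five remainders is the derivative of the next and vanishes at 0, so
  nonnegativity propagates from exp (- u) >= 1 - u.\<close>

lemma exp_neg_taylor_bounds:
  fixes u :: real
  assumes "u \<ge> 0"
  shows "exp (- u) \<le> 1 - u + u\<^sup>2 / 2 - u ^ 3 / 6 + u ^ 4 / 24"
    and "1 - u + u\<^sup>2 / 2 - u ^ 3 / 6 + u ^ 4 / 24 - u ^ 5 / 120 \<le> exp (- u)"
proof -
  have mono: "0 \<le> F u" if "F 0 = 0" "\<And>t. (F has_real_derivative F' t) (at t)" "\<And>t. t \<ge> 0 \<Longrightarrow> F' t \<ge> 0" "u \<ge> 0" for F F' :: "real \<Rightarrow> real" and u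
  proof -
    have "F 0 \<le> F u"
    proof (rule DERIV_nonneg_imp_nondecreasing[OF that(4)])
      fix t assume "0 \<le> t" "t \<le> u"
      with that(2,3)[of t] show "\<exists>y. (F has_real_derivative y) (at t) \<and> 0 \<le> y" by (intro exI[of _ "F' t"] conjI)
    qed
    thus ?thesis by (simp only: that(1))
  qed
  have 1: "0 \<le> exp (- u) - (1 - u)" if "u \<ge> 0" for u :: real
    using exp_ge_add_one_self[of "- u"] by simp
  have 2: "0 \<le> (1 - u + u\<^sup>2 / 2) - exp (- u)" if "u \<ge> 0" for u :: real
    by (rule mono[where F = "\<lambda>u. (1 - u + u\<^sup>2 / 2) - exp (- u)", OF _ _ 1 that]) (auto intro!: derivative_eq_intros)
  have 3: "0 \<le> exp (- u) - (1 - u + u\<^sup>2 / 2 - u ^ 3 / 6)" if "u \<ge> 0" for u :: real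
    by (rule mono[where F = "\<lambda>u. exp (- u) - (1 - u + u\<^sup>2 / 2 - u ^ 3 / 6)", OF _ _ 2 that]) (auto intro!: derivative_eq_intros)
  have 4: "0 \<le> (1 - u + u\<^sup>2 / 2 - u ^ 3 / 6 + u ^ 4 / 24) - exp (- u)" if "u \<ge> 0" for u :: real
    by (rule mono[where F = "\<lambda>u. (1 - u + u\<^sup>2 / 2 - u ^ 3 / 6 + u ^ 4 / 24) - exp (- u)", OF _ _ 3 that]) (auto intro!: derivative_eq_intros)
  have 5: "0 \<le> exp (- u) - (1 - u + u\<^sup>2 / 2 - u ^ 3 / 6 + u ^ 4 / 24 - u ^ 5 / 120)" if "u \<ge> 0" for u :: real
    by (rule mono[where F = "\<lambda>u. exp (- u) - (1 - u + u\<^sup>2 / 2 - u ^ 3 / 6 + u ^ 4 / 24 - u ^ 5 / 120)", OF _ _ 4 that]) (auto intro!: derivative_eq_intros)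
  show "exp (- u) \<le> 1 - u + u\<^sup>2 / 2 - u ^ 3 / 6 + u ^ 4 / 24"
    and "1 - u + u\<^sup>2 / 2 - u ^ 3 / 6 + u ^ 4 / 24 - u ^ 5 / 120 \<le> exp (- u)"
    using 4[OF assms] 5[OF assms] by simp_all
qed

text \<open>The Bernstein coefficients of the polynomial on \<open>[0, 1/2]\<close> and \<open>[1/2, 3/2]\<close> are positive.\<close>

lemma certificate_minorant_nonneg:
  fixes u :: real
  assumes "0 \<le> u" "u \<le> 3/2"
  shows "0 \<le> 696/10000 - 745/1000*u + 3835/1000*u^2 - 8193/1000*u^3 + 8108/1000*u^4 - 4207/1000*u^5 + 169/100*u^6 - 383/1000*u^7 - 453/10000*u^8"
    (is "0 \<le> ?B")
proof (cases "u \<le> 1/2")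
  case True
  define v w where "v = u" and "w = 1/2 - u"
  have "?B = 11136/625 * v ^ 0 * w ^ 8 + 29488/625 * v ^ 1 * w ^ 7 + 48008/625 * v ^ 2 * w ^ 6 + 128556/625 * v ^ 3 * w ^ 5
        + 10252/25 * v ^ 4 * w ^ 4 + 270301/625 * v ^ 5 * w ^ 3 + 150208/625 * v ^ 6 * w ^ 2 + 168697/2500 * v ^ 7 * w ^ 1
        + 77423/10000 * v ^ 8 * w ^ 0"
    unfolding v_def w_def by algebra
  also have "\<dots> \<ge> 0"
    using assms True by (intro add_nonneg_nonneg mult_nonneg_nonneg zero_le_power) (auto simp: v_def w_def)
  finally show ?thesis .
next
  case False
  define v w where "v = u - 1/2" and "w = 3/2 - u"
  have "?B = 77423/2560000 * v ^ 0 * w ^ 8 + 15893/80000 * v ^ 1 * w ^ 7 + 195703/640000 * v ^ 2 * w ^ 6 + 1087/6400 * v ^ 3 * w ^ 5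
        + 807109/256000 * v ^ 4 * w ^ 4 + 206079/20000 * v ^ 5 * w ^ 3 + 7977203/640000 * v ^ 6 * w ^ 2 + 188819/32000 * v ^ 7 * w ^ 1
        + 1470903/2560000 * v ^ 8 * w ^ 0"
    unfolding v_def w_def by algebra
  also have "\<dots> \<ge> 0"
    using assms False by (intro add_nonneg_nonneg mult_nonneg_nonneg zero_le_power) (auto simp: v_def w_def)
  finally show ?thesis .
qed

text \<open>\<open>exp (- u) * cert_poly u\<close> is a slightly enlarged numerical solution (collocation, then rounding) of
  \<open>(\<pi> exp u - 1/4) f - f' = q\<close>, where \<open>q\<close> is a quartic majorant of \<open>1.62 cos (y u) - u sin (y u)\<close> for \<open>y\<close>
  near \<open>\<pi>\<close>.\<close>

definition cert_poly :: "real \<Rightarrow> real" where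
  "cert_poly u = (28/100) - 6/10 * u - 12/10 * u ^ 2 + 3/10 * u ^ 3 + 3 * u ^ 4 + 4/10 * u ^ 5"

definition cert_poly' :: "real \<Rightarrow> real" where
  "cert_poly' u = - 6/10 - 24/10 * u + 9/10 * u ^ 2 + 12 * u ^ 3 + 2 * u ^ 4"

text \<open>The supersolution inequality for f = exp (- u) * \<open>cert_poly u\<close>: the growing
  factor exp u cancels, leaving polynomials and a single exp (- u).\<close>

lemma cert_poly_ineq:
  fixes u :: real
  assumes u: "u \<ge> 0"
  shows "162/100 - 1095/100 * u ^ 2 + 1215/100 * u ^ 4 \<le> pi * cert_poly u - exp (- u) * (cert_poly' u - 3/4 * cert_poly u)"
proof -
  define R where "R = (\<lambda>p e. (- e * (cert_poly' u - 3/4 * cert_poly u) - ((162/100) - 1095/100 * u ^ 2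
        + 1215/100 * u ^ 4)) + cert_poly u * p)"
  have R_e: "R p e = (p * cert_poly u - ((162/100) - 1095/100 * u ^ 2 + 1215/100 * u ^ 4)) + (- (cert_poly' u - 3/4 * cert_poly u)) * e" for p e
    by (simp add: R_def algebra_simps)
  \<comment> \<open>\<open>R\<close> is affine in each argument separately, so it suffices to test
    it at the four corners of a box containing the pair of pi and exp (- u).\<close>
  have R_between: "R pi (exp (- u)) \<ge> 0"
    if "l \<le> exp (- u)" "exp (- u) \<le> h" "R (31415/10000) l \<ge> 0" "R (31415/10000) h \<ge> 0" "R (31416/10000) l \<ge> 0" "R (31416/10000) h \<ge> 0" for l h
  proof -
    have "R p (exp (- u)) \<ge> 0" if "R p l \<ge> 0" "R p h \<ge> 0" for p
      using that unfolding R_e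
      by (rule affine_nonneg_between[OF \<open>l \<le> exp (- u)\<close> \<open>exp (- u) \<le> h\<close>])
    from this[OF that(3,4)] this[OF that(5,6)] show ?thesis unfolding R_def
      by (rule affine_nonneg_between[rotated 2]) (use pi_approx in auto)
  qed
  have "R pi (exp (- u)) \<ge> 0"
  proof (cases "u \<le> 3/2")
    case True
    \<comment> \<open>One polynomial lying below all four corner polynomials, so that one positivity
      check serves them all. The differences have nonnegative coefficients once the negative u^10
      term is written through 9/4 - u^2.\<close>
    let ?B = "696/10000 - 745/1000*u + 3835/1000*u^2 - 8193/1000*u^3 + 8108/1000*u^4 - 4207/1000*u^5 + 169/100*u^6 - 383/1000*u^7 - 453/10000*u^8"
    let ?E4 = "1 - u + u\<^sup>2 / 2 - u ^ 3 / 6 + u ^ 4 / 24"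
    let ?E5 = "1 - u + u\<^sup>2 / 2 - u ^ 3 / 6 + u ^ 4 / 24 - u ^ 5 / 120"
    have "u * u \<le> 3/2 * (3/2)" using True u by (intro mult_mono) auto
    hence u2: "u\<^sup>2 \<le> 9/4" by (simp add: power2_eq_square)
    note B = certificate_minorant_nonneg[OF u True]
    have 1: "R (31415/10000) ?E5 - ?B = 1/50000 + 1/10000 * u ^ 1 + 1/5000 * u ^ 2 + 9/20000 * u ^ 3 + 1/4000 * u ^ 4 + 3/5000 * u ^ 5
        + 1/160 * u ^ 6 + 377/24000 * u ^ 7 + 5893/60000 * u ^ 8 + 1/96 * u ^ 9 + 1/400 * (u ^ 8 * (9/4 - u\<^sup>2))"
      unfolding R_def cert_poly_def cert_poly'_def by algebra
    have 2: "R (31415/10000) ?E4 - ?B = 1/50000 + 1/10000 * u ^ 1 + 1/5000 * u ^ 2 + 9/20000 * u ^ 3 + 1/4000 * u ^ 4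
        + 147/20000 * u ^ 5 + 9/400 * u ^ 6 + 17/24000 * u ^ 7 + 343/60000 * u ^ 8 + 1/80 * u ^ 9"
      unfolding R_def cert_poly_def cert_poly'_def by algebra
    have 3: "R (31416/10000) ?E5 - ?B = 3/62500 + 1/25000 * u ^ 1 + 1/12500 * u ^ 2 + 3/6250 * u ^ 3 + 11/20000 * u ^ 4
        + 2/3125 * u ^ 5 + 1/160 * u ^ 6 + 377/24000 * u ^ 7 + 5893/60000 * u ^ 8 + 1/96 * u ^ 9 + 1/400 * (u ^ 8 * (9/4 - u\<^sup>2))"
      unfolding R_def cert_poly_def cert_poly'_def by algebra
    have 4: "R (31416/10000) ?E4 - ?B = 3/62500 + 1/25000 * u ^ 1 + 1/12500 * u ^ 2 + 3/6250 * u ^ 3 + 11/20000 * u ^ 4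
        + 739/100000 * u ^ 5 + 9/400 * u ^ 6 + 17/24000 * u ^ 7 + 343/60000 * u ^ 8 + 1/80 * u ^ 9"
      unfolding R_def cert_poly_def cert_poly'_def by algebra
    have pos: "0 \<le> a" if "0 \<le> a - ?B" for a using B that by linarith
    have "0 \<le> R (31415/10000) ?E5" "0 \<le> R (31416/10000) ?E5"
      by (rule pos, unfold 1 3, use u u2 in \<open>intro add_nonneg_nonneg mult_nonneg_nonneg zero_le_power; simp\<close>)+
    moreover have "0 \<le> R (31415/10000) ?E4" "0 \<le> R (31416/10000) ?E4"
      by (rule pos, unfold 2 4, use u in \<open>intro add_nonneg_nonneg mult_nonneg_nonneg zero_le_power; simp\<close>)+
    ultimately show ?thesis
      by (intro R_between[OF exp_neg_taylor_bounds(2)[OF u] exp_neg_taylor_bounds(1)[OF u]])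
  next
    case False
    \<comment> \<open>Beyond 3/2 the crude box 0 <= exp (- u) <= 1/4 is enough: expanded at 3/2, all
      four corner polynomials have positive coefficients.\<close>
    define v where "v = u - 3/2"
    have v: "v \<ge> 0" and uv: "u = v + 3/2" using False by (auto simp: v_def)
    have 1: "R (31415/10000) 0 = 9210361/800000 + 841227/40000 * v ^ 1 + 681489/40000 * v ^ 2 + 257259/20000 * v ^ 3
        + 6699/1000 * v ^ 4 + 6283/5000 * v ^ 5" unfolding R_def cert_poly_def cert_poly'_def uv by algebra
    have 2: "R (31415/10000) (1/4) = 953993/400000 + 60801/20000 * v ^ 1 + 134307/20000 * v ^ 2 + 119817/10000 * v ^ 3
        + 1831/250 * v ^ 4 + 3329/2500 * v ^ 5" unfolding R_def cert_poly_def cert_poly'_def uv by algebra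
    have 3: "R (31416/10000) 0 = 11514543/1000000 + 65736/3125 * v ^ 1 + 213033/12500 * v ^ 2 + 160821/12500 * v ^ 3
        + 16749/2500 * v ^ 4 + 3927/3125 * v ^ 5" unfolding R_def cert_poly_def cert_poly'_def uv by algebra
    have 4: "R (31416/10000) (1/4) = 9546297/4000000 + 608979/200000 * v ^ 1 + 1344153/200000 * v ^ 2 + 1198443/100000 * v ^ 3
        + 36623/5000 * v ^ 4 + 33291/25000 * v ^ 5" unfolding R_def cert_poly_def cert_poly'_def uv by algebra
    have nn: "R (31415/10000) 0 \<ge> 0" "R (31415/10000) (1/4) \<ge> 0" "R (31416/10000) 0 \<ge> 0" "R (31416/10000) (1/4) \<ge> 0"
      unfolding 1 2 3 4 using v
      by (intro add_nonneg_nonneg mult_nonneg_nonneg zero_le_power; simp)+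
    have "exp (- u) \<le> exp (- 3/2)" using False by simp
    also have "\<dots> \<le> 1 / 4"
    proof -
      have "(1 + 1/2 + (1/2)\<^sup>2 / 2) ^ 3 \<le> (exp (1/2) ^ 3 :: real)"
        by (intro power_mono exp_lower_Taylor_quadratic) auto
      also have "exp (1/2) ^ 3 = (exp (3/2) :: real)" using exp_of_nat_mult[of 3 "1/2 :: real"] by simp
      finally have "exp (3/2 :: real) \<ge> 4" by (simp add: power2_eq_square power3_eq_cube)
      thus ?thesis by (simp add: exp_minus field_simps)
    qed
    finally show ?thesis by (intro R_between[of 0 "1/4"] nn) auto
  qed
  thus ?thesis by (simp add: R_def algebra_simps)
qed

text \<open>The true value is about 23.14; with 22 the numerical estimate in
  \<open>stationary_point_inequality\<close> would fail.\<close>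

lemma exp_pi_ge: "exp pi \<ge> 23"
proof -
  have "(2718/1000 :: real) \<le> exp 1" using abs_le_D2[OF e_approx_32] by simp
  hence "(2718/1000 :: real) ^ 3 \<le> exp 1 ^ 3" by (intro power_mono) auto
  also have "exp (1::real) ^ 3 = exp 3" using exp_of_nat_mult[of 3 "1 :: real"] by simp
  finally have e3: "20 \<le> exp (3::real)" by (simp add: power3_eq_cube)
  have "115/100 \<le> 1 + 1415/10000 + (1415/10000)\<^sup>2 / (2::real)" by (simp add: power2_eq_square)
  also have "\<dots> \<le> exp (1415/10000)" by (rule exp_lower_Taylor_quadratic) simp
  finally have "20 * (115/100) \<le> exp 3 * exp (1415/10000::real)" using e3 by (intro mult_mono) auto
  also have "\<dots> = exp (3 + 1415/10000)" by (rule exp_add[symmetric])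
  also have "\<dots> \<le> exp pi" using pi_approx by simp
  finally show ?thesis by simp
qed

lemma exp_neg_pi_le: "exp (- pi) \<le> 1 / 23"
  using exp_pi_ge by (simp add: exp_minus field_simps)

text \<open>The terms after the first cost at most the factor 1 / (1 - exp (- 3 pi)), and exp (- 3
  pi) is below 23^(-3).\<close>

lemma theta_weight_bounds:
  assumes u: "u \<ge> 0"
  shows "theta_kernel u \<le> theta_weight u" and "theta_weight u \<le> 1001/1000 * theta_kernel u"
proof -
  have "exp (- pi * exp u) \<le> half_theta (exp u)"
    using sum_le_suminf[OF summable_half_theta[of "exp u"], of "{0}"] by (simp add: half_theta_def)
  thus "theta_kernel u \<le> theta_weight u"
    using u by (simp add: theta_kernel_def theta_weight_def)
  have "exp (- 3 * pi) = exp (- pi) ^ 3" using exp_of_nat_mult[of 3 "- pi"] by simp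
  also have "\<dots> \<le> (1/23) ^ 3" by (intro power_mono exp_neg_pi_le) auto
  finally have "exp (- 3 * pi) \<le> 1/1001" by (simp add: power3_eq_cube)
  hence e: "1 / (1 - exp (- 3 * pi)) \<le> 1001/1000" by (simp add: field_simps)
  have "half_theta (exp u) \<le> exp (- pi * exp u) * (1 / (1 - exp (- 3 * pi)))"
    using half_theta_le[of "exp u"] u by simp
  also have "\<dots> \<le> exp (- pi * exp u) * (1001/1000)" by (intro mult_left_mono e) auto
  finally have "exp (u / 4) * half_theta (exp u) \<le> exp (u / 4) * (exp (- pi * exp u) * (1001/1000))"
    by (intro mult_left_mono) auto
  thus "theta_weight u \<le> 1001/1000 * theta_kernel u"
    using u by (simp add: theta_kernel_def theta_weight_def mult_ac)
qed

text \<open>The total mass bounds the cosine transform at every y, sharply enough to fix the sign of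
  \<open>xi_line\<close> near the zeros of theta' and at 0.\<close>

lemma integral_theta_weight_le:
  "(LINT u|lborel. theta_weight u) \<le> 2805/10000 * exp (- pi)"
proof -
  have int: "set_integrable lborel {0..} (\<lambda>u. 1001/1000 * theta_kernel u)"
    using set_integrable_mult_right[OF set_integrable_power_theta_kernel[of 0], of "1001/1000"] by simp
  have "(LINT u|lborel. theta_weight u) \<le> (LINT u:{0..}|lborel. 1001/1000 * theta_kernel u)"
    unfolding set_lebesgue_integral_def
  proof (rule integral_mono)
    show "integrable lborel theta_weight" using integrable_exp_theta_weight[of 0] by simp
    show "integrable lborel (\<lambda>u. indicator {0..} u *\<^sub>R (1001/1000 * theta_kernel u))"
      using int by (simp add: set_integrable_def)
    fix u :: real
    show "theta_weight u \<le> indicator {0..} u *\<^sub>R (1001/1000 * theta_kernel u)"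
      using theta_weight_bounds(2)[of u] by (cases "u \<ge> 0") (auto simp: theta_weight_def)
  qed
  also have "\<dots> \<le> (exp (- 0) * (2805/10000 + 89/1000 * 0)) * exp (- pi)"
  \<comment> \<open>The certificate is exp (- u) times a linear function, tuned so that the
    inequality is nearly an equality at u = 0, where its value becomes the bound.\<close>
  proof (rule theta_kernel_integral_le[where f = "\<lambda>u. exp (- u) * (2805/10000 + 89/1000 * u)"
        and f' = "\<lambda>u. exp (- u) * (89/1000 - (2805/10000 + 89/1000 * u))", OF _ _ int])
    fix u :: real assume u: "u \<ge> 0"
    show "((\<lambda>u. exp (- u) * (2805/10000 + 89/1000 * u)) has_real_derivative exp (- u) * (89/1000 - (2805/10000 + 89/1000 * u))) (at u)"
      by (auto intro!: derivative_eq_intros simp: field_simps)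
    define h where "h = 2805/10000 + 89/1000 * u"
    have h: "h \<ge> 2805/10000" using u by (simp add: h_def)
    have "(pi * exp u - 1 / 4) * (exp (- u) * h) - exp (- u) * (89/1000 - h) = pi * h * (exp u * exp (- u)) + exp (- u) * (3/4 * h - 89/1000)"
      by (simp add: algebra_simps)
    also have "exp u * exp (- u) = 1" by (simp add: exp_minus)
    also have "pi * h * 1 + exp (- u) * (3/4 * h - 89/1000) \<ge> 1001/1000"
    proof -
      have ph: "31415/10000 * h \<le> pi * h" using pi_approx h by (intro mult_right_mono) auto
      show ?thesis
      proof (cases "u \<le> 1")
        case True
        have "(1 - u) * (3/4 * h - 89/1000) \<le> exp (- u) * (3/4 * h - 89/1000)"
          using exp_ge_add_one_self[of "- u"] h by (intro mult_right_mono) auto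
        moreover have "1001/1000 \<le> 31415/10000 * h + (1 - u) * (3/4 * h - 89/1000)"
        proof -
          have "u * u \<le> u" using u True by (simp add: mult_left_le)
          thus ?thesis using u unfolding h_def by (simp add: field_simps)
        qed
        ultimately show ?thesis using ph by linarith
      next
        case False
        have "0 \<le> exp (- u) * (3/4 * h - 89/1000)" using h by (intro mult_nonneg_nonneg) auto
        moreover have "h \<ge> 3695/10000" using False by (simp add: h_def)
        ultimately show ?thesis using ph by linarith
      qed
    qed
    finally show "1001/1000 \<le> (pi * exp u - 1 / 4) * (exp (- u) * (2805/10000 + 89/1000 * u)) - exp (- u) * (89/1000 - (2805/10000
        + 89/1000 * u))"
      unfolding h_def .
  next
    show "((\<lambda>u. exp (- u) * (2805/10000 + 89/1000 * u) * theta_kernel u) \<longlongrightarrow> 0) at_top"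
      unfolding theta_kernel_def using pi_gt_zero by real_asymp
  qed
  finally show ?thesis by simp
qed

lemma integrable_cos_theta_weight: "integrable lborel (\<lambda>u. cos (y * u) * theta_weight u)"
  by (rule Bochner_Integration.integrable_bound[OF integrable_power_exp_theta_weight[of 0 0]])
     (auto simp: abs_mult theta_weight_nonneg intro!: mult_left_le_one_le)

lemma integrable_sin_theta_weight: "integrable lborel (\<lambda>u. u * sin (y * u) * theta_weight u)"
  by (rule Bochner_Integration.integrable_bound[OF integrable_power_exp_theta_weight[of 1 0]])
     (auto simp: abs_mult theta_weight_nonneg intro!: mult_right_mono mult_left_le)

text \<open>The weight 162/100 is the lower bound from \<open>Im_Digamma_quarter_ge\<close>, so this
  is exactly the combination of the transforms that enters X.\<close>

lemma cos_sin_transform_le: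
  fixes y :: real
  assumes y: "y > 0" "\<bar>y\<^sup>2 - pi\<^sup>2\<bar> \<le> 3 / 16"
  shows "162/100 * (LINT u|lborel. cos (y * u) * theta_weight u) - (LINT u|lborel. u * sin (y * u) * theta_weight u)
           \<le> 2809/10000 * exp (- pi)"
proof -
  note b = near_pi_bounds[OF y]
  define qt where "qt = (\<lambda>u. 162/100 * cos (y * u) - u * sin (y * u))"
  \<comment> \<open>The Taylor majorant of \<open>qt\<close>, with its quadratic and quartic
    coefficients rounded to cover every y in the range.\<close>
  define q where "q = (\<lambda>u::real. 162/100 - 1095/100 * u ^ 2 + 1215/100 * u ^ 4)"
  \<comment> \<open>The extra term pays for replacing \<open>theta_weight\<close> by
    \<open>theta_kernel\<close>: they differ by at most a thousandth of the kernel, and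
    \<open>qt u\<close> is at most 162/100 + u.\<close>
  define Q where "Q = (\<lambda>u. q u + (162/100 + u) / 1000)"
  have qt_le: "qt u \<le> q u" if u: "u \<ge> 0" for u
  proof -
    have yu: "y * u \<ge> 0" using y u by simp
    have y3: "y ^ 3 \<le> 31896/1000" "y ^ 4 \<le> 10115/100"
    proof -
      have "y * y\<^sup>2 \<le> 31714/10000 * (100572/10000)" using b y by (intro mult_mono) auto
      thus "y ^ 3 \<le> 31896/1000" by (simp add: power3_eq_cube power2_eq_square)
      have "y\<^sup>2 * y\<^sup>2 \<le> 100572/10000 * (100572/10000)" using b by (intro mult_mono) auto
      thus "y ^ 4 \<le> 10115/100" by (simp add: power_numeral_reduce)
    qed
    have "qt u \<le> 162/100 * (1 - (y * u)\<^sup>2 / 2 + (y * u) ^ 4 / 24) - u * (y * u - (y * u) ^ 3 / 6)"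
      unfolding qt_def by (intro diff_mono mult_left_mono cos_le_quartic sin_ge_cubic yu u) simp
    also have "\<dots> = 162/100 - (81/100 * y\<^sup>2 + y) * u ^ 2 + (162/2400 * y ^ 4 + y ^ 3 / 6) * u ^ 4"
      by (simp add: field_simps eval_nat_numeral)
    also have "\<dots> \<le> 162/100 - 1095/100 * u ^ 2 + 1215/100 * u ^ 4"
    proof -
      have "1095/100 \<le> 81/100 * y\<^sup>2 + y" using b by linarith
      hence "1095/100 * u ^ 2 \<le> (81/100 * y\<^sup>2 + y) * u ^ 2" by (intro mult_right_mono) auto
      moreover have "162/2400 * y ^ 4 + y ^ 3 / 6 \<le> 1215/100" using y3 by linarith
      hence "(162/2400 * y ^ 4 + y ^ 3 / 6) * u ^ 4 \<le> 1215/100 * u ^ 4" by (intro mult_right_mono) auto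
      ultimately show ?thesis by linarith
    qed
    finally show ?thesis by (simp add: q_def)
  qed
  have int: "set_integrable lborel {0..} (\<lambda>u. Q u * theta_kernel u)"
  proof -
    have "set_integrable lborel {0..} (\<lambda>u. (162/100 + 162/100000) * (u ^ 0 * theta_kernel u) + 1/1000 * (u ^ 1 * theta_kernel u)
        + (- 1095/100) * (u ^ 2 * theta_kernel u) + 1215/100 * (u ^ 4 * theta_kernel u))"
      by (intro set_integral_add set_integrable_mult_right set_integrable_power_theta_kernel)
    also have "(\<lambda>u. (162/100 + 162/100000) * (u ^ 0 * theta_kernel u) + 1/1000 * (u ^ 1 * theta_kernel u)
        + (- 1095/100) * (u ^ 2 * theta_kernel u) + 1215/100 * (u ^ 4 * theta_kernel u)) = (\<lambda>u. Q u * theta_kernel u)"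
      by (simp add: Q_def q_def fun_eq_iff algebra_simps add_divide_distrib)
    finally show ?thesis .
  qed
  have "162/100 * (LINT u|lborel. cos (y * u) * theta_weight u) - (LINT u|lborel. u * sin (y * u) * theta_weight u)
      = (LINT u|lborel. qt u * theta_weight u)"
  proof -
    have "(LINT u|lborel. qt u * theta_weight u) = (LINT u|lborel. 162/100 * (cos (y * u) * theta_weight u) - u * sin (y * u) * theta_weight u)"
      by (simp add: qt_def left_diff_distrib mult.assoc)
    also have "\<dots> = 162/100 * (LINT u|lborel. cos (y * u) * theta_weight u) - (LINT u|lborel. u * sin (y * u) * theta_weight u)"
      by (subst Bochner_Integration.integral_diff)
         (intro integrable_mult_right integrable_cos_theta_weight integrable_sin_theta_weight | simp)+
    finally show ?thesis ..
  qed
  also have "\<dots> \<le> (LINT u:{0..}|lborel. Q u * theta_kernel u)"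
    unfolding set_lebesgue_integral_def
  proof (rule integral_mono)
    have "integrable lborel (\<lambda>u. 162/100 * (cos (y * u) * theta_weight u) - u * sin (y * u) * theta_weight u)"
      by (intro Bochner_Integration.integrable_diff integrable_mult_right integrable_cos_theta_weight integrable_sin_theta_weight)
    thus "integrable lborel (\<lambda>u. qt u * theta_weight u)" by (simp add: qt_def left_diff_distrib mult.assoc)
    show "integrable lborel (\<lambda>u. indicator {0..} u *\<^sub>R (Q u * theta_kernel u))"
      using int by (simp add: set_integrable_def)
    fix u :: real
    show "qt u * theta_weight u \<le> indicator {0..} u *\<^sub>R (Q u * theta_kernel u)"
    proof (cases "u \<ge> 0")
      case True
      define e where "e = theta_weight u - theta_kernel u"
      have e: "0 \<le> e" "e \<le> theta_kernel u / 1000" using theta_weight_bounds[OF True] by (auto simp: e_def)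
      have "qt u \<le> 162/100 + u"
      proof -
        have "- u \<le> u * sin (y * u)" using mult_left_mono[OF sin_ge_minus_one[of "y * u"] True] by simp
        thus ?thesis unfolding qt_def using cos_le_one[of "y * u"] by linarith
      qed
      hence "qt u * e \<le> (162/100 + u) * e" using e by (intro mult_right_mono) auto
      also have "\<dots> \<le> (162/100 + u) * (theta_kernel u / 1000)" using e True by (intro mult_left_mono) auto
      finally have "qt u * e \<le> (162/100 + u) / 1000 * theta_kernel u" by simp
      moreover have "qt u * theta_kernel u \<le> q u * theta_kernel u"
        using theta_kernel_pos[of u] by (intro mult_right_mono qt_le True) auto
      moreover have "qt u * theta_weight u = qt u * theta_kernel u + qt u * e" by (simp add: e_def algebra_simps)
      moreover have "Q u * theta_kernel u = q u * theta_kernel u + (162/100 + u) / 1000 * theta_kernel u"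
        by (simp only: Q_def distrib_right)
      ultimately show ?thesis using True by simp
    qed (simp add: theta_weight_def)
  qed
  also have "\<dots> \<le> (exp (- 0) * cert_poly 0 + 9/10000) * exp (- pi)"
  \<comment> \<open>The constant 9/10000 added to the certificate covers the extra term of
    \<open>Q\<close>, because pi exp u >= 3 (1 + u).\<close>
  proof (rule theta_kernel_integral_le[where f = "\<lambda>u. exp (- u) * cert_poly u + 9/10000"
        and f' = "\<lambda>u. exp (- u) * (cert_poly' u - cert_poly u)", OF _ _ int])
    fix u :: real assume u: "u \<ge> 0"
    show "((\<lambda>u. exp (- u) * cert_poly u + 9/10000) has_real_derivative exp (- u) * (cert_poly' u - cert_poly u)) (at u)"
    proof -
      have "(cert_poly has_real_derivative cert_poly' u) (at u)"
        unfolding cert_poly_def[abs_def] cert_poly'_def by (auto intro!: derivative_eq_intros)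
      thus ?thesis by (auto intro!: derivative_eq_intros simp: algebra_simps)
    qed
    have "(pi * exp u - 1 / 4) * (exp (- u) * cert_poly u + 9/10000) - exp (- u) * (cert_poly' u - cert_poly u)
       = (pi * cert_poly u * (exp u * exp (- u)) - exp (- u) * (cert_poly' u - 3/4 * cert_poly u)) + (pi * exp u - 1 / 4) * (9/10000)"
      by (simp add: algebra_simps)
    also have "exp u * exp (- u) = 1" by (simp add: exp_minus)
    also have "(pi * cert_poly u * 1 - exp (- u) * (cert_poly' u - 3/4 * cert_poly u)) + (pi * exp u - 1 / 4) * (9/10000) \<ge> q u + (162/100 + u) / 1000"
    proof -
      have "3 * (1 + u) \<le> pi * exp u" using pi_gt3 u exp_ge_add_one_self[of u] by (intro mult_mono) auto
      hence "(162/100 + u) / 1000 \<le> (pi * exp u - 1 / 4) * (9/10000)" using u by (simp add: field_simps)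
      from add_mono[OF cert_poly_ineq[OF u] this] show ?thesis by (simp add: q_def)
    qed
    finally show "Q u \<le> (pi * exp u - 1 / 4) * (exp (- u) * cert_poly u + 9/10000) - exp (- u) * (cert_poly' u - cert_poly u)"
      unfolding Q_def .
  next
    show "((\<lambda>u. (exp (- u) * cert_poly u + 9/10000) * theta_kernel u) \<longlongrightarrow> 0) at_top"
      unfolding theta_kernel_def cert_poly_def using pi_gt_zero by real_asymp
  qed
  also have "\<dots> = 2809/10000 * exp (- pi)" by (simp add: cert_poly_def)
  finally show ?thesis .
qed

text \<open>With y = t / 2 and P half the imaginary part of the digamma function, the left side is -
  \<open>zeta_deriv_im t\<close>. Its first factor is nonpositive, so P may be lowered to 81/100,
  and the certified bound on the transforms applies.\<close>

lemma stationary_point_inequality: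
  fixes y P :: real
  assumes y: "y > 0" "\<bar>y\<^sup>2 - pi\<^sup>2\<bar> \<le> 3 / 16" and P: "81/100 \<le> P"
  defines "C \<equiv> (LINT u|lborel. cos (y * u) * theta_weight u)"
    and "S \<equiv> (LINT u|lborel. u * sin (y * u) * theta_weight u)"
    and "D \<equiv> 1/4 + 4 * y\<^sup>2"
  shows "(2 * C - 1 / D) * P - S + 4 * y / D\<^sup>2 < 0"
proof -
  note b = near_pi_bounds[OF y]
  have D: "D > 0" "D \<le> 405/10" using b by (auto simp: D_def)
  have "C \<le> (LINT u|lborel. theta_weight u)"
    unfolding C_def
  proof (rule integral_mono[OF integrable_cos_theta_weight])
    show "integrable lborel theta_weight" using integrable_exp_theta_weight[of 0] by simp
    show "cos (y * u) * theta_weight u \<le> theta_weight u" for u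
      using mult_right_mono[OF cos_le_one theta_weight_nonneg, of "y * u" u] by simp
  qed
  hence C: "C \<le> 2805/10000 * (1/23)"
    using integral_theta_weight_le exp_neg_pi_le by linarith
  have "2 * C * D \<le> 1"
  proof -
    have "2 * C * D \<le> 2 * (2805/10000 * (1/23)) * D" using C D by (intro mult_right_mono) auto
    thus ?thesis using D by linarith
  qed
  hence "2 * C - 1 / D \<le> 0" using D by (simp add: field_simps)
  hence "(2 * C - 1 / D) * P \<le> (2 * C - 1 / D) * (81/100)" using P by (intro mult_left_mono_neg)
  moreover have "162/100 * C - S \<le> 2809/10000 * (1/23)"
    using cos_sin_transform_le[OF y] exp_neg_pi_le unfolding C_def S_def by linarith
  ultimately have "(2 * C - 1 / D) * P - S + 4 * y / D\<^sup>2 \<le> 2809/10000 * (1/23) - 81/100 * (1 / D) + 4 * y / D\<^sup>2"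
    by (simp add: left_diff_distrib)
  also have "\<dots> < 0"
  proof -
    \<comment> \<open>The variable y is bounded by its tangent as a function of y^2 at 3.14, and y^4
      by its chord in y^2. The remaining inequality is linear in y^2.\<close>
    have "(y - 314/100)\<^sup>2 \<ge> 0" by simp
    hence y1: "4 * y \<le> 4 * ((y\<^sup>2 + 98596/10000) / (628/100))" by (simp add: power2_eq_square algebra_simps)
    have "(y\<^sup>2 - 9682/1000) * (100572/10000 - y\<^sup>2) \<ge> 0" using b by (intro mult_nonneg_nonneg) auto
    hence y2: "y\<^sup>2 * y\<^sup>2 \<le> 197392/10000 * y\<^sup>2 - 9682/1000 * (100572/10000)" by (simp add: algebra_simps)
    have D2: "D\<^sup>2 = 1/16 + 2 * y\<^sup>2 + 16 * (y\<^sup>2 * y\<^sup>2)" unfolding D_def by algebra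
    have "2809/10000 * (1/23) * D\<^sup>2 + 4 * y < 81/100 * D"
    proof -
      have "2809/10000 * (1/23) * (1/16 + 2 * Y + 16 * Z) + w < 81/100 * (1/4 + 4 * Y)"
        if "w \<le> 4 * ((Y + 98596/10000) / (628/100))" "Z \<le> 197392/10000 * Y - 9682/1000 * (100572/10000)"
          "9682/1000 \<le> Y" "Y \<le> 100572/10000" for w Y Z :: real
        using that by (simp add: field_simps)
      from this[OF y1 y2 b(1,2)] show ?thesis unfolding D2 unfolding D_def .
    qed
    hence "(2809/10000 * (1/23) * D\<^sup>2 - 81/100 * D + 4 * y) / D\<^sup>2 < 0" using D by (intro divide_neg_pos) auto
    thus ?thesis using D by (simp add: add_divide_distrib diff_divide_distrib power2_eq_square)
  qed
  finally show ?thesis .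
qed

section \<open>Zeta and its derivative on the critical line\<close>

lemma Im_Digamma_quarter_uminus:
  "Im (Digamma (1 / 4 + \<i> * of_real (- y))) = - Im (Digamma (1 / 4 + \<i> * of_real y))"
proof (rule LIMSEQ_unique[OF Digamma_quarter_limits(2)])
  show "(\<lambda>m. \<Sum>n<m. - y / ((real n + 1/4)\<^sup>2 + (- y)\<^sup>2)) \<longlonglongrightarrow> - Im (Digamma (1 / 4 + \<i> * of_real y))"
    using tendsto_minus[OF Digamma_quarter_limits(2)[of y]] by (simp add: sum_negf)
qed

definition cos_transform :: "real \<Rightarrow> real" where
  "cos_transform y = (LINT u|lborel. cos (y * u) * theta_weight u)"

definition sin_transform :: "real \<Rightarrow> real" where
  "sin_transform y = (LINT u|lborel. u * sin (y * u) * theta_weight u)"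

lemma cos_transform_uminus: "cos_transform (- y) = cos_transform y"
  by (simp add: cos_transform_def)

lemma sin_transform_uminus: "sin_transform (- y) = - sin_transform y"
  by (simp add: sin_transform_def)

lemma cos_transform_0_less: "cos_transform 0 < 2"
proof -
  have "cos_transform 0 \<le> 2805/10000 * (1/23)"
    using integral_theta_weight_le exp_neg_pi_le by (simp add: cos_transform_def)
  thus ?thesis by simp
qed

lemma theta_transform_add_uminus:
  "theta_transform (\<i> * of_real y) + theta_transform (- (\<i> * of_real y)) = of_real (2 * cos_transform y)"
proof -
  have "theta_transform (\<i> * of_real y) + theta_transform (- (\<i> * of_real y)) =
      (LINT u|lborel. exp (\<i> * of_real y * of_real u) * of_real (theta_weight u) + exp (- (\<i> * of_real y) * of_real u) * of_real (theta_weight u))"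
    unfolding theta_transform_def
    by (rule Bochner_Integration.integral_add[symmetric]; rule integrable_theta_transform)
  also have "\<dots> = (LINT u|lborel. complex_of_real (2 * (cos (y * u) * theta_weight u)))"
  proof (intro Bochner_Integration.integral_cong refl)
    fix u :: real
    have "exp (\<i> * of_real y * of_real u) + exp (- (\<i> * of_real y) * of_real u) = complex_of_real (2 * cos (y * u))"
      by (simp add: cos_exp_eq cos_of_real[symmetric] mult.assoc)
    thus "exp (\<i> * of_real y * of_real u) * of_real (theta_weight u) + exp (- (\<i> * of_real y) * of_real u) * of_real (theta_weight u)
        = complex_of_real (2 * (cos (y * u) * theta_weight u))"
      by (metis distrib_right mult.assoc of_real_mult)
  qed
  also have "\<dots> = of_real (2 * cos_transform y)"
    unfolding integral_complex_of_real by (simp add: cos_transform_def)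
  finally show ?thesis .
qed

lemma theta_transform_deriv_diff:
  "(LINT u|lborel. of_real u * exp (\<i> * of_real y * of_real u) * complex_of_real (theta_weight u))
     - (LINT u|lborel. of_real u * exp (- (\<i> * of_real y) * of_real u) * complex_of_real (theta_weight u))
   = 2 * \<i> * of_real (sin_transform y)"
proof -
  have int: "integrable lborel (\<lambda>u. of_real u * exp (z * of_real u) * complex_of_real (theta_weight u))" for z
    by (rule Bochner_Integration.integrable_bound[OF integrable_power_exp_theta_weight[of 1 "Re z"]])
       (auto simp: norm_mult abs_mult)
  have "(LINT u|lborel. of_real u * exp (\<i> * of_real y * of_real u) * complex_of_real (theta_weight u))
     - (LINT u|lborel. of_real u * exp (- (\<i> * of_real y) * of_real u) * complex_of_real (theta_weight u))
    = (LINT u|lborel. of_real u * exp (\<i> * of_real y * of_real u) * complex_of_real (theta_weight u)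
     - of_real u * exp (- (\<i> * of_real y) * of_real u) * complex_of_real (theta_weight u))"
    by (rule Bochner_Integration.integral_diff[symmetric]; rule int)
  also have "\<dots> = (LINT u|lborel. 2 * \<i> * complex_of_real (u * sin (y * u) * theta_weight u))"
  proof (intro Bochner_Integration.integral_cong refl)
    fix u :: real
    have "exp (\<i> * of_real y * of_real u) - exp (- (\<i> * of_real y) * of_real u) = 2 * \<i> * complex_of_real (sin (y * u))"
    proof -
      have "exp (\<i> * of_real y * of_real u) = cis (y * u)" "exp (- (\<i> * of_real y) * of_real u) = cis (- (y * u))"
        by (simp_all add: cis_conv_exp mult.assoc)
      thus ?thesis by (simp add: complex_eq_iff)
    qed
    moreover have "of_real u * a * w - of_real u * b * w = of_real u * (a - b) * w" for a b w :: complex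
      by (simp add: algebra_simps)
    ultimately show "of_real u * exp (\<i> * of_real y * of_real u) * of_real (theta_weight u) - of_real u * exp (- (\<i> * of_real y) * of_real u) * of_real (theta_weight u)
        = 2 * \<i> * complex_of_real (u * sin (y * u) * theta_weight u)"
      by simp
  qed
  also have "\<dots> = 2 * \<i> * of_real (sin_transform y)"
    by (simp only: integral_mult_right_zero integral_complex_of_real sin_transform_def)
  finally show ?thesis .
qed

text \<open>With \<open>G = \<pi>\<^bsup>s/2\<^esup> / \<Gamma>(s/2)\<close> on the critical line, \<open>xi_line\<close> is \<open>\<zeta> / G\<close> and
  \<open>zeta_deriv_im\<close> is the imaginary part of \<open>\<zeta>' / G\<close>; the real part is \<open>- \<vartheta>' xi_line\<close>.\<close>

definition xi_line :: "real \<Rightarrow> real" where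
  "xi_line t = 2 * cos_transform (t / 2) - 1 / (1/4 + t\<^sup>2)"

definition zeta_deriv_im :: "real \<Rightarrow> real" where
  "zeta_deriv_im t = sin_transform (t / 2) - 2 * t / (1/4 + t\<^sup>2)\<^sup>2
     - xi_line t * (Im (Digamma (1 / 4 + \<i> * of_real t / 2)) / 2)"

lemma half_critical_line: "critical_line t / 2 = 1 / 4 + \<i> * of_real t / 2"
  by (simp add: critical_line_def add_divide_distrib)

lemma gamma_factor_nonzero: "gamma_factor (critical_line t) \<noteq> 0"
  using quarter_line_not_nonpos_Ints[of t]
  by (simp add: gamma_factor_def half_critical_line rGamma_eq_zero_iff)

lemma critical_line_nonzero: "critical_line t \<noteq> 0" "critical_line t \<noteq> 1" "critical_line t - 1 \<noteq> 0"
  by (auto simp: critical_line_def complex_eq_iff)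

lemma riemann_zeta_eq_gamma_factor:
  assumes "s \<noteq> 0" "s \<noteq> 1"
  shows "riemann_zeta s = gamma_factor s * (xi_entire s + 1 / (s - 1) - 1 / s)"
  using assms by (simp add: riemann_zeta_eq zeta_ext_eq_gamma_factor)

text \<open>On the critical line s (s - 1) is the real number - (1/4 + t^2), which makes the polar
  part real and its derivative imaginary.\<close>

lemma critical_line_fractions:
  fixes t :: real
  shows "1 / (critical_line t - 1) - 1 / critical_line t = - of_real (1 / (1/4 + t\<^sup>2))"
    and "1 / (critical_line t)\<^sup>2 - 1 / (critical_line t - 1)\<^sup>2 = - \<i> * of_real (2 * t / (1/4 + t\<^sup>2)\<^sup>2)"
proof -
  define s where "s = critical_line t"
  define D where "D = 1/4 + t\<^sup>2"
  have D: "D > 0" by (simp add: D_def add_pos_nonneg)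
  have s: "s \<noteq> 0" "s - 1 \<noteq> 0" unfolding s_def using critical_line_nonzero by auto
  have sD: "s * (s - 1) = - of_real D"
    by (simp add: s_def D_def critical_line_def complex_eq_iff power2_eq_square)
  have "1 / (s - 1) - 1 / s = 1 / (s * (s - 1))" using s by (simp add: divide_simps)
  also have "\<dots> = - of_real (1 / D)" unfolding sD by simp
  finally show "1 / (critical_line t - 1) - 1 / critical_line t = - of_real (1 / (1/4 + t\<^sup>2))"
    unfolding s_def D_def .
  have "1 / s\<^sup>2 - 1 / (s - 1)\<^sup>2 = ((s - 1)\<^sup>2 - s\<^sup>2) / (s * (s - 1))\<^sup>2"
    using s by (simp add: divide_simps power_mult_distrib)
  also have "(s - 1)\<^sup>2 - s\<^sup>2 = - \<i> * of_real (2 * t)"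
    by (simp add: s_def critical_line_def power2_eq_square algebra_simps)
  also have "(s * (s - 1))\<^sup>2 = of_real (D\<^sup>2)" unfolding sD by simp
  finally show "1 / (critical_line t)\<^sup>2 - 1 / (critical_line t - 1)\<^sup>2 = - \<i> * of_real (2 * t / (1/4 + t\<^sup>2)\<^sup>2)"
    unfolding s_def D_def by simp
qed

lemma centred_critical_line: "(critical_line t - 1 / 2) / 2 = \<i> * of_real (t / 2)"
  by (simp add: critical_line_def)

lemma completed_zeta_critical_line:
  "xi_entire (critical_line t) + 1 / (critical_line t - 1) - 1 / critical_line t = of_real (xi_line t)"
proof -
  have "xi_entire (critical_line t) = of_real (2 * cos_transform (t / 2))"
    unfolding xi_entire_def centred_critical_line by (rule theta_transform_add_uminus)
  moreover have "xi_entire (critical_line t) + 1 / (critical_line t - 1) - 1 / critical_line t =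
      xi_entire (critical_line t) + (1 / (critical_line t - 1) - 1 / critical_line t)" by simp
  ultimately show ?thesis unfolding critical_line_fractions by (simp add: xi_line_def)
qed

lemma riemann_zeta_critical_line:
  "riemann_zeta (critical_line t) = gamma_factor (critical_line t) * of_real (xi_line t)"
  using riemann_zeta_eq_gamma_factor[OF critical_line_nonzero(1,2)]
  unfolding completed_zeta_critical_line .

text \<open>The completed function is real on a vertical line, so its complex derivative there is
  purely imaginary.\<close>

lemma completed_zeta_deriv_critical_line:
  "((\<lambda>s. xi_entire s + 1 / (s - 1) - 1 / s) has_field_derivative
      \<i> * of_real (sin_transform (t / 2) - 2 * t / (1/4 + t\<^sup>2)\<^sup>2)) (at (critical_line t))"
proof -
  let ?s = "critical_line t"
  let ?F = "\<lambda>z. LINT u|lborel. of_real u * exp (z * of_real u) * complex_of_real (theta_weight u)"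
  have d: "((\<lambda>s. (s - 1 / 2) / 2) has_field_derivative 1 / 2) (at s)" for s :: complex
    by (auto intro!: derivative_eq_intros)
  have d': "((\<lambda>s. - ((s - 1 / 2) / 2)) has_field_derivative - (1 / 2)) (at s)" for s :: complex
    by (auto intro!: derivative_eq_intros)
  have 1: "(xi_entire has_field_derivative ?F ((?s - 1 / 2) / 2) * (1 / 2) + ?F (- ((?s - 1 / 2) / 2)) * (- (1 / 2))) (at ?s)"
    unfolding xi_entire_def[abs_def]
    by (intro DERIV_add DERIV_chain2[OF theta_transform_has_derivative d] DERIV_chain2[OF theta_transform_has_derivative d'])
  have "?F ((?s - 1 / 2) / 2) * (1 / 2) + ?F (- ((?s - 1 / 2) / 2)) * (- (1 / 2)) = (1 / 2) * (?F ((?s - 1 / 2) / 2) - ?F (- ((?s - 1 / 2) / 2)))"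
  proof -
    have "a * (1 / 2) + b * (- (1 / 2)) = (1 / 2) * (a - b)" for a b :: complex by (simp add: field_simps)
    thus ?thesis .
  qed
  also have "\<dots> = (1 / 2) * (2 * \<i> * of_real (sin_transform (t / 2)))"
    unfolding centred_critical_line theta_transform_deriv_diff ..
  finally have xi: "(xi_entire has_field_derivative \<i> * of_real (sin_transform (t / 2))) (at ?s)"
    using 1 by simp
  have 2: "((\<lambda>s. 1 / (s - 1)) has_field_derivative - (1 / (?s - 1)\<^sup>2)) (at ?s)"
    using critical_line_nonzero[of t] by (auto intro!: derivative_eq_intros simp: power2_eq_square)
  have 3: "((\<lambda>s. 1 / s) has_field_derivative - (1 / ?s\<^sup>2)) (at ?s)"
    using critical_line_nonzero[of t] by (auto intro!: derivative_eq_intros simp: power2_eq_square)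
  have "((\<lambda>s. xi_entire s + 1 / (s - 1) - 1 / s) has_field_derivative
      \<i> * of_real (sin_transform (t / 2)) + - (1 / (?s - 1)\<^sup>2) - - (1 / ?s\<^sup>2)) (at ?s)"
    by (rule DERIV_diff[OF DERIV_add[OF xi 2] 3])
  also have "\<i> * of_real (sin_transform (t / 2)) + - (1 / (?s - 1)\<^sup>2) - - (1 / ?s\<^sup>2) =
      \<i> * of_real (sin_transform (t / 2)) + (1 / ?s\<^sup>2 - 1 / (?s - 1)\<^sup>2)" by simp
  also have "\<dots> = \<i> * of_real (sin_transform (t / 2) - 2 * t / (1/4 + t\<^sup>2)\<^sup>2)"
    unfolding critical_line_fractions by (simp add: right_diff_distrib)
  finally show ?thesis .
qed

text \<open>The logarithmic derivative of \<open>gamma_factor\<close> is (ln pi - psi(s/2)) / 2,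
  where psi is the digamma function. Its real part on the line is - theta', while its imaginary part
  joins the derivative of the completed function.\<close>

lemma deriv_riemann_zeta_critical_line:
  "deriv riemann_zeta (critical_line t) = gamma_factor (critical_line t) *
     (of_real (- deriv riemann_siegel_theta t * xi_line t) + \<i> * of_real (zeta_deriv_im t))"
proof (rule DERIV_imp_deriv)
  let ?s = "critical_line t"
  define \<psi> :: complex where "\<psi> = Digamma (1 / 4 + \<i> * of_real t / 2)"
  have np: "?s / 2 \<notin> \<int>\<^sub>\<le>\<^sub>0" unfolding half_critical_line by (rule quarter_line_not_nonpos_Ints)
  have e: "((\<lambda>s. exp (s / 2 * of_real (ln pi))) has_field_derivative exp (?s / 2 * of_real (ln pi)) * (of_real (ln pi) / 2)) (at ?s)"
    by (auto intro!: derivative_eq_intros)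
  have r: "((\<lambda>s. rGamma (s / 2)) has_field_derivative (- rGamma (?s / 2) * \<psi>) * (1 / 2)) (at ?s)"
    unfolding \<psi>_def half_critical_line[symmetric]
  proof (rule DERIV_chain2[where f = rGamma and g = "\<lambda>s. s / 2"])
    show "(rGamma has_field_derivative - rGamma (?s / 2) * Digamma (?s / 2)) (at (?s / 2))"
      by (rule has_field_derivative_rGamma_no_nonpos_int[OF np])
  qed (auto intro!: derivative_eq_intros)
  have G: "(gamma_factor has_field_derivative gamma_factor ?s * ((of_real (ln pi) - \<psi>) / 2)) (at ?s)"
  proof -
    from DERIV_mult[OF e r] show ?thesis
      unfolding gamma_factor_def[abs_def] by (simp add: algebra_simps diff_divide_distrib)
  qed
  have "((\<lambda>s. gamma_factor s * (xi_entire s + 1 / (s - 1) - 1 / s)) has_field_derivative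
     gamma_factor ?s * ((of_real (ln pi) - \<psi>) / 2) * of_real (xi_line t) +
     (\<i> * of_real (sin_transform (t / 2) - 2 * t / (1/4 + t\<^sup>2)\<^sup>2)) * gamma_factor ?s) (at ?s)"
    using DERIV_mult[OF G completed_zeta_deriv_critical_line] unfolding completed_zeta_critical_line .
  also have "gamma_factor ?s * ((of_real (ln pi) - \<psi>) / 2) * of_real (xi_line t) +
     (\<i> * of_real (sin_transform (t / 2) - 2 * t / (1/4 + t\<^sup>2)\<^sup>2)) * gamma_factor ?s =
     gamma_factor ?s * (((of_real (ln pi) - \<psi>) / 2) * of_real (xi_line t) + \<i> * of_real (sin_transform (t / 2) - 2 * t / (1/4 + t\<^sup>2)\<^sup>2))"
    by (simp only: algebra_simps)
  also have "((of_real (ln pi) - \<psi>) / 2) * of_real (xi_line t) + \<i> * of_real (sin_transform (t / 2) - 2 * t / (1/4 + t\<^sup>2)\<^sup>2) =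
     of_real (- deriv riemann_siegel_theta t * xi_line t) + \<i> * of_real (zeta_deriv_im t)"
    by (simp add: complex_eq_iff deriv_riemann_siegel_theta zeta_deriv_im_def \<psi>_def algebra_simps diff_divide_distrib add_divide_distrib)
  finally have D: "((\<lambda>s. gamma_factor s * (xi_entire s + 1 / (s - 1) - 1 / s)) has_field_derivative
     gamma_factor ?s * (of_real (- deriv riemann_siegel_theta t * xi_line t) + \<i> * of_real (zeta_deriv_im t))) (at ?s)" .
  show "(riemann_zeta has_field_derivative
     gamma_factor ?s * (of_real (- deriv riemann_siegel_theta t * xi_line t) + \<i> * of_real (zeta_deriv_im t))) (at ?s)"
  proof (rule has_field_derivative_transform_within_open[OF D, where S = "- {0, 1}"])
    show "open (- {0, 1 :: complex})" by (intro open_Compl finite_imp_closed) auto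
    show "?s \<in> - {0, 1}" using critical_line_nonzero[of t] by auto
    show "gamma_factor s * (xi_entire s + 1 / (s - 1) - 1 / s) = riemann_zeta s" if "s \<in> - {0, 1}" for s
      using that riemann_zeta_eq_gamma_factor[of s] by auto
  qed
qed

section \<open>Zeros of theta' and of zeta' on the critical line\<close>

lemma zeta_deriv_im_uminus: "zeta_deriv_im (- t) = - zeta_deriv_im t"
proof -
  have xi: "xi_line (- t) = xi_line t" using cos_transform_uminus[of "t / 2"] by (simp add: xi_line_def)
  have "Im (Digamma (1 / 4 + \<i> * of_real (- t) / 2)) = - Im (Digamma (1 / 4 + \<i> * of_real t / 2))"
    using Im_Digamma_quarter_uminus[of "t / 2"] by simp
  thus ?thesis
    using sin_transform_uminus[of "t / 2"] by (simp add: zeta_deriv_im_def xi)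
qed

text \<open>Oddness of \<open>zeta_deriv_im\<close> reduces the claim to t > 0; the value t = 0 is
  excluded because (t/2)^2 lies within 3/16 of pi^2.\<close>

lemma stationary_theta_zeta_deriv_im_nonzero:
  assumes "deriv riemann_siegel_theta t = 0"
  shows "zeta_deriv_im t \<noteq> 0"
proof -
  have pos: "zeta_deriv_im t > 0" if t: "t > 0" "\<bar>(t / 2)\<^sup>2 - pi\<^sup>2\<bar> \<le> 3 / 16" for t
  proof -
    have P: "81/100 \<le> Im (Digamma (1 / 4 + \<i> * of_real t / 2)) / 2"
      using Im_Digamma_quarter_ge[of "t / 2"] t by simp
    have D: "1/4 + 4 * (t / 2)\<^sup>2 = 1/4 + t\<^sup>2" "4 * (t / 2) = 2 * t" by (simp_all add: power_divide)
    have "t / 2 > 0" using t(1) by simp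
    from stationary_point_inequality[OF this t(2) P]
    have "xi_line t * (Im (Digamma (1 / 4 + \<i> * of_real t / 2)) / 2) - sin_transform (t / 2) + 2 * t / (1/4 + t\<^sup>2)\<^sup>2 < 0"
      unfolding D xi_line_def cos_transform_def sin_transform_def .
    thus ?thesis unfolding zeta_deriv_im_def by linarith
  qed
  have "Re (Digamma (1 / 4 + \<i> * of_real (t / 2))) = ln pi"
    using assms by (simp add: deriv_riemann_siegel_theta)
  hence near: "\<bar>(t / 2)\<^sup>2 - pi\<^sup>2\<bar> \<le> 3 / 16" by (rule Re_Digamma_quarter_eq_ln_pi)
  show ?thesis
  proof (cases t "0 :: real" rule: linorder_cases)
    case less
    hence "zeta_deriv_im (- t) > 0" using near by (intro pos) auto
    thus ?thesis by (simp add: zeta_deriv_im_uminus)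
  next
    case equal
    have "pi\<^sup>2 \<ge> 3\<^sup>2" using pi_gt3 by (intro power_mono) auto
    with near equal show ?thesis by simp
  next
    case greater
    thus ?thesis using pos[of t] near by simp
  qed
qed

lemma deriv_zeta_zero_imp_xi_line_zero:
  assumes "deriv riemann_zeta (critical_line t) = 0"
  shows "xi_line t = 0"
proof (rule ccontr)
  assume xi: "xi_line t \<noteq> 0"
  have "of_real (- deriv riemann_siegel_theta t * xi_line t) + \<i> * of_real (zeta_deriv_im t) = (0::complex)"
    using assms gamma_factor_nonzero[of t] unfolding deriv_riemann_zeta_critical_line by simp
  hence "deriv riemann_siegel_theta t * xi_line t = 0" "zeta_deriv_im t = 0"
    by (simp_all add: complex_eq_iff)
  with xi stationary_theta_zeta_deriv_im_nonzero show False by auto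
qed

lemma xi_line_0_neg: "xi_line 0 < 0"
  using cos_transform_0_less by (simp add: xi_line_def)

lemma zeta_deriv_im_0: "zeta_deriv_im 0 = 0"
  using zeta_deriv_im_uminus[of 0] by simp

section \<open>The quotient and the phase\<close>

lemma holomorphic_riemann_zeta: "riemann_zeta holomorphic_on - {1}"
  by (rule holomorphic_transform[OF holomorphic_zeta_ext]) (auto simp: riemann_zeta_eq)

lemma connected_punctured_plane: "connected (- {1 :: complex})"
  by (rule connected_punctured_universe) simp

text \<open>A constant would have derivative zero at s = 1/2, forcing \<open>xi_line\<close> to
  vanish at 0. Nonconstancy is what gives every zero a finite order.\<close>

lemma riemann_zeta_not_constant: "\<not> riemann_zeta constant_on - {1}"
proof
  assume "riemann_zeta constant_on - {1}"
  then obtain c where c: "\<And>s. s \<noteq> 1 \<Longrightarrow> riemann_zeta s = c" unfolding constant_on_def by auto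
  have "deriv riemann_zeta (critical_line 0) = deriv (\<lambda>_. c) (critical_line 0)"
  proof (rule deriv_cong_ev)
    have "eventually (\<lambda>s. s \<in> - {1}) (nhds (critical_line 0))"
      using critical_line_nonzero[of 0] by (intro eventually_nhds_in_open) auto
    thus "eventually (\<lambda>s. riemann_zeta s = c) (nhds (critical_line 0))"
      by eventually_elim (auto simp: c)
  qed simp
  hence "deriv riemann_zeta (critical_line 0) = 0" by simp
  from deriv_zeta_zero_imp_xi_line_zero[OF this] show False using xi_line_0_neg by simp
qed

text \<open>The value 0 is the correct analytic one at a common zero of zeta and zeta', where zeta /
  zeta' has a zero.\<close>

definition zeta_ratio :: "complex \<Rightarrow> complex" where
  "zeta_ratio s = (if deriv riemann_zeta s = 0 then 0 else riemann_zeta s / deriv riemann_zeta s)"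

text \<open>At a zero of order \<open>n\<close>, \<open>\<zeta> = (s - a)\<^sup>n g\<close> gives \<open>\<zeta> / \<zeta>' = (s - a) g / (n g + (s - a) g')\<close>.\<close>

lemma zeta_ratio_local:
  assumes a: "a \<noteq> 1" and zero: "deriv riemann_zeta a = 0 \<Longrightarrow> riemann_zeta a = 0"
  obtains r where "r > 0" "zeta_ratio holomorphic_on ball a r"
    "\<And>s. s \<in> ball a r \<Longrightarrow> s \<noteq> a \<Longrightarrow> deriv riemann_zeta s \<noteq> 0"
proof (cases "deriv riemann_zeta a = 0")
  case False
  have hd: "deriv riemann_zeta holomorphic_on - {1}"
    by (intro holomorphic_deriv holomorphic_riemann_zeta) auto
  have "isCont (deriv riemann_zeta) a"
    using holomorphic_on_imp_continuous_on[OF hd] a by (simp add: continuous_on_eq_continuous_at open_Compl)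
  from continuous_at_avoid[OF this False] obtain e where e: "e > 0" "\<And>s. dist a s < e \<Longrightarrow> deriv riemann_zeta s \<noteq> 0"
    by blast
  define r where "r = min e (dist a 1)"
  have r: "r > 0" "ball a r \<subseteq> - {1}" using e a by (auto simp: r_def)
  have nz: "deriv riemann_zeta s \<noteq> 0" if "s \<in> ball a r" for s
    using that by (intro e) (simp add: r_def)
  have "(\<lambda>s. riemann_zeta s / deriv riemann_zeta s) holomorphic_on ball a r"
    using nz by (intro holomorphic_on_divide holomorphic_on_subset[OF holomorphic_riemann_zeta r(2)] holomorphic_on_subset[OF hd r(2)]) auto
  hence "zeta_ratio holomorphic_on ball a r"
    by (rule holomorphic_transform) (use nz in \<open>auto simp: zeta_ratio_def\<close>)
  with r(1) nz show ?thesis by (intro that[of r]) auto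
next
  case True
  obtain g r n where n: "0 < n" and r: "0 < r" "ball a r \<subseteq> - {1}" and g: "g holomorphic_on ball a r"
    and fact: "\<And>w. w \<in> ball a r \<Longrightarrow> riemann_zeta w = (w - a) ^ n * g w"
    and g0: "\<And>w. w \<in> ball a r \<Longrightarrow> g w \<noteq> 0"
    by (rule holomorphic_factor_zero_nonconstant[OF holomorphic_riemann_zeta _ connected_punctured_plane _
          zero[OF True] riemann_zeta_not_constant]) (use a in \<open>simp_all add: open_Compl\<close>)
  define k where "k = (\<lambda>s. of_nat n * g s + (s - a) * deriv g s)"
  have k_hol: "k holomorphic_on ball a r"
    unfolding k_def by (intro holomorphic_intros holomorphic_deriv g) auto
  have "isCont k a"
    using holomorphic_on_imp_continuous_on[OF k_hol] r by (simp add: continuous_on_eq_continuous_at)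
  moreover have "k a \<noteq> 0" using n g0[of a] r by (simp add: k_def)
  ultimately obtain e where e: "e > 0" "\<And>s. dist a s < e \<Longrightarrow> k s \<noteq> 0"
    using continuous_at_avoid by blast
  define R where "R = min e r"
  have R: "R > 0" "ball a R \<subseteq> ball a r" using e r by (auto simp: R_def)
  have k0: "k s \<noteq> 0" if "s \<in> ball a R" for s using that by (intro e) (simp add: R_def)
  have der: "deriv riemann_zeta s = (s - a) ^ (n - 1) * k s" if s: "s \<in> ball a r" for s
  proof (rule DERIV_imp_deriv)
    have "(g has_field_derivative deriv g s) (at s)"
      using holomorphic_derivI[OF g _ s] by simp
    hence "((\<lambda>w. (w - a) ^ n * g w) has_field_derivative (s - a) ^ (n - 1) * k s) (at s)"
    proof -
      assume g': "(g has_field_derivative deriv g s) (at s)"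
      have "((\<lambda>w. (w - a) ^ n) has_field_derivative of_nat n * (s - a) ^ (n - 1)) (at s)"
        by (auto intro!: derivative_eq_intros)
      from DERIV_mult[OF this g']
      have "((\<lambda>w. (w - a) ^ n * g w) has_field_derivative of_nat n * (s - a) ^ (n - 1) * g s + deriv g s * (s - a) ^ n) (at s)" .
      moreover have "(s - a) ^ n = (s - a) ^ (n - 1) * (s - a)"
        using n by (metis power_minus_mult)
      ultimately show ?thesis by (simp add: k_def algebra_simps)
    qed
    thus "(riemann_zeta has_field_derivative (s - a) ^ (n - 1) * k s) (at s)"
      by (rule has_field_derivative_transform_within_open[where S = "ball a r"]) (use s fact in auto)
  qed
  have nz: "deriv riemann_zeta s \<noteq> 0" if "s \<in> ball a R" "s \<noteq> a" for s
    using der[of s] k0[of s] that R by auto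
  have "(\<lambda>s. (s - a) * g s / k s) holomorphic_on ball a R"
    using k0 by (intro holomorphic_intros holomorphic_on_subset[OF g R(2)] holomorphic_on_subset[OF k_hol R(2)]) auto
  hence "zeta_ratio holomorphic_on ball a R"
  proof (rule holomorphic_transform)
    fix s assume s: "s \<in> ball a R"
    show "(s - a) * g s / k s = zeta_ratio s"
    proof (cases "s = a")
      case False
      have "(s - a) ^ n = (s - a) ^ (n - 1) * (s - a)"
        using n by (metis power_minus_mult)
      thus ?thesis using False der[of s] fact[of s] nz[OF s False] s R
        by (auto simp: zeta_ratio_def)
    qed (simp add: zeta_ratio_def True)
  qed
  with R(1) nz show ?thesis by (intro that[of R]) auto
qed

lemma deriv_zeta_zero_imp_zeta_zero:
  "deriv riemann_zeta (critical_line t) = 0 \<Longrightarrow> riemann_zeta (critical_line t) = 0"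
  by (simp add: riemann_zeta_critical_line deriv_zeta_zero_imp_xi_line_zero)

lemma dist_critical_line: "dist (critical_line x) (1 / 2 + \<i> * z) = dist (of_real x) z"
proof -
  have "critical_line x - (1 / 2 + \<i> * z) = \<i> * (of_real x - z)"
    by (simp add: critical_line_def algebra_simps)
  thus ?thesis by (simp add: dist_norm norm_mult)
qed

lemma real_analytic_zeta_ratio: "real_analytic (\<lambda>t. zeta_ratio (critical_line t))"
  unfolding real_analytic_complex_iff
proof
  fix x
  obtain r where r: "r > 0" "zeta_ratio holomorphic_on ball (critical_line x) r"
    using zeta_ratio_local[OF critical_line_nonzero(2) deriv_zeta_zero_imp_zeta_zero, of x] by blast
  have "zeta_ratio \<circ> (\<lambda>z. 1 / 2 + \<i> * z) holomorphic_on ball (of_real x) r"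
  proof (rule holomorphic_on_compose_gen[OF _ r(2)])
    show "(\<lambda>z. 1 / 2 + \<i> * z) ` ball (of_real x) r \<subseteq> ball (critical_line x) r"
      by (auto simp: dist_critical_line)
  qed (auto intro!: holomorphic_intros)
  with r(1) show "\<exists>r>0. \<exists>g. g holomorphic_on ball (of_real x) r \<and>
      (\<forall>y. \<bar>y - x\<bar> < r \<longrightarrow> zeta_ratio (critical_line y) = g (of_real y))"
    by (rule local_extensionI) (simp add: critical_line_def)
qed

text \<open>Around each point of the line zeta' has no other zero within some disc, so any two
  admissible extensions agree near the point and, by continuity, at it.\<close>

lemma zeta_quotient_eq: "zeta_quotient = (\<lambda>t. zeta_ratio (critical_line t))"
  unfolding zeta_quotient_def
proof (rule the_equality, intro conjI real_analytic_zeta_ratio allI impI)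
  show "zeta_ratio (critical_line t) = riemann_zeta (critical_line t) / deriv riemann_zeta (critical_line t)"
    if "deriv riemann_zeta (critical_line t) \<noteq> 0" for t
    using that by (simp add: zeta_ratio_def)
next
  fix q :: "real \<Rightarrow> complex"
  assume q: "real_analytic q \<and> (\<forall>t. deriv riemann_zeta (critical_line t) \<noteq> 0 \<longrightarrow>
       q t = riemann_zeta (critical_line t) / deriv riemann_zeta (critical_line t))"
  show "q = (\<lambda>t. zeta_ratio (critical_line t))"
  proof
    fix t
    obtain r where r: "r > 0" "\<And>s. s \<in> ball (critical_line t) r \<Longrightarrow> s \<noteq> critical_line t \<Longrightarrow> deriv riemann_zeta s \<noteq> 0"
      using zeta_ratio_local[OF critical_line_nonzero(2) deriv_zeta_zero_imp_zeta_zero, of t] by blast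
    have eq: "q x = zeta_ratio (critical_line x)" if "x \<noteq> t" "dist x t < r" for x
    proof -
      have "deriv riemann_zeta (critical_line x) \<noteq> 0"
      proof (rule r(2))
        have "dist (critical_line t) (critical_line x) = dist (of_real t) (complex_of_real x)"
          using dist_critical_line[of t "of_real x"] by (simp add: critical_line_def)
        thus "critical_line x \<in> ball (critical_line t) r"
          using that(2) by (simp add: dist_commute)
        show "critical_line x \<noteq> critical_line t" using that(1) by (simp add: critical_line_def)
      qed
      thus ?thesis using q by (simp add: zeta_ratio_def)
    qed
    have ev: "\<forall>\<^sub>F x in at t. q x = zeta_ratio (critical_line x)"
      unfolding eventually_at using r(1) eq by (intro exI[of _ r]) auto
    have c1: "(q \<longlongrightarrow> q t) (at t)"
      using real_analytic_imp_continuous[of q] q by (simp add: continuous_on_eq_continuous_at isCont_def)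
    have c2: "((\<lambda>x. zeta_ratio (critical_line x)) \<longlongrightarrow> zeta_ratio (critical_line t)) (at t)"
      using real_analytic_imp_continuous[OF real_analytic_zeta_ratio] by (simp add: continuous_on_eq_continuous_at isCont_def)
    have "((\<lambda>x. zeta_ratio (critical_line x)) \<longlongrightarrow> q t) (at t)"
      using c1 by (rule Lim_transform_eventually) (use ev in \<open>simp add: eq_commute\<close>)
    from tendsto_unique[OF _ this c2] show "q t = zeta_ratio (critical_line t)" by simp
  qed
qed

lemma phase_factor:
  defines "U \<equiv> \<lambda>t. 1 + 2 * of_real (deriv riemann_siegel_theta t) * zeta_quotient t"
  shows "real_analytic U" and "norm (U t) = 1" and "U 0 = - 1"
proof -
  show "real_analytic U"
    unfolding U_def zeta_quotient_eq
    by (intro real_analytic_add real_analytic_mult real_analytic_const real_analytic_deriv_riemann_siegel_theta real_analytic_zeta_ratio)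
  define p where "p = (\<lambda>t. deriv riemann_siegel_theta t * xi_line t)"
  define B where "B = (\<lambda>t. of_real (- p t) + \<i> * of_real (zeta_deriv_im t))"
  have Bz: "deriv riemann_zeta (critical_line t) = gamma_factor (critical_line t) * B t" for t
    by (simp add: deriv_riemann_zeta_critical_line B_def p_def)
  have U: "U t = (of_real (p t) + \<i> * of_real (zeta_deriv_im t)) / B t" if "B t \<noteq> 0" for t
  proof -
    have "zeta_quotient t = of_real (xi_line t) / B t"
      using that gamma_factor_nonzero[of t]
      by (simp add: zeta_quotient_eq zeta_ratio_def Bz riemann_zeta_critical_line)
    hence "U t = (B t + 2 * of_real (p t)) / B t"
      using that by (simp add: U_def p_def field_simps)
    thus ?thesis by (simp add: B_def)
  qed
  show "norm (U t) = 1"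
  proof (cases "B t = 0")
    \<comment> \<open>Here zeta' vanishes, the quotient takes its extended value 0, and the factor
      is 1.\<close>
    case True
    thus ?thesis by (simp add: U_def zeta_quotient_eq zeta_ratio_def Bz)
  next
    case False
    have "norm (of_real (p t) + \<i> * of_real (zeta_deriv_im t)) = norm (B t)"
      by (simp add: B_def cmod_def)
    thus ?thesis using U[OF False] False by (simp add: norm_divide)
  qed
  have "B 0 \<noteq> 0"
  proof
    assume "B 0 = 0"
    hence "xi_line 0 = 0" by (intro deriv_zeta_zero_imp_xi_line_zero) (simp add: Bz)
    thus False using xi_line_0_neg by simp
  qed
  moreover have "B 0 = - of_real (p 0)" by (simp add: B_def zeta_deriv_im_0)
  ultimately show "U 0 = - 1" using U[of 0] by (simp add: zeta_deriv_im_0)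
qed

text \<open>The first conjunct certifies that the definite description of
  \<open>zeta_quotient\<close> denotes the intended extension, so that the second conjunct speaks of
  it.\<close>

theorem proposition12:
  shows "(real_analytic zeta_quotient \<and>
          (\<forall>t. deriv riemann_zeta (critical_line t) \<noteq> 0 \<longrightarrow>
               zeta_quotient t =
                 riemann_zeta (critical_line t) / deriv riemann_zeta (critical_line t)) \<and>
          (\<forall>t. deriv riemann_zeta (critical_line t) = 0 \<longrightarrow>
               riemann_zeta (critical_line t) = 0 \<and> zeta_quotient t = 0)) \<and>
         (\<exists>!\<kappa> :: real \<Rightarrow> real.
            real_analytic \<kappa> \<and> \<kappa> 0 = - 1 / 2 \<and>
            (\<forall>t. exp (2 * of_real pi * \<i> * of_real (\<kappa> t)) =
                 1 + 2 * of_real (deriv riemann_siegel_theta t) * zeta_quotient t))"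
proof (intro conjI allI impI)
  show "real_analytic zeta_quotient"
    unfolding zeta_quotient_eq by (rule real_analytic_zeta_ratio)
  show "zeta_quotient t = riemann_zeta (critical_line t) / deriv riemann_zeta (critical_line t)"
    if "deriv riemann_zeta (critical_line t) \<noteq> 0" for t
    using that by (simp add: zeta_quotient_eq zeta_ratio_def)
  show "riemann_zeta (critical_line t) = 0" if "deriv riemann_zeta (critical_line t) = 0" for t
    using that by (rule deriv_zeta_zero_imp_zeta_zero)
  show "zeta_quotient t = 0" if "deriv riemann_zeta (critical_line t) = 0" for t
    using that by (simp add: zeta_quotient_eq zeta_ratio_def)
next
  let ?U = "\<lambda>t. 1 + 2 * of_real (deriv riemann_siegel_theta t) * zeta_quotient t"
  have rescale: "exp (2 * of_real pi * \<i> * of_real x) = exp (\<i> * of_real (2 * pi * x))" for x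
    by (simp add: mult_ac)
  \<comment> \<open>Among the phases of - 1 the value - pi is selected, because after division by 2
    pi it gives - 1/2.\<close>
  have "?U 0 = exp (\<i> * of_real (- pi))"
    unfolding phase_factor(3) by (simp add: exp_minus)
  from real_analytic_phase_exists[OF phase_factor(1,2) this]
  obtain f where f: "real_analytic f" "f 0 = - pi" "\<And>t. ?U t = exp (\<i> * of_real (f t))" by blast
  show "\<exists>!\<kappa> :: real \<Rightarrow> real. real_analytic \<kappa> \<and> \<kappa> 0 = - 1 / 2 \<and>
            (\<forall>t. exp (2 * of_real pi * \<i> * of_real (\<kappa> t)) = ?U t)"
  proof (rule ex1I[of _ "\<lambda>t. f t / (2 * pi)"], intro conjI allI)
    show "real_analytic (\<lambda>t. f t / (2 * pi))"
      by (rule real_analytic_linear[OF bounded_linear_divide f(1)])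
    show "f 0 / (2 * pi) = - 1 / 2" by (simp add: f(2))
    show "exp (2 * of_real pi * \<i> * of_real (f t / (2 * pi))) = ?U t" for t
      unfolding rescale f(3) by simp
  next
    fix \<kappa> :: "real \<Rightarrow> real"
    assume \<kappa>: "real_analytic \<kappa> \<and> \<kappa> 0 = - 1 / 2 \<and> (\<forall>t. exp (2 * of_real pi * \<i> * of_real (\<kappa> t)) = ?U t)"
    have "(\<lambda>t. 2 * pi * \<kappa> t) = f"
    proof (rule continuous_phase_unique)
      show "continuous_on UNIV (\<lambda>t. 2 * pi * \<kappa> t)"
        using \<kappa> by (intro continuous_intros real_analytic_imp_continuous_real) blast
      show "continuous_on UNIV f" by (rule real_analytic_imp_continuous_real[OF f(1)])
      show "exp (\<i> * of_real (2 * pi * \<kappa> t)) = exp (\<i> * of_real (f t))" for t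
        using \<kappa> f(3)[of t] unfolding rescale by metis
      show "2 * pi * \<kappa> 0 = f 0" using \<kappa> f(2) by simp
    qed
    from fun_cong[OF this] show "\<kappa> = (\<lambda>t. f t / (2 * pi))" by (auto simp: fun_eq_iff field_simps)
  qed
qed

end
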